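(* Let $p=a_0(\mathbf{X})+a_1(\mathbf{X})T+\dots+a_n(\mathbf{X})T^n\in\mathbb{C}[\mathbf{X}][T]$ with $a_n\neq 0$ in $\mathbb{C}[\mathbf{X}]$. If $V(C_{\mathbf{X}}(p))\cap i\mathbb{R}^d=\emptyset$, then $N_{\mathcal{L}(\mathcal{D}(\mathbb{R}),\mathcal{S}'(\mathbb{R}^d))}(p)=\{0\}$.
   Context: $\mathbf{X}=(X_1,\dots,X_d)$; coordinates on $\mathbb{R}^{d+1}$ are $(\mathbf{x},t)$. $\mathcal{L}(\mathcal{D}(\mathbb{R}),\mathcal{S}'(\mathbb{R}^d))$ is the space of continuous linear maps from $\mathcal{D}(\mathbb{R})$ (inductive limit topology) to $\mathcal{S}'(\mathbb{R}^d)$ (weak-* topology); each such $u$ is identified with the unique $U\in\mathcal{D}'(\mathbb{R}^{d+1})$ with $\langle U,\varphi\otimes\psi\rangle=\langle u(\varphi),\psi\rangle$ for $\varphi\in\mathcal{D}(\mathbb{R})$, $\psi\in\mathcal{D}(\mathbb{R}^d)$. $D_p=p\left(\frac{\partial}{\partial x_1},\dots,\frac{\partial}{\partial x_d},\frac{\partial}{\partial t}\right)$, and for a subspace $S\subset\mathcal{D}'(\mathbb{R}^{d+1})$, $N_S(p)=\{u\in S: D_pu=0,\ u|_{t<0}=0\}$ with $u|_{t<0}$ the restriction to $\{t<0\}$. $C_{\mathbf{X}}(p)$ is the ideal in $\mathbb{C}[\mathbf{X}]$ generated by $a_0,\dots,a_n$, and $V(I)=\{\boldsymbol{\xi}\in\mathbb{C}^d: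 q(\boldsymbol{\xi})=0\ \forall q\in I\}$. *)

theory Defs
  imports "HOL-Analysis.Analysis" "HOL-Library.Poly_Mapping"
    "HOL-Computational_Algebra.Polynomial"
begin

definition pdir :: "'a::euclidean_space \<Rightarrow> ('a \<Rightarrow> complex) \<Rightarrow> 'a \<Rightarrow> complex" where
  "pdir b f x = vector_derivative (\<lambda>s::real. f (x + s *\<^sub>R b)) (at 0)"

fun dlist :: "'a::euclidean_space list \<Rightarrow> ('a \<Rightarrow> complex) \<Rightarrow> 'a \<Rightarrow> complex" where
  "dlist [] f = f"
| "dlist (b # bs) f = pdir b (dlist bs f)"

definition smooth_fn :: "('a::euclidean_space \<Rightarrow> complex) \<Rightarrow> bool" where
  "smooth_fn f \<longleftrightarrow> (\<forall>bs. set bs \<subseteq> Basis \<longrightarrow>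
      continuous_on UNIV (dlist bs f) \<and>
      (\<forall>b\<in>Basis. \<forall>x. (\<lambda>s::real. dlist bs f (x + s *\<^sub>R b)) differentiable (at 0)))"

definition tsupport :: "('a::euclidean_space \<Rightarrow> complex) \<Rightarrow> 'a set" where
  "tsupport f = closure {x. f x \<noteq> 0}"

definition test_fn :: "('a::euclidean_space \<Rightarrow> complex) \<Rightarrow> bool" where
  "test_fn f \<longleftrightarrow> smooth_fn f \<and> compact (tsupport f)"

definition supnorm_N :: "nat \<Rightarrow> ('a::euclidean_space \<Rightarrow> complex) \<Rightarrow> real" where
  "supnorm_N N f = (SUP bx \<in> {(bs, x). set bs \<subseteq> Basis \<and> length bs \<le> N}.
       norm (dlist (fst bx) f (snd bx)))"

definition schwartz :: "('a::euclidean_space \<Rightarrow> complex) \<Rightarrow> bool" where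
  "schwartz f \<longleftrightarrow> smooth_fn f \<and> (\<forall>bs N. set bs \<subseteq> Basis \<longrightarrow>
      bounded (range (\<lambda>x. (1 + norm x) ^ N * norm (dlist bs f x))))"

definition schwartz_norm :: "nat \<Rightarrow> ('a::euclidean_space \<Rightarrow> complex) \<Rightarrow> real" where
  "schwartz_norm N f = (SUP bx \<in> {(bs, x). set bs \<subseteq> Basis \<and> length bs \<le> N}.
       (1 + norm (snd bx)) ^ N * norm (dlist (fst bx) f (snd bx)))"

text \<open>Distributions D'(R^n): linear functionals on test functions, continuous for the
  inductive limit topology (standard seminorm characterisation on each compact).\<close>
definition distribution :: "(('a::euclidean_space \<Rightarrow> complex) \<Rightarrow> complex) \<Rightarrow> bool" where
  "distribution U \<longleftrightarrow>
     (\<forall>f g c. test_fn f \<longrightarrow> test_fn g \<longrightarrow> U (\<lambda>x. c * f x + g x) = c * U f + U g) \<and>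
     (\<forall>K. compact K \<longrightarrow> (\<exists>C N. \<forall>f. test_fn f \<and> tsupport f \<subseteq> K \<longrightarrow>
          norm (U f) \<le> C * supnorm_N N f))"

definition tempered :: "(('a::euclidean_space \<Rightarrow> complex) \<Rightarrow> complex) \<Rightarrow> bool" where
  "tempered T \<longleftrightarrow>
     (\<forall>f g c. schwartz f \<longrightarrow> schwartz g \<longrightarrow> T (\<lambda>x. c * f x + g x) = c * T f + T g) \<and>
     (\<exists>C N. \<forall>f. schwartz f \<longrightarrow> norm (T f) \<le> C * schwartz_norm N f)"

text \<open>L(D(R), S'(R^d)) with S' carrying the weak-* topology: u maps test functions to
  tempered distributions, and continuity into the weak-* topology means that every
  evaluation phi |-> <u(phi), psi> is a distribution on R.  Elements are represented
  extensionally (value 0 outside the test-function / Schwartz domains).\<close>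
definition Lmaps :: "((real \<Rightarrow> complex) \<Rightarrow> (real^'d \<Rightarrow> complex) \<Rightarrow> complex) set" where
  "Lmaps = {u. (\<forall>\<phi>. test_fn \<phi> \<longrightarrow> tempered (u \<phi>)) \<and>
               (\<forall>\<psi>. schwartz \<psi> \<longrightarrow> distribution (\<lambda>\<phi>. u \<phi> \<psi>)) \<and>
               (\<forall>\<phi> \<psi>. \<not> (test_fn \<phi> \<and> schwartz \<psi>) \<longrightarrow> u \<phi> \<psi> = 0)}"

definition represents ::
  "(((real^'d) \<times> real \<Rightarrow> complex) \<Rightarrow> complex) \<Rightarrow>
   ((real \<Rightarrow> complex) \<Rightarrow> (real^'d \<Rightarrow> complex) \<Rightarrow> complex) \<Rightarrow> bool" where
  "represents U u \<longleftrightarrow> (\<forall>\<phi> \<psi>. test_fn \<phi> \<longrightarrow> test_fn \<psi> \<longrightarrow>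
       U (\<lambda>(x, t). \<phi> t * \<psi> x) = u \<phi> \<psi>)"

type_synonym 'd mpoly = "('d \<Rightarrow>\<^sub>0 nat) \<Rightarrow>\<^sub>0 complex"

definition mpoly_eval :: "'d::finite mpoly \<Rightarrow> complex^'d \<Rightarrow> complex" where
  "mpoly_eval q \<xi> = (\<Sum>\<alpha>\<in>Poly_Mapping.keys q. Poly_Mapping.lookup q \<alpha> * (\<Prod>i\<in>UNIV. (\<xi> $ i) ^ Poly_Mapping.lookup (\<alpha>::'d \<Rightarrow>\<^sub>0 nat) i))"

definition CX :: "'d mpoly poly \<Rightarrow> 'd mpoly set" where
  "CX p = {q. \<exists>b. q = (\<Sum>j\<le>degree p. b j * coeff p j)}"

definition Vset :: "'d::finite mpoly set \<Rightarrow> (complex^'d) set" where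
  "Vset I = {\<xi>. \<forall>q\<in>I. mpoly_eval q \<xi> = 0}"

definition imag_Rd :: "(complex^'d) set" where
  "imag_Rd = {\<xi>. \<exists>y::real^'d. \<xi> = (\<chi> i. \<i> * complex_of_real (y $ i))}"

text \<open>List of x-directions (in R^(d+1) = R^d x R) realising the multi-index alpha
  (the order is irrelevant for smooth functions).\<close>
definition xdirs :: "('d::finite \<Rightarrow>\<^sub>0 nat) \<Rightarrow> ((real^'d) \<times> real) list" where
  "xdirs \<alpha> = (SOME bs. mset bs = (\<Sum>i\<in>UNIV. replicate_mset (Poly_Mapping.lookup \<alpha> i) (axis i 1, 0)))"

definition Dp_transpose :: "'d::finite mpoly poly \<Rightarrow> ((real^'d) \<times> real \<Rightarrow> complex) \<Rightarrow>
    ((real^'d) \<times> real \<Rightarrow> complex)" where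
  "Dp_transpose p f = (\<lambda>z. \<Sum>j\<le>degree p. \<Sum>\<alpha>\<in>Poly_Mapping.keys (coeff p j).
      Poly_Mapping.lookup (coeff p j) \<alpha> * (-1) ^ ((\<Sum>i\<in>UNIV. Poly_Mapping.lookup \<alpha> i) + j) *
      dlist (replicate j (0, 1) @ xdirs \<alpha>) f z)"

definition Dp_zero :: "'d::finite mpoly poly \<Rightarrow> (((real^'d) \<times> real \<Rightarrow> complex) \<Rightarrow> complex) \<Rightarrow> bool" where
  "Dp_zero p U \<longleftrightarrow> (\<forall>f. test_fn f \<longrightarrow> U (Dp_transpose p f) = 0)"

definition vanishes_neg :: "(((real^'d) \<times> real \<Rightarrow> complex) \<Rightarrow> complex) \<Rightarrow> bool" where
  "vanishes_neg U \<longleftrightarrow> (\<forall>f. test_fn f \<longrightarrow> tsupport f \<subseteq> {z. snd z < 0} \<longrightarrow> U f = 0)"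

definition N_L :: "'d::finite mpoly poly \<Rightarrow>
    ((real \<Rightarrow> complex) \<Rightarrow> (real^'d \<Rightarrow> complex) \<Rightarrow> complex) set" where
  "N_L p = {u \<in> Lmaps. \<exists>U. distribution U \<and> represents U u \<and> Dp_zero p U \<and> vanishes_neg U}"

end

theory Submission
  imports Defs
begin

text \<open>
  Taking the Fourier transform in \<open>x\<close> turns \<open>D\<^sub>p u = 0\<close> into an ordinary differential equation in \<open>t\<close>
  with coefficients \<open>a\<^sub>j(i\<xi>)\<close>, solved by a distribution \<open>w\<close> that vanishes for \<open>t < 0\<close>. Where the leading
  coefficient \<open>a\<^sub>n(i\<xi>)\<close> does not vanish, uniqueness for the equation gives \<open>w = 0\<close>. Hence \<open>w\<close> is carried by
  the zero set of \<open>a\<^sub>n\<close>, and being locally of finite order it is annihilated by a power of \<open>a\<^sub>n\<close>. On the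
  part annihilated by \<open>a\<^sub>n\<close> itself the equation has order at most \<open>n - 1\<close>, so an induction on the order
  and on the exponent shows that \<open>w\<close> is carried by the common zeros of all \<open>a\<^sub>j(i\<xi>)\<close>, of which there are
  none. All orders are uniform by a Banach-Steinhaus argument, and Fourier transforms of test functions
  are dense in the Schwartz space, so \<open>u = 0\<close>.
\<close>

subsection \<open>Smooth functions\<close>

text \<open>The support condition is what makes the equation in \<open>t\<close> uniquely solvable.
  Since \<open>u\<close> vanishes for negative times, a test function may be altered freely in the
  past, so \<open>u\<close> extends to functions that merely vanish for large \<open>t\<close>. On
  these the transposed time derivative has the inverse \<open>future_integral\<close>, whose powers
  decay faster than any geometric sequence on bounded intervals; where \<open>a n\<close> is
  invertible the equation can be iterated until nothing is left. Near the zeros of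
  \<open>a n\<close> the finite order takes over: a pairing of order \<open>N\<close> sees
  \<open>N\<close> derivatives only, and a high power of \<open>a n\<close> is small there together
  with these derivatives.

  The obstacle is that \<open>u\<close> is continuous in each argument separately, while the
  induction needs one finite order for time and frequency together. Frequencies are therefore
  confined to a compact set by a fixed test function \<open>g\<close>, and \<open>u\<close> is
  probed with the transforms of the products \<open>\<lambda>\<xi>. g \<xi> * h \<xi>\<close>, where
  \<open>h\<close> is an arbitrary smooth multiplier. All transforms act on test functions, and the
  distribution side enters only through the bilinear quantity \<open>w \<phi> h\<close>.\<close>

abbreviation has_pdir :: "'a::euclidean_space \<Rightarrow> ('a \<Rightarrow> complex) \<Rightarrow> 'a \<Rightarrow> complex \<Rightarrow> bool" where
  "has_pdir b f x D \<equiv> ((\<lambda>s::real. f (x + s *\<^sub>R b)) has_vector_derivative D) (at 0)"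

lemma has_pdir_imp: "has_pdir b f x D \<Longrightarrow> pdir b f x = D"
  unfolding pdir_def by (rule vector_derivative_at)

text \<open>Smoothness is a greatest fixed point: a class of continuous functions that contains,
  with each member, its partial derivatives contains every \<open>dlist bs f\<close> as well. Proofs
  of smoothness then only exhibit such a class \<open>P\<close> and first derivatives, and never
  compute iterated ones.\<close>

lemma smooth_fn_coinduct:
  assumes "P f"
    and cont: "\<And>f. P f \<Longrightarrow> continuous_on UNIV f"
    and step: "\<And>f b. P f \<Longrightarrow> b \<in> Basis \<Longrightarrow> \<exists>f'. P f' \<and> (\<forall>x. has_pdir b f x (f' x))"
  shows "smooth_fn f"
proof -
  have *: "P (dlist bs f)" if "set bs \<subseteq> Basis" for bs
    using that
  proof (induction bs)
    case (Cons b bs)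
    then obtain f' where "P f'" "\<forall>x. has_pdir b (dlist bs f) x (f' x)"
      using step[of "dlist bs f" b] by auto
    then have "pdir b (dlist bs f) = f'" by (auto intro!: has_pdir_imp)
    then show ?case using \<open>P f'\<close> by simp
  qed (simp add: assms(1))
  show ?thesis
    unfolding smooth_fn_def
  proof (intro allI impI conjI ballI)
    fix bs :: "'a list" and b x :: 'a
    assume bs: "set bs \<subseteq> Basis" and b: "b \<in> Basis"
    then show "(\<lambda>s::real. dlist bs f (x + s *\<^sub>R b)) differentiable (at 0)"
      using step[OF *[OF bs] b] differentiableI_vector by blast
  qed (auto intro: cont *)
qed

lemma dlist_append: "dlist (bs @ cs) f = dlist bs (dlist cs f)"
  by (induction bs) auto

lemma smooth_fn_dlist:
  assumes "smooth_fn f" "set cs \<subseteq> Basis"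
  shows "smooth_fn (dlist cs f)"
  using assms unfolding smooth_fn_def dlist_append[symmetric]
  by (metis Un_subset_iff set_append)

lemma smooth_fn_pdir: "smooth_fn f \<Longrightarrow> b \<in> Basis \<Longrightarrow> smooth_fn (pdir b f)"
  using smooth_fn_dlist[of f "[b]"] by simp

lemma smooth_fn_continuous: "smooth_fn f \<Longrightarrow> continuous_on UNIV f"
  unfolding smooth_fn_def by (metis dlist.simps(1) empty_set empty_subsetI)

lemma smooth_fn_isCont: "smooth_fn f \<Longrightarrow> isCont f x"
  using smooth_fn_continuous continuous_on_eq_continuous_at by blast

lemma smooth_fn_has_pdir: "smooth_fn f \<Longrightarrow> b \<in> Basis \<Longrightarrow> has_pdir b f x (pdir b f x)"
  unfolding pdir_def smooth_fn_def vector_derivative_works[symmetric]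
  by (metis dlist.simps(1) empty_set empty_subsetI)

lemma has_vector_derivative_affine:
  assumes "(f has_vector_derivative D) (at (a + c * s))"
  shows "((\<lambda>s::real. f (a + c * s)) has_vector_derivative c *\<^sub>R D) (at s)"
proof -
  have "((\<lambda>s. a + c * s) has_vector_derivative c) (at s)"
    unfolding has_real_derivative_iff_has_vector_derivative[symmetric]
    by (auto intro!: derivative_eq_intros)
  from vector_diff_chain_at[OF this assms] show ?thesis by (simp add: o_def)
qed

lemma has_pdir_line:
  assumes "\<And>x. has_pdir b f x (f' x)"
  shows "((\<lambda>s::real. f (x + s *\<^sub>R b)) has_vector_derivative f' (x + s *\<^sub>R b)) (at s)"
proof -
  have "((\<lambda>h::real. f ((x + s *\<^sub>R b) + h *\<^sub>R b)) has_vector_derivative f' (x + s *\<^sub>R b)) (at (- s + 1 * s))"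
    using assms[of "x + s *\<^sub>R b"] by simp
  from has_vector_derivative_affine[OF this]
  have "((\<lambda>h. f ((x + s *\<^sub>R b) + (- s + h) *\<^sub>R b)) has_vector_derivative f' (x + s *\<^sub>R b)) (at s)"
    by simp
  then show ?thesis by (simp add: algebra_simps)
qed

lemma has_pdir_add: "has_pdir b f x f' \<Longrightarrow> has_pdir b g x g' \<Longrightarrow> has_pdir b (\<lambda>x. f x + g x) x (f' + g')"
  by (rule has_vector_derivative_add)

lemma has_pdir_mult:
  assumes "has_pdir b f x f'" "has_pdir b g x g'"
  shows "has_pdir b (\<lambda>x. f x * g x) x (f' * g x + f x * g')"
  using has_vector_derivative_mult[OF assms] by (simp add: algebra_simps)

lemma has_pdir_comp:
  fixes F :: "real \<Rightarrow> complex"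
  assumes "\<And>t. has_pdir 1 F t (F' t)" "((\<lambda>s::real. q (x + s *\<^sub>R b)) has_vector_derivative q') (at 0)"
  shows "has_pdir b (\<lambda>x. F (q x)) x (of_real q' * F' (q x))"
proof -
  have "(F has_vector_derivative F' t) (at t)" for t
    using has_pdir_line[where b=1 and f=F and f'=F' and x=0 and s=t] assms(1) by simp
  then have "((F \<circ> (\<lambda>s::real. q (x + s *\<^sub>R b))) has_vector_derivative q' *\<^sub>R F' (q x)) (at 0)"
    by (intro vector_diff_chain_at assms(2)) simp
  then show ?thesis by (simp add: o_def scaleR_conv_of_real)
qed

section \<open>Closure of smooth functions under algebraic operations and composition\<close>

text \<open>Differentiating one operation produces others (a product gives a sum, an inverse gives
  products), so all operations are closed up simultaneously and the whole class is fed into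
  \<open>smooth_fn_coinduct\<close>. Composition passes through \<open>Re\<close> because the outer
  function lives on the real line.\<close>

inductive smooth_closure :: "('a::euclidean_space \<Rightarrow> complex) \<Rightarrow> bool" where
  base: "smooth_fn f \<Longrightarrow> smooth_closure f"
| const: "smooth_closure (\<lambda>x. c)"
| add: "smooth_closure f \<Longrightarrow> smooth_closure g \<Longrightarrow> smooth_closure (\<lambda>x. f x + g x)"
| mult: "smooth_closure f \<Longrightarrow> smooth_closure g \<Longrightarrow> smooth_closure (\<lambda>x. f x * g x)"
| cnj: "smooth_closure f \<Longrightarrow> smooth_closure (\<lambda>x. cnj (f x))"
| comp: "smooth_fn F \<Longrightarrow> smooth_closure f \<Longrightarrow> smooth_closure (\<lambda>x. F (Re (f x)))"
| inverse: "smooth_closure f \<Longrightarrow> (\<And>x. f x \<noteq> 0) \<Longrightarrow> smooth_closure (\<lambda>x. inverse (f x))"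

lemma smooth_closure_continuous: "smooth_closure f \<Longrightarrow> continuous_on UNIV f"
proof (induction rule: smooth_closure.induct)
  case (comp F f)
  have "continuous_on UNIV (\<lambda>x. Re (f x))" using comp by (intro continuous_intros)
  from continuous_on_compose2[OF smooth_fn_continuous[OF comp(1)] this] show ?case by simp
qed (auto intro!: continuous_intros simp: smooth_fn_continuous)

lemma smooth_closure_pdir:
  assumes "smooth_closure f" "b \<in> Basis"
  shows "\<exists>f'. smooth_closure f' \<and> (\<forall>x. has_pdir b f x (f' x))"
  using assms
proof (induction rule: smooth_closure.induct)
  case (base f)
  then show ?case using smooth_fn_has_pdir smooth_fn_pdir smooth_closure.base by blast
next
  case (const c)
  show ?case by (rule exI[of _ "\<lambda>x. 0"]) (auto intro: smooth_closure.const)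
next
  case (add f g)
  then obtain f' g' where *: "smooth_closure f'" "\<forall>x. has_pdir b f x (f' x)"
    "smooth_closure g'" "\<forall>x. has_pdir b g x (g' x)" by blast
  show ?case
    by (rule exI[of _ "\<lambda>x. f' x + g' x"]) (use * in \<open>auto intro!: smooth_closure.add has_pdir_add\<close>)
next
  case (mult f g)
  then obtain f' g' where *: "smooth_closure f'" "\<forall>x. has_pdir b f x (f' x)"
    "smooth_closure g'" "\<forall>x. has_pdir b g x (g' x)" by blast
  show ?case
    by (rule exI[of _ "\<lambda>x. f' x * g x + f x * g' x"])
      (use * mult in \<open>auto intro!: smooth_closure.add smooth_closure.mult has_pdir_mult\<close>)
next
  case (cnj f)
  then obtain f' where *: "smooth_closure f'" "\<forall>x. has_pdir b f x (f' x)" by blast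
  show ?case
    by (rule exI[of _ "\<lambda>x. cnj (f' x)"])
      (use * in \<open>auto intro!: smooth_closure.cnj has_vector_derivative_cnj\<close>)
next
  case (comp F f)
  then obtain f' where *: "smooth_closure f'" "\<forall>x. has_pdir b f x (f' x)" by blast
  have F: "has_pdir 1 F t (pdir 1 F t)" "smooth_fn (pdir 1 F)" for t
    using smooth_fn_has_pdir[OF comp(1), of 1 t] smooth_fn_pdir[OF comp(1), of 1] by auto
  have "((\<lambda>s::real. Re (f (x + s *\<^sub>R b))) has_vector_derivative Re (f' x)) (at 0)" for x
    using bounded_linear.has_vector_derivative[OF bounded_linear_Re, of "\<lambda>s. f (x + s *\<^sub>R b)"] * by blast
  from has_pdir_comp[of F, OF F(1) this]
  have "has_pdir b (\<lambda>x. F (Re (f x))) x (of_real (Re (f' x)) * pdir 1 F (Re (f x)))" for x .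
  \<comment> \<open>The chain rule produces a real part as a factor; it belongs to the class as half
    the sum of \<open>f'\<close> and its conjugate.\<close>
  moreover have "smooth_closure (\<lambda>x. (1/2) * (f' x + cnj (f' x)) * pdir 1 F (Re (f x)))"
    by (intro smooth_closure.mult smooth_closure.add smooth_closure.const smooth_closure.cnj * smooth_closure.comp[OF F(2)] comp(2))
  moreover have "(1/2) * (f' x + cnj (f' x)) = of_real (Re (f' x))" for x
    by (simp add: complex_add_cnj)
  ultimately show ?case by (intro exI[of _ "\<lambda>x. of_real (Re (f' x)) * pdir 1 F (Re (f x))"]) auto
next
  case (inverse f)
  then obtain f' where *: "smooth_closure f'" "\<forall>x. has_pdir b f x (f' x)" by blast
  have "has_pdir b (\<lambda>x. inverse (f x)) x ((-1) * f' x * (inverse (f x) * inverse (f x)))" for x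
  proof -
    have "((\<lambda>s. f (x + s *\<^sub>R b)) has_derivative (\<lambda>h. h *\<^sub>R f' x)) (at 0)"
      using * by (simp add: has_vector_derivative_def)
    from Deriv.has_derivative_inverse[OF _ this] inverse(2)
    show ?thesis by (simp add: has_vector_derivative_def algebra_simps)
  qed
  moreover have "smooth_closure (\<lambda>x. (-1) * f' x * (inverse (f x) * inverse (f x)))"
    by (intro smooth_closure.mult smooth_closure.const smooth_closure.inverse * inverse)
  ultimately show ?case by blast
qed

lemma smooth_closureD: "smooth_closure f \<Longrightarrow> smooth_fn f"
  using smooth_fn_coinduct[of smooth_closure f] smooth_closure_continuous smooth_closure_pdir by blast

named_theorems smooth_intros

lemma smooth_const [smooth_intros]: "smooth_fn (\<lambda>x. c)"
  by (rule smooth_closureD[OF smooth_closure.const])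

lemma smooth_add [smooth_intros]: "smooth_fn f \<Longrightarrow> smooth_fn g \<Longrightarrow> smooth_fn (\<lambda>x. f x + g x)"
  by (rule smooth_closureD[OF smooth_closure.add[OF smooth_closure.base smooth_closure.base]])

lemma smooth_mult [smooth_intros]: "smooth_fn f \<Longrightarrow> smooth_fn g \<Longrightarrow> smooth_fn (\<lambda>x. f x * g x)"
  by (rule smooth_closureD[OF smooth_closure.mult[OF smooth_closure.base smooth_closure.base]])

lemma smooth_cnj [smooth_intros]: "smooth_fn f \<Longrightarrow> smooth_fn (\<lambda>x. cnj (f x))"
  by (rule smooth_closureD[OF smooth_closure.cnj[OF smooth_closure.base]])

lemma smooth_comp: "smooth_fn F \<Longrightarrow> smooth_fn f \<Longrightarrow> smooth_fn (\<lambda>x. F (Re (f x)))"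
  by (rule smooth_closureD[OF smooth_closure.comp[OF _ smooth_closure.base]])

lemma smooth_inverse [smooth_intros]: "smooth_fn f \<Longrightarrow> (\<And>x. f x \<noteq> 0) \<Longrightarrow> smooth_fn (\<lambda>x. inverse (f x))"
  by (rule smooth_closureD[OF smooth_closure.inverse[OF smooth_closure.base]])

lemma smooth_divide [smooth_intros]:
  "smooth_fn f \<Longrightarrow> smooth_fn g \<Longrightarrow> (\<And>x. g x \<noteq> 0) \<Longrightarrow> smooth_fn (\<lambda>x. f x / g x)"
  unfolding divide_inverse by (intro smooth_intros)

lemma smooth_uminus [smooth_intros]: "smooth_fn f \<Longrightarrow> smooth_fn (\<lambda>x. - f x)"
  using smooth_mult[OF smooth_const[of "-1"], of f] by simp

lemma smooth_diff [smooth_intros]: "smooth_fn f \<Longrightarrow> smooth_fn g \<Longrightarrow> smooth_fn (\<lambda>x. f x - g x)"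
  using smooth_add[OF _ smooth_uminus, of f g] by simp

lemma smooth_power [smooth_intros]: "smooth_fn f \<Longrightarrow> smooth_fn (\<lambda>x. f x ^ k)"
  by (induction k) (auto intro: smooth_intros)

lemma smooth_sum [smooth_intros]: "(\<And>i. i \<in> I \<Longrightarrow> smooth_fn (f i)) \<Longrightarrow> smooth_fn (\<lambda>x. \<Sum>i\<in>I. f i x)"
  by (induction I rule: infinite_finite_induct) (auto intro: smooth_intros)

lemma smooth_prod [smooth_intros]: "(\<And>i. i \<in> I \<Longrightarrow> smooth_fn (f i)) \<Longrightarrow> smooth_fn (\<lambda>x. \<Prod>i\<in>I. f i x)"
  by (induction I rule: infinite_finite_induct) (auto intro: smooth_intros)

lemma pdir_const [simp]: "pdir b (\<lambda>x. c) = (\<lambda>x. 0)"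
  by (rule ext, rule has_pdir_imp) simp

lemma dlist_zero [simp]: "dlist bs (\<lambda>x. 0) = (\<lambda>x. 0)"
  by (induction bs) auto

lemma pdir_add: "smooth_fn f \<Longrightarrow> smooth_fn g \<Longrightarrow> b \<in> Basis \<Longrightarrow>
    pdir b (\<lambda>x. f x + g x) = (\<lambda>x. pdir b f x + pdir b g x)"
  by (rule ext, rule has_pdir_imp) (auto intro!: has_pdir_add smooth_fn_has_pdir)

lemma pdir_mult: "smooth_fn f \<Longrightarrow> smooth_fn g \<Longrightarrow> b \<in> Basis \<Longrightarrow>
    pdir b (\<lambda>x. f x * g x) = (\<lambda>x. pdir b f x * g x + f x * pdir b g x)"
  by (rule ext, rule has_pdir_imp) (auto intro!: has_pdir_mult smooth_fn_has_pdir)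

lemma pdir_cmult: "smooth_fn f \<Longrightarrow> b \<in> Basis \<Longrightarrow> pdir b (\<lambda>x. c * f x) = (\<lambda>x. c * pdir b f x)"
  using pdir_mult[OF smooth_const, of f b c] by simp

lemma dlist_add: "smooth_fn f \<Longrightarrow> smooth_fn g \<Longrightarrow> set bs \<subseteq> Basis \<Longrightarrow>
    dlist bs (\<lambda>x. f x + g x) = (\<lambda>x. dlist bs f x + dlist bs g x)"
  by (induction bs) (auto simp: pdir_add smooth_fn_dlist)

lemma dlist_cmult: "smooth_fn f \<Longrightarrow> set bs \<subseteq> Basis \<Longrightarrow> dlist bs (\<lambda>x. c * f x) = (\<lambda>x. c * dlist bs f x)"
  by (induction bs) (auto simp: pdir_cmult smooth_fn_dlist)

lemma dlist_uminus: "smooth_fn f \<Longrightarrow> set bs \<subseteq> Basis \<Longrightarrow> dlist bs (\<lambda>x. - f x) = (\<lambda>x. - dlist bs f x)"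
  using dlist_cmult[of f bs "-1"] by simp

lemma dlist_diff: "smooth_fn f \<Longrightarrow> smooth_fn g \<Longrightarrow> set bs \<subseteq> Basis \<Longrightarrow>
    dlist bs (\<lambda>x. f x - g x) = (\<lambda>x. dlist bs f x - dlist bs g x)"
  using dlist_add[OF _ smooth_uminus, of f g bs] by (simp add: dlist_uminus)

text \<open>If \<open>A\<close> maps coordinate lines to coordinate lines, possibly with speed
  \<open>c = 0\<close>, a partial derivative of \<open>f\<close> after \<open>A\<close> is a
  multiple of a partial derivative of \<open>f\<close>, again after \<open>A\<close>, so the form is
  stable. This covers dilations and translations as well as the two projections of a product
  space.\<close>

lemma smooth_affine:
  fixes A :: "'a::euclidean_space \<Rightarrow> 'b::euclidean_space"
  assumes "smooth_fn f" and contA: "continuous_on UNIV A"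
    and A: "\<And>b. b \<in> Basis \<Longrightarrow> \<exists>b'\<in>Basis. \<exists>c. \<forall>x s. A (x + s *\<^sub>R b) = A x + (c * s) *\<^sub>R b'"
  shows "smooth_fn (\<lambda>x. f (A x))"
proof (rule smooth_fn_coinduct[where P = "\<lambda>g. \<exists>f. smooth_fn f \<and> g = (\<lambda>x. f (A x))"])
  show "\<exists>h. smooth_fn h \<and> (\<lambda>x. f (A x)) = (\<lambda>x. h (A x))" using assms(1) by blast
next
  fix g assume "\<exists>f. smooth_fn f \<and> g = (\<lambda>x. f (A x))"
  then show "continuous_on UNIV g"
    using continuous_on_compose2[OF smooth_fn_continuous contA] by auto
next
  fix g and b :: 'a assume "\<exists>f. smooth_fn f \<and> g = (\<lambda>x. f (A x))" "b \<in> Basis"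
  then obtain f where f: "smooth_fn f" "g = (\<lambda>x. f (A x))" by blast
  from A[OF \<open>b \<in> Basis\<close>] obtain b' c where b': "b' \<in> Basis" "\<And>x s. A (x + s *\<^sub>R b) = A x + (c * s) *\<^sub>R b'"
    by blast
  have "has_pdir b g x (of_real c * pdir b' f (A x))" for x
  proof -
    have "((\<lambda>s. f (A x + s *\<^sub>R b')) has_vector_derivative pdir b' f (A x)) (at (0 + c * 0))"
      using smooth_fn_has_pdir[OF f(1) b'(1)] by simp
    from has_vector_derivative_affine[OF this]
    have "((\<lambda>s. f (A x + (c * s) *\<^sub>R b')) has_vector_derivative c *\<^sub>R pdir b' f (A x)) (at 0)"
      by simp
    then show ?thesis by (simp add: f(2) b'(2) scaleR_conv_of_real)
  qed
  moreover have "smooth_fn (\<lambda>y. of_real c * pdir b' f y)"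
    by (intro smooth_intros smooth_fn_pdir f b')
  ultimately show "\<exists>f'. (\<exists>f. smooth_fn f \<and> f' = (\<lambda>x. f (A x))) \<and> (\<forall>x. has_pdir b g x (f' x))"
    by (intro exI[of _ "\<lambda>x. of_real c * pdir b' f (A x)"] conjI) (auto)
qed

lemma pdir_affine:
  assumes "smooth_fn f" "b' \<in> Basis" "\<And>x s. A (x + s *\<^sub>R b) = A x + (c * s) *\<^sub>R b'"
  shows "pdir b (\<lambda>x. f (A x)) = (\<lambda>x. of_real c * pdir b' f (A x))"
proof (rule ext, rule has_pdir_imp)
  fix x
  have "((\<lambda>s. f (A x + s *\<^sub>R b')) has_vector_derivative pdir b' f (A x)) (at (0 + c * 0))"
    using smooth_fn_has_pdir[OF assms(1,2)] by simp
  from has_vector_derivative_affine[OF this]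
  have "((\<lambda>s. f (A x + (c * s) *\<^sub>R b')) has_vector_derivative c *\<^sub>R pdir b' f (A x)) (at 0)"
    by simp
  then show "has_pdir b (\<lambda>x. f (A x)) x (of_real c * pdir b' f (A x))"
    by (simp add: assms(3) scaleR_conv_of_real)
qed

lemma smooth_scale_shift:
  fixes a :: "'a::euclidean_space"
  assumes "smooth_fn f"
  shows "smooth_fn (\<lambda>x. f (a + c *\<^sub>R x))"
  using assms
proof (rule smooth_affine)
  show "\<exists>b'\<in>Basis. \<exists>c'. \<forall>x s. a + c *\<^sub>R (x + s *\<^sub>R b) = a + c *\<^sub>R x + (c' * s) *\<^sub>R b'"
    if "b \<in> Basis" for b :: 'a
    by (rule bexI[OF _ that], rule exI[of _ c]) (simp add: scaleR_add_right)
qed (auto intro!: continuous_intros)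

lemma smooth_linear:
  fixes L :: "'a::euclidean_space \<Rightarrow> real"
  assumes "bounded_linear L"
  shows "smooth_fn (\<lambda>x. complex_of_real (L x))"
proof (rule smooth_fn_coinduct[where P = "\<lambda>g. g = (\<lambda>x. complex_of_real (L x)) \<or> (\<exists>c. g = (\<lambda>x. c))"])
  show "continuous_on UNIV g" if "g = (\<lambda>x. complex_of_real (L x)) \<or> (\<exists>c. g = (\<lambda>x. c))" for g
    using that by (elim disjE exE) (simp_all add: continuous_on_of_real linear_continuous_on assms)
  show "\<exists>f'. (f' = (\<lambda>x. complex_of_real (L x)) \<or> (\<exists>c. f' = (\<lambda>x. c))) \<and> (\<forall>x. has_pdir b g x (f' x))"
    if "g = (\<lambda>x. complex_of_real (L x)) \<or> (\<exists>c. g = (\<lambda>x. c))" for g b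
    using that
  proof
    assume g: "g = (\<lambda>x. complex_of_real (L x))"
    have lin: "L (x + s *\<^sub>R b) = L x + L b * s" for x s
      using bounded_linear.linear[OF assms] by (simp add: linear_add linear_scale)
    have "((\<lambda>s. complex_of_real s) has_vector_derivative 1) (at (L x + L b * 0))" for x
      using has_vector_derivative_real_field[of "\<lambda>z. z" 1] DERIV_ident by blast
    from has_vector_derivative_affine[OF this]
    have "has_pdir b g x (L b *\<^sub>R 1)" for x
      unfolding g lin .
    then show ?thesis by (intro exI[of _ "\<lambda>x. L b *\<^sub>R 1"]) blast
  next
    assume "\<exists>c. g = (\<lambda>x. c)"
    then have "has_pdir b g x 0" for x by auto
    then show ?thesis by (intro exI[of _ "\<lambda>x. 0"]) blast
  qed
qed simp

lemma smooth_exp_linear: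
  assumes "bounded_linear L"
  shows "smooth_fn (\<lambda>x. exp (c * complex_of_real (L x)))"
proof -
  have *: "((\<lambda>z. k * exp (c * z)) has_field_derivative (k * c * exp (c * of_real x))) (at (of_real x))" for x :: real and k
  proof -
    have "((\<lambda>z. exp (c * z)) has_field_derivative exp (c * of_real x) * c) (at (of_real x))"
      by (rule DERIV_chain2[where f = exp, OF DERIV_exp]) (rule DERIV_cmult_Id)
    from DERIV_cmult[OF this, of k] show ?thesis by (simp add: mult_ac)
  qed
  have **: "has_pdir 1 (\<lambda>t. k * exp (c * complex_of_real t)) x (k * c * exp (c * of_real x))" for x k
    using has_vector_derivative_affine[of "\<lambda>t. k * exp (c * complex_of_real t)" "k * c * exp (c * of_real x)" x 1 0]
      has_vector_derivative_real_field[OF *[of k x]] by simp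
  have "smooth_fn (\<lambda>t::real. exp (c * complex_of_real t))"
  proof (rule smooth_fn_coinduct[where P = "\<lambda>g. \<exists>k. g = (\<lambda>t::real. k * exp (c * complex_of_real t))"])
    show "\<exists>k. (\<lambda>x. exp (c * complex_of_real x)) = (\<lambda>t. k * exp (c * complex_of_real t))"
      by (intro exI[of _ 1]) simp
    fix g :: "real \<Rightarrow> complex" and b :: real assume "\<exists>k. g = (\<lambda>t::real. k * exp (c * complex_of_real t))"
    then obtain k where g: "g = (\<lambda>t::real. k * exp (c * complex_of_real t))" by blast
    show "continuous_on UNIV g" unfolding g by (intro continuous_intros)
    assume "b \<in> Basis" then have b: "b = 1" by simp
    show "\<exists>f'. (\<exists>k. f' = (\<lambda>t. k * exp (c * complex_of_real t))) \<and> (\<forall>x. has_pdir b g x (f' x))"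
      unfolding g b by (intro exI[of _ "\<lambda>x. k * c * exp (c * complex_of_real x)"] conjI exI[of _ "k * c"] refl allI **)
  qed
  from smooth_comp[OF this smooth_linear[OF assms]] show ?thesis by (simp only: Re_complex_of_real)
qed

subsection \<open>Pointwise derivative bounds and cutoff functions\<close>

text \<open>A bound at a single point can be imposed on a subset only, and as a predicate it
  includes the finiteness that a supremum such as \<open>supnorm_N\<close> would leave to be
  checked.\<close>

definition pbound :: "nat \<Rightarrow> ('a::euclidean_space \<Rightarrow> complex) \<Rightarrow> 'a \<Rightarrow> real \<Rightarrow> bool" where
  "pbound N f x B \<longleftrightarrow> (\<forall>bs. set bs \<subseteq> Basis \<and> length bs \<le> N \<longrightarrow> norm (dlist bs f x) \<le> B)"

lemma pboundD: "pbound N f x B \<Longrightarrow> set bs \<subseteq> Basis \<Longrightarrow> length bs \<le> N \<Longrightarrow> norm (dlist bs f x) \<le> B"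
  by (auto simp: pbound_def)

lemma pbound_norm: "pbound N f x B \<Longrightarrow> norm (f x) \<le> B"
  using pboundD[of N f x B "[]"] by simp

lemma pbound_nonneg: "pbound N f x B \<Longrightarrow> 0 \<le> B"
  using pbound_norm norm_ge_zero order_trans by blast

lemma pbound_mono: "pbound N f x B \<Longrightarrow> N' \<le> N \<Longrightarrow> B \<le> B' \<Longrightarrow> pbound N' f x B'"
  unfolding pbound_def by (meson order_trans)

text \<open>The derivative split off is the innermost one, at the end of the list, so that the
  remaining ones act on \<open>pdir b f\<close>. This is the shape in which the product and chain
  rules can be used in an induction on \<open>N\<close>.\<close>

lemma pbound_Suc:
  "pbound (Suc N) f x B \<longleftrightarrow> norm (f x) \<le> B \<and> (\<forall>b\<in>Basis. pbound N (pdir b f) x B)"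
proof safe
  assume *: "pbound (Suc N) f x B"
  show "norm (f x) \<le> B" by (rule pbound_norm[OF *])
  fix b :: 'a assume "b \<in> Basis"
  then show "pbound N (pdir b f) x B"
    using pboundD[OF *, of "bs @ [b]" for bs] by (auto simp: pbound_def dlist_append)
next
  assume *: "norm (f x) \<le> B" "\<forall>b\<in>Basis. pbound N (pdir b f) x B"
  show "pbound (Suc N) f x B"
    unfolding pbound_def
  proof (intro allI impI)
    fix bs :: "'a list" assume bs: "set bs \<subseteq> Basis \<and> length bs \<le> Suc N"
    show "norm (dlist bs f x) \<le> B"
    proof (cases bs rule: rev_cases)
      case (snoc cs b)
      then show ?thesis using bs * by (auto simp: pbound_def dlist_append)
    qed (use * in simp)
  qed
qed

lemma pbound_0: "pbound 0 f x B \<longleftrightarrow> norm (f x) \<le> B"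
  by (auto simp: pbound_def)

lemma pbound_pdir: "pbound (Suc N) f x B \<Longrightarrow> b \<in> Basis \<Longrightarrow> pbound N (pdir b f) x B"
  by (simp add: pbound_Suc)

lemma pbound_add:
  assumes "smooth_fn f" "smooth_fn g" "pbound N f x A" "pbound N g x B"
  shows "pbound N (\<lambda>x. f x + g x) x (A + B)"
  unfolding pbound_def
  using pboundD[OF assms(3)] pboundD[OF assms(4)]
  by (auto simp: dlist_add[OF assms(1,2)] intro!: norm_triangle_mono)

lemma pbound_cmult:
  assumes "smooth_fn f" "pbound N f x A"
  shows "pbound N (\<lambda>x. c * f x) x (norm c * A)"
  unfolding pbound_def
  using pboundD[OF assms(2)]
  by (auto simp: dlist_cmult[OF assms(1)] norm_mult intro!: mult_left_mono)

lemma pbound_uminus: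
  assumes "smooth_fn f" "pbound N f x A"
  shows "pbound N (\<lambda>x. - f x) x A"
  using pbound_cmult[OF assms, of "-1"] by simp

lemma pbound_diff:
  assumes "smooth_fn f" "smooth_fn g" "pbound N f x A" "pbound N g x B"
  shows "pbound N (\<lambda>x. f x - g x) x (A + B)"
  using pbound_add[OF assms(1) smooth_uminus[OF assms(2)] assms(3) pbound_uminus[OF assms(2,4)]] by simp

text \<open>Each derivative of a product gives two products with one derivative fewer to go, hence
  \<open>2 ^ N\<close>.\<close>

lemma pbound_mult:
  assumes "smooth_fn f" "smooth_fn g" "pbound N f x A" "pbound N g x B"
  shows "pbound N (\<lambda>x. f x * g x) x (2 ^ N * A * B)"
  using assms
proof (induction N arbitrary: f g)
  case 0
  then show ?case by (auto simp: pbound_0 norm_mult intro!: mult_mono order_trans[OF norm_ge_zero])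
next
  case (Suc N)
  have nn: "0 \<le> A" "0 \<le> B" using Suc.prems pbound_nonneg by blast+
  have "norm (f x * g x) \<le> A * B"
    using pbound_norm[OF Suc.prems(3)] pbound_norm[OF Suc.prems(4)] nn
    by (simp add: norm_mult mult_mono)
  also have "\<dots> \<le> 2 ^ Suc N * (A * B)"
    using nn mult_right_mono[of 1 "2 ^ Suc N" "A * B"] by (simp del: power_Suc)
  finally have 1: "norm (f x * g x) \<le> 2 ^ Suc N * A * B" by (simp only: mult.assoc)
  have "pbound N (pdir b (\<lambda>x. f x * g x)) x (2 ^ Suc N * A * B)" if b: "b \<in> Basis" for b
  proof -
    have "pbound N (\<lambda>x. pdir b f x * g x) x (2 ^ N * A * B)"
      by (rule Suc.IH) (use Suc.prems b pbound_mono[OF Suc.prems(4), of N] in \<open>auto intro: smooth_fn_pdir pbound_pdir\<close>)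
    moreover have "pbound N (\<lambda>x. f x * pdir b g x) x (2 ^ N * A * B)"
      by (rule Suc.IH) (use Suc.prems b pbound_mono[OF Suc.prems(3), of N] in \<open>auto intro: smooth_fn_pdir pbound_pdir\<close>)
    ultimately have "pbound N (\<lambda>x. pdir b f x * g x + f x * pdir b g x) x (2 ^ N * A * B + 2 ^ N * A * B)"
      by (intro pbound_add smooth_intros smooth_fn_pdir Suc.prems b)
    then show ?thesis using Suc.prems b by (simp add: pdir_mult mult_ac)
  qed
  then show ?case using 1 by (simp add: pbound_Suc)
qed

lemma finite_Basis_lists: "finite {bs :: 'a::euclidean_space list. set bs \<subseteq> Basis \<and> length bs \<le> N}"
  using finite_lists_length_le[OF finite_Basis] by auto

lemma pbound_compact:
  fixes f :: "'a::euclidean_space \<Rightarrow> complex"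
  assumes "smooth_fn f" "compact X"
  obtains B where "0 \<le> B" "\<And>x. x \<in> X \<Longrightarrow> pbound N f x B"
proof -
  define D where "D = {bs :: 'a list. set bs \<subseteq> Basis \<and> length bs \<le> N}"
  have "\<exists>B\<ge>0. \<forall>x\<in>X. norm (dlist bs f x) \<le> B" if "bs \<in> D" for bs
  proof -
    have "continuous_on X (dlist bs f)"
      using smooth_fn_continuous[OF smooth_fn_dlist[OF assms(1), of bs]] that continuous_on_subset
      by (auto simp: D_def)
    then have "bounded (dlist bs f ` X)"
      using assms(2) compact_continuous_image compact_imp_bounded by blast
    then show ?thesis by (metis bounded_pos imageI less_eq_real_def)
  qed
  then obtain B where B: "\<And>bs. bs \<in> D \<Longrightarrow> 0 \<le> B bs \<and> (\<forall>x\<in>X. norm (dlist bs f x) \<le> B bs)" by metis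
  have fin: "finite D" unfolding D_def by (rule finite_Basis_lists)
  show thesis
  proof (rule that[of "\<Sum>bs\<in>D. B bs"])
    show "0 \<le> (\<Sum>bs\<in>D. B bs)" using B by (simp add: sum_nonneg)
    fix x assume "x \<in> X"
    then show "pbound N f x (\<Sum>bs\<in>D. B bs)"
      unfolding pbound_def
    proof (intro allI impI)
      fix bs :: "'a list" assume "set bs \<subseteq> Basis \<and> length bs \<le> N"
      then have bs: "bs \<in> D" by (simp add: D_def)
      then have "norm (dlist bs f x) \<le> B bs" using B \<open>x \<in> X\<close> by blast
      also have "\<dots> \<le> (\<Sum>bs\<in>D. B bs)" by (rule member_le_sum[OF bs _ fin]) (use B in auto)
      finally show "norm (dlist bs f x) \<le> (\<Sum>bs\<in>D. B bs)" .
    qed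
  qed
qed

text \<open>A short segment of the line through \<open>x\<close> in direction \<open>b\<close> stays
  in the open set \<open>S\<close>, so every directional derivative sees only values on
  \<open>S\<close>. The main use is that derivatives vanish off supports.\<close>

lemma dlist_local:
  assumes "open S" "\<And>x. x \<in> S \<Longrightarrow> f x = g x" "x \<in> S"
  shows "dlist bs f x = dlist bs g x"
  using assms(3)
proof (induction bs arbitrary: x)
  case (Cons b bs)
  have "open ((\<lambda>s::real. x + s *\<^sub>R b) -` S)"
    by (intro open_vimage assms(1) continuous_intros)
  moreover have "0 \<in> ((\<lambda>s::real. x + s *\<^sub>R b) -` S)" using Cons by simp
  ultimately have "\<forall>\<^sub>F s in nhds 0. dlist bs f (x + s *\<^sub>R b) = dlist bs g (x + s *\<^sub>R b)"
    unfolding eventually_nhds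
    by (intro exI[of _ "(\<lambda>s::real. x + s *\<^sub>R b) -` S"]) (auto intro: Cons.IH)
  then have "vector_derivative (\<lambda>s. dlist bs f (x + s *\<^sub>R b)) (at 0) = vector_derivative (\<lambda>s. dlist bs g (x + s *\<^sub>R b)) (at 0)"
    by (intro vector_derivative_cong_eq refl) (auto simp: eventually_at_filter elim: eventually_mono)
  then show ?case by (simp add: pdir_def)
qed (use assms in simp)

lemma dlist_scale_shift:
  fixes a :: "'a::euclidean_space"
  assumes "smooth_fn f" "set bs \<subseteq> Basis"
  shows "dlist bs (\<lambda>x. f (a + c *\<^sub>R x)) = (\<lambda>x. of_real c ^ length bs * dlist bs f (a + c *\<^sub>R x))"
  using assms(2)
proof (induction bs)
  case (Cons b bs)
  have "pdir b (\<lambda>x. dlist bs f (a + c *\<^sub>R x)) = (\<lambda>x. of_real c * pdir b (dlist bs f) (a + c *\<^sub>R x))"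
    using Cons by (intro pdir_affine smooth_fn_dlist assms(1)) (auto simp: algebra_simps)
  moreover have "smooth_fn (\<lambda>x. dlist bs f (a + c *\<^sub>R x))"
    using Cons by (intro smooth_scale_shift smooth_fn_dlist assms(1)) auto
  ultimately show ?case using Cons by (simp add: pdir_cmult mult_ac)
qed simp

lemma pbound_scale_shift:
  fixes a :: "'a::euclidean_space"
  assumes "smooth_fn f" "pbound N f (a + c *\<^sub>R x) B" "\<bar>c\<bar> \<le> 1"
  shows "pbound N (\<lambda>x. f (a + c *\<^sub>R x)) x B"
  unfolding pbound_def
proof (intro allI impI)
  fix bs :: "'a list" assume bs: "set bs \<subseteq> Basis \<and> length bs \<le> N"
  have "norm (of_real c ^ length bs * dlist bs f (a + c *\<^sub>R x)) \<le> 1 * B"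
    unfolding norm_mult norm_power
    using pboundD[OF assms(2), of bs] bs assms(3) by (intro mult_mono power_le_one) auto
  then show "norm (dlist bs (\<lambda>x. f (a + c *\<^sub>R x)) x) \<le> B"
    using bs by (simp add: dlist_scale_shift[OF assms(1)])
qed

lemma test_fnI:
  assumes "smooth_fn f" "bounded {x. f x \<noteq> 0}"
  shows "test_fn f"
  using assms unfolding test_fn_def tsupport_def by (simp add: compact_closure)

lemma test_fn_bounded: "test_fn f \<Longrightarrow> bounded {x. f x \<noteq> 0}"
  unfolding test_fn_def tsupport_def by (simp add: compact_closure)

lemma test_fn_smooth: "test_fn f \<Longrightarrow> smooth_fn f"
  by (simp add: test_fn_def)

lemma test_fn_iff: "test_fn f \<longleftrightarrow> smooth_fn f \<and> bounded {x. f x \<noteq> 0}"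
  using test_fnI test_fn_bounded test_fn_smooth by blast

lemma dlist_eq_0_outside:
  assumes "x \<notin> tsupport f"
  shows "dlist bs f x = 0"
proof -
  have "dlist bs f x = dlist bs (\<lambda>x. 0) x"
    by (rule dlist_local[of "- tsupport f"])
      (use assms closure_subset[of "{x. f x \<noteq> 0}"] in \<open>auto simp: tsupport_def\<close>)
  then show ?thesis by simp
qed

lemma tsupport_dlist: "{x. dlist bs f x \<noteq> 0} \<subseteq> tsupport f"
  using dlist_eq_0_outside by blast

lemma test_fn_dlist: "test_fn f \<Longrightarrow> set bs \<subseteq> Basis \<Longrightarrow> test_fn (dlist bs f)"
  unfolding test_fn_iff[of "dlist bs f"]
  by (metis compact_imp_bounded bounded_subset smooth_fn_dlist test_fn_def tsupport_dlist)

lemma test_fn_mult_left: "smooth_fn f \<Longrightarrow> test_fn g \<Longrightarrow> test_fn (\<lambda>x. f x * g x)"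
  unfolding test_fn_iff by (auto intro!: smooth_intros intro: bounded_subset[of "{x. g x \<noteq> 0}"])

lemma test_fn_mult_right: "test_fn f \<Longrightarrow> smooth_fn g \<Longrightarrow> test_fn (\<lambda>x. f x * g x)"
  unfolding test_fn_iff by (auto intro!: smooth_intros intro: bounded_subset[of "{x. f x \<noteq> 0}"])

lemma test_fn_add: "test_fn f \<Longrightarrow> test_fn g \<Longrightarrow> test_fn (\<lambda>x. f x + g x)"
  unfolding test_fn_iff
  by (auto intro!: smooth_intros intro: bounded_subset[of "{x. f x \<noteq> 0} \<union> {x. g x \<noteq> 0}"])

lemma test_fn_zero: "test_fn (\<lambda>x. 0)"
  unfolding test_fn_iff by (auto intro: smooth_const)

lemma test_fn_cmult: "test_fn g \<Longrightarrow> test_fn (\<lambda>x. c * g x)"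
  by (intro test_fn_mult_left smooth_const)

lemma test_fn_diff: "test_fn f \<Longrightarrow> test_fn g \<Longrightarrow> test_fn (\<lambda>x. f x - g x)"
  using test_fn_add[OF _ test_fn_cmult, of f g "-1"] by simp

lemma test_fn_sum: "(\<And>i. i \<in> I \<Longrightarrow> test_fn (f i)) \<Longrightarrow> test_fn (\<lambda>x. \<Sum>i\<in>I. f i x)"
  by (induction I rule: infinite_finite_induct) (auto intro: test_fn_zero test_fn_add)

lemma pbound_test:
  assumes "test_fn f"
  obtains B where "0 \<le> B" "\<And>x. pbound N f x B"
proof -
  obtain B where B: "0 \<le> B" "\<And>x. x \<in> tsupport f \<Longrightarrow> pbound N f x B"
    using assms pbound_compact[of f "tsupport f" N] unfolding test_fn_def by metis
  have "pbound N f x B" for x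
    using B dlist_eq_0_outside[of x f] by (cases "x \<in> tsupport f") (auto simp: pbound_def)
  then show thesis using that B(1) by blast
qed

section \<open>A flat function and smooth cutoffs\<close>

text \<open>The polynomial factor makes the class of these functions closed under differentiation:
  in \<open>y = inverse x\<close> the derivative replaces \<open>p\<close> by
  \<open>(p - pderiv p)\<close> times the square of \<open>y\<close>. The classical flat function is
  the case \<open>p = 1\<close>.\<close>

definition flat_poly :: "real poly \<Rightarrow> real \<Rightarrow> real" where
  "flat_poly p x = (if x > 0 then poly p (inverse x) * exp (- inverse x) else 0)"

lemma poly_exp_tendsto_0: "((\<lambda>y. poly p y * exp (- y)) \<longlongrightarrow> (0::real)) at_top"
proof -
  have "((\<lambda>y. \<Sum>i\<le>degree p. coeff p i * (y ^ i / exp y)) \<longlongrightarrow> (\<Sum>i\<le>degree p. coeff p i * 0)) at_top"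
    by (intro tendsto_intros tendsto_power_div_exp_0)
  then show ?thesis by (simp add: poly_altdef exp_minus field_simps sum_divide_distrib)
qed

lemma flat_poly_deriv:
  "(flat_poly p has_real_derivative flat_poly ((p - pderiv p) * [:0, 0, 1:]) x) (at x)"
proof -
  consider "x > 0" | "x < 0" | "x = 0" by linarith
  then show ?thesis
  proof cases
    case 1
    have "((\<lambda>x. poly p (inverse x) * exp (- inverse x)) has_real_derivative
        flat_poly ((p - pderiv p) * [:0, 0, 1:]) x) (at x)"
      using 1 by (auto intro!: derivative_eq_intros poly_DERIV[THEN DERIV_chain2]
        simp: flat_poly_def algebra_simps power2_eq_square)
    moreover have "\<forall>\<^sub>F y in nhds x. flat_poly p y = poly p (inverse y) * exp (- inverse y)"
      using eventually_nhds_in_open[of "{0<..}" x] 1 by (auto simp: flat_poly_def elim: eventually_mono)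
    ultimately show ?thesis by (subst DERIV_cong_ev[OF refl _ refl]) auto
  next
    case 2
    have "\<forall>\<^sub>F y in nhds x. flat_poly p y = 0"
      using eventually_nhds_in_open[of "{..<0}" x] 2 by (auto simp: flat_poly_def elim: eventually_mono)
    then show ?thesis using 2 by (subst DERIV_cong_ev[OF refl _ refl, of _ "\<lambda>x. 0"]) (auto simp: flat_poly_def)
  next
    case 3
    have "((\<lambda>h. flat_poly p h / h) \<longlongrightarrow> 0) (at_left 0)"
      by (rule tendsto_eventually) (auto simp: flat_poly_def eventually_at_filter)
    moreover have "((\<lambda>h. flat_poly p h / h) \<longlongrightarrow> 0) (at_right 0)"
    proof -
      \<comment> \<open>Division by \<open>h\<close> in the difference quotient is one more factor
        \<open>inverse h\<close>, that is, multiplication of \<open>p\<close> by the monomial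
        \<open>[:0, 1:]\<close>.\<close>
      have "((\<lambda>h. poly (p * [:0, 1:]) (inverse h) * exp (- inverse h)) \<longlongrightarrow> 0) (at_right 0)"
        by (rule filterlim_compose[OF poly_exp_tendsto_0 filterlim_inverse_at_top_right])
      then show ?thesis
        by (rule Lim_transform_eventually)
          (auto simp: flat_poly_def eventually_at_filter field_simps)
    qed
    ultimately have "((\<lambda>h. flat_poly p h / h) \<longlongrightarrow> 0) (at 0)"
      by (rule filterlim_split_at)
    then show ?thesis using 3 by (simp add: DERIV_def flat_poly_def)
  qed
qed

lemma smooth_flat_poly: "smooth_fn (\<lambda>x. complex_of_real (flat_poly p x))"
proof (rule smooth_fn_coinduct[where P = "\<lambda>f. \<exists>p. f = (\<lambda>x. complex_of_real (flat_poly p x))"])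
  fix f :: "real \<Rightarrow> complex" and b :: real
  assume "\<exists>p. f = (\<lambda>x. complex_of_real (flat_poly p x))"
  then obtain p where f: "f = (\<lambda>x. complex_of_real (flat_poly p x))" by blast
  have "continuous_on UNIV (flat_poly p)"
    by (rule DERIV_continuous_on) (rule DERIV_subset[OF flat_poly_deriv], simp)
  then show "continuous_on UNIV f" unfolding f by (rule continuous_on_of_real)
  assume "b \<in> Basis" then have b: "b = 1" by simp
  have "(f has_vector_derivative complex_of_real (flat_poly ((p - pderiv p) * [:0, 0, 1:]) x)) (at x)" for x
    unfolding f
    using bounded_linear.has_vector_derivative[OF bounded_linear_of_real]
      flat_poly_deriv[of p x, unfolded has_real_derivative_iff_has_vector_derivative] by blast
  then have "has_pdir b f x (complex_of_real (flat_poly ((p - pderiv p) * [:0, 0, 1:]) x))" for x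
    using has_vector_derivative_affine[of f _ x 1 0] unfolding b by simp
  then show "\<exists>f'. (\<exists>p. f' = (\<lambda>x. complex_of_real (flat_poly p x))) \<and> (\<forall>x. has_pdir b f x (f' x))"
    by (intro exI[of _ "\<lambda>x. complex_of_real (flat_poly ((p - pderiv p) * [:0, 0, 1:]) x)"]) blast
qed blast

definition flat_exp :: "real \<Rightarrow> real" where
  "flat_exp = flat_poly 1"

lemma flat_exp_pos: "x > 0 \<Longrightarrow> flat_exp x > 0"
  and flat_exp_zero: "x \<le> 0 \<Longrightarrow> flat_exp x = 0"
  and flat_exp_nonneg: "flat_exp x \<ge> 0"
  by (auto simp: flat_exp_def flat_poly_def)

lemma smooth_flat_exp: "smooth_fn f \<Longrightarrow> smooth_fn (\<lambda>x. complex_of_real (flat_exp (Re (f x))))"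
  unfolding flat_exp_def by (rule smooth_comp[OF smooth_flat_poly])

definition smooth_step :: "real \<Rightarrow> real" where
  "smooth_step x = flat_exp x / (flat_exp x + flat_exp (1 - x))"

lemma smooth_step_denom: "flat_exp x + flat_exp (1 - x) > 0"
  using flat_exp_pos[of x] flat_exp_pos[of "1 - x"] flat_exp_nonneg[of x] flat_exp_nonneg[of "1 - x"]
  by (cases "x > 0") auto

lemma smooth_step_zero: "x \<le> 0 \<Longrightarrow> smooth_step x = 0"
  by (simp add: smooth_step_def flat_exp_zero)

lemma smooth_step_one: "x \<ge> 1 \<Longrightarrow> smooth_step x = 1"
  using smooth_step_denom[of x] by (simp add: smooth_step_def flat_exp_zero)

lemma smooth_step_nonneg: "0 \<le> smooth_step x"
  by (simp add: smooth_step_def flat_exp_nonneg)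

lemma smooth_smooth_step: 
  assumes "smooth_fn f"
  shows "smooth_fn (\<lambda>x. complex_of_real (smooth_step (Re (f x))))"
proof -
  have "smooth_fn (\<lambda>x. complex_of_real (flat_exp (Re (f x))) /
      (complex_of_real (flat_exp (Re (f x))) + complex_of_real (flat_exp (Re (1 - f x)))))"
    using smooth_step_denom[of "Re (f x)" for x]
    by (intro smooth_intros smooth_flat_exp assms)
      (metis Re_complex_of_real minus_complex.sel(1) of_real_add one_complex.sel(1) less_irrefl zero_complex.sel(1))
  then show ?thesis by (simp add: smooth_step_def)
qed

lemma smooth_norm_sq: "smooth_fn (\<lambda>x::'a::euclidean_space. complex_of_real (x \<bullet> x))"
proof -
  have "smooth_fn (\<lambda>x::'a. \<Sum>b\<in>Basis. complex_of_real (x \<bullet> b) * complex_of_real (x \<bullet> b))"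
    by (intro smooth_intros smooth_linear bounded_linear_inner_left)
  then show ?thesis by (subst euclidean_inner) simp
qed

text \<open>Built from \<open>x \<bullet> x\<close>, since the norm is not smooth at the origin. It
  is 1 on the unit ball and 0 where \<open>x \<bullet> x \<ge> 2\<close>.\<close>

definition cutoff :: "'a::euclidean_space \<Rightarrow> complex" where
  "cutoff x = of_real (smooth_step (2 - x \<bullet> x))"

lemma smooth_cutoff: "smooth_fn cutoff"
proof -
  have "smooth_fn (\<lambda>x::'a. complex_of_real (smooth_step (Re (2 - complex_of_real (x \<bullet> x)))))"
    by (intro smooth_smooth_step smooth_intros smooth_norm_sq)
  then show ?thesis by (simp add: cutoff_def[abs_def])
qed

lemma cutoff_one: "norm x \<le> 1 \<Longrightarrow> cutoff x = 1"
  unfolding cutoff_def dot_square_norm by (simp add: smooth_step_one power_le_one)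

lemma cutoff_zero: "norm x \<ge> 2 \<Longrightarrow> cutoff x = 0"
  unfolding cutoff_def dot_square_norm using power_mono[of 2 "norm x" 2] by (simp add: smooth_step_zero)

lemma test_fn_cutoff: "test_fn (cutoff :: 'a::euclidean_space \<Rightarrow> complex)"
  unfolding test_fn_iff
proof
  have "norm x \<le> 2" if "cutoff x \<noteq> 0" for x :: 'a
    using cutoff_zero[of x] that by linarith
  then show "bounded {x::'a. cutoff x \<noteq> 0}" by (auto simp: bounded_iff)
qed (rule smooth_cutoff)

subsection \<open>Pairings that are bounded on functions vanishing in the future\<close>

text \<open>Nothing is imposed in the past: the antiderivative of a test function that vanishes for
  large \<open>t\<close> is in general a nonzero constant for very negative \<open>t\<close>, so it
  is this larger space that is stable under \<open>future_integral\<close>.\<close>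

definition past_functions :: "real \<Rightarrow> (real \<Rightarrow> complex) set" where
  "past_functions T = {\<phi>. smooth_fn \<phi> \<and> (\<forall>t>T. \<phi> t = 0)}"

definition future_integral :: "real \<Rightarrow> (real \<Rightarrow> complex) \<Rightarrow> real \<Rightarrow> complex" where
  "future_integral T \<phi> t = integral {t..T} \<phi>"

text \<open>The transpose of the time derivative, with the sign that makes it inverse to
  \<open>future_integral\<close> on \<open>past_functions\<close>.\<close>

definition neg_deriv :: "(real \<Rightarrow> complex) \<Rightarrow> real \<Rightarrow> complex" where
  "neg_deriv \<phi> t = - pdir 1 \<phi> t"

lemma past_functions_smooth: "\<phi> \<in> past_functions T \<Longrightarrow> smooth_fn \<phi>"
  by (auto simp: past_functions_def)

lemma past_functions_zero:
  assumes "\<phi> \<in> past_functions T" "t \<ge> T"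
  shows "\<phi> t = 0"
proof (cases "t = T")
  case True
  have "(\<phi> \<longlongrightarrow> \<phi> T) (at_right T)"
    using smooth_fn_isCont[OF past_functions_smooth[OF assms(1)], of T]
    by (auto simp: isCont_def intro: tendsto_within_subset)
  moreover have "(\<phi> \<longlongrightarrow> 0) (at_right T)"
    by (rule tendsto_eventually) (use assms in \<open>auto simp: past_functions_def eventually_at_filter\<close>)
  ultimately show ?thesis
    using tendsto_unique[of "at_right T"] True by simp
qed (use assms in \<open>auto simp: past_functions_def\<close>)

lemmas past_functionsD = past_functions_smooth past_functions_zero

lemma smooth_fn_has_vector_derivative:
  fixes f :: "real \<Rightarrow> complex"
  assumes "smooth_fn f"
  shows "(f has_vector_derivative pdir 1 f t) (at t within S)"
  using has_pdir_line[where b=1 and f=f and f'="pdir 1 f" and x=0 and s=t] smooth_fn_has_pdir[OF assms, of 1]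
  by (simp add: has_vector_derivative_at_within)

lemma has_pdirI_real:
  fixes f :: "real \<Rightarrow> complex"
  assumes "(f has_vector_derivative D) (at t)"
  shows "has_pdir 1 f t D"
  using has_vector_derivative_affine[of f D t 1 0] assms by simp

text \<open>Moving the upper limit beyond \<open>T\<close> puts a full neighbourhood of any
  \<open>t\<close>, also of \<open>t \<ge> T\<close>, into the range of one ordinary antiderivative,
  so that no case distinction at \<open>T\<close> is left for the derivative.\<close>

lemma future_integral_extend:
  assumes "\<phi> \<in> past_functions T" "T \<le> T'"
  shows "future_integral T \<phi> u = integral {u..T'} \<phi>"
proof -
  have int: "\<phi> integrable_on {x..y}" for x y
    using past_functionsD(1)[OF assms(1)] smooth_fn_continuous continuous_on_subset
    by (intro integrable_continuous_real) blast
  have 0: "integral {x..y} \<phi> = 0" if "x \<ge> T" for x y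
    using integral_cong[of "{x..y}" \<phi> "\<lambda>_. 0"] past_functionsD(2)[OF assms(1)] that by simp
  show ?thesis
  proof (cases "u \<le> T")
    case True
    have "integral {u..T} \<phi> + integral {T..T'} \<phi> = integral {u..T'} \<phi>"
      by (rule Henstock_Kurzweil_Integration.integral_combine) (use True assms int in auto)
    then show ?thesis using 0[of T T'] by (simp add: future_integral_def)
  next
    case False
    then show ?thesis using 0[of u T'] by (simp add: future_integral_def)
  qed
qed

lemma future_integral_deriv:
  assumes "\<phi> \<in> past_functions T"
  shows "(future_integral T \<phi> has_vector_derivative - \<phi> t) (at t)"
proof -
  define A T' where "A = t - 1" and "T' = max t T + 1"
  have cont: "continuous_on S \<phi>" for S
    using past_functionsD(1)[OF assms(1)] smooth_fn_continuous continuous_on_subset by blast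
  have eq: "integral {A..T'} \<phi> - integral {A..u} \<phi> = future_integral T \<phi> u" if "u \<in> {A<..<T'}" for u
    using Henstock_Kurzweil_Integration.integral_combine[of A u T' \<phi>] that
      future_integral_extend[OF assms, of T' u] integrable_continuous_real[OF cont]
    by (auto simp: T'_def algebra_simps)
  have "((\<lambda>u. integral {A..u} \<phi>) has_vector_derivative \<phi> t) (at t within {A..T'})"
    by (rule integral_has_vector_derivative[OF cont]) (auto simp: A_def T'_def)
  then have "((\<lambda>u. integral {A..u} \<phi>) has_vector_derivative \<phi> t) (at t within {A<..<T'})"
    by (rule has_vector_derivative_within_subset) auto
  then have "((\<lambda>u. integral {A..u} \<phi>) has_vector_derivative \<phi> t) (at t)"
    by (subst (asm) at_within_open) (auto simp: A_def T'_def)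
  then have "((\<lambda>u. integral {A..T'} \<phi> - integral {A..u} \<phi>) has_vector_derivative - \<phi> t) (at t)"
    using has_vector_derivative_diff[OF has_vector_derivative_const] by fastforce
  then show ?thesis
    by (rule has_vector_derivative_transform_within_open[where S = "{A<..<T'}"])
      (use eq in \<open>auto simp: A_def T'_def\<close>)
qed

lemma future_integral_past:
  assumes "\<phi> \<in> past_functions T"
  shows "future_integral T \<phi> \<in> past_functions T"
proof -
  have "smooth_fn (future_integral T \<phi>)"
  proof (rule smooth_fn_coinduct[where P = "\<lambda>f. smooth_fn f \<or> f = future_integral T \<phi>"])
    fix f assume f: "smooth_fn f \<or> f = future_integral T \<phi>"
    have "continuous_on UNIV (future_integral T \<phi>)"
      using has_vector_derivative_continuous[OF future_integral_deriv[OF assms]]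
      by (simp add: continuous_on_eq_continuous_at)
    then show "continuous_on UNIV f" using f smooth_fn_continuous by auto
    fix b :: real assume "b \<in> Basis"
    then have b: "b = 1" by simp
    show "\<exists>f'. (smooth_fn f' \<or> f' = future_integral T \<phi>) \<and> (\<forall>x. has_pdir b f x (f' x))"
      using f
    proof
      assume "smooth_fn f"
      then show ?thesis using smooth_fn_has_pdir smooth_fn_pdir \<open>b \<in> Basis\<close> by blast
    next
      assume f: "f = future_integral T \<phi>"
      have "has_pdir b f x (- \<phi> x)" for x
        unfolding f b by (intro has_pdirI_real future_integral_deriv assms)
      then show ?thesis using smooth_uminus[OF past_functionsD(1)[OF assms]] by blast
    qed
  qed simp
  moreover have "future_integral T \<phi> t = 0" if "t > T" for t
    using that by (simp add: future_integral_def)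
  ultimately show ?thesis by (simp add: past_functions_def)
qed

lemma pdir_future_integral: "\<phi> \<in> past_functions T \<Longrightarrow> pdir 1 (future_integral T \<phi>) = (\<lambda>t. - \<phi> t)"
  by (rule ext, rule has_pdir_imp, rule has_pdirI_real, rule future_integral_deriv)

lemma neg_deriv_future_integral: "\<phi> \<in> past_functions T \<Longrightarrow> neg_deriv (future_integral T \<phi>) = \<phi>"
  by (simp add: neg_deriv_def[abs_def] pdir_future_integral)

lemma pdir_past:
  assumes "\<phi> \<in> past_functions T"
  shows "pdir 1 \<phi> \<in> past_functions T"
  using dlist_local[of "{T<..}" \<phi> "\<lambda>_. 0" _ "[1]"] smooth_fn_pdir[of \<phi> 1] assms
  by (auto simp: past_functions_def)

lemma dlist_past:
  assumes "\<phi> \<in> past_functions T" "set bs \<subseteq> Basis"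
  shows "dlist bs \<phi> \<in> past_functions T"
  using assms(2) by (induction bs) (auto intro: pdir_past assms)

lemma future_integral_pdir:
  assumes "\<phi> \<in> past_functions T"
  shows "future_integral T (pdir 1 \<phi>) = (\<lambda>t. - \<phi> t)"
proof
  fix t
  show "future_integral T (pdir 1 \<phi>) t = - \<phi> t"
  proof (cases "t \<le> T")
    case True
    have "(pdir 1 \<phi> has_integral \<phi> T - \<phi> t) {t..T}"
      by (rule fundamental_theorem_of_calculus[OF True])
        (rule smooth_fn_has_vector_derivative[OF past_functions_smooth[OF assms]])
    then show ?thesis
      using past_functions_zero[OF assms, of T] by (simp add: future_integral_def integral_unique)
  next
    case False
    then show ?thesis
      using past_functions_zero[OF assms, of t] by (simp add: future_integral_def)
  qed
qed

text \<open>Differentiating and integrating give \<open>- \<phi>\<close> in either order, the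
  boundary term at \<open>T\<close> being zero. Derivative bounds for the integral thus come from
  bounds on the derivatives of \<open>\<phi>\<close>, with the same gain.\<close>

lemma dlist_future_integral:
  assumes "\<phi> \<in> past_functions T" "set bs \<subseteq> Basis"
  shows "dlist bs (future_integral T \<phi>) = future_integral T (dlist bs \<phi>)"
  using assms(2)
proof (induction bs)
  case (Cons b bs)
  then have "dlist bs \<phi> \<in> past_functions T" "b = 1" using dlist_past[OF assms(1)] by auto
  then show ?case using Cons by (simp add: pdir_future_integral future_integral_pdir)
qed simp

text \<open>The weight \<open>exp (- \<mu> * t)\<close> makes each integration gain a factor \<open>1 / \<mu>\<close>.\<close>
lemma future_integral_bound:
  assumes "\<phi> \<in> past_functions T" "0 < \<mu>"
    and bound: "\<And>s. s \<in> {l..T} \<Longrightarrow> norm (\<phi> s) \<le> A * exp (- \<mu> * s)" and t: "t \<in> {l..T}" and "0 \<le> A"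
  shows "norm (future_integral T \<phi> t) \<le> A / \<mu> * exp (- \<mu> * t)"
proof -
  have int: "((\<lambda>s. A * exp (- \<mu> * s)) has_integral (- A / \<mu> * exp (- \<mu> * T)) - (- A / \<mu> * exp (- \<mu> * t))) {t..T}"
    by (rule fundamental_theorem_of_calculus)
      (use t assms in \<open>auto simp: has_real_derivative_iff_has_vector_derivative[symmetric]
        intro!: derivative_eq_intros\<close>)
  have "norm (integral {t..T} \<phi>) \<le> integral {t..T} (\<lambda>s. A * exp (- \<mu> * s))"
  proof (rule integral_norm_bound_integral)
    show "\<phi> integrable_on {t..T}"
      using past_functions_smooth[OF assms(1)] smooth_fn_continuous continuous_on_subset
      by (intro integrable_continuous_real) blast
  qed (use int bound t in auto)
  also have "\<dots> = (- A / \<mu> * exp (- \<mu> * T)) - (- A / \<mu> * exp (- \<mu> * t))"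
    by (rule integral_unique[OF int])
  also have "\<dots> \<le> A / \<mu> * exp (- \<mu> * t)"
    using assms by simp
  finally show ?thesis by (simp add: future_integral_def)
qed

lemma future_integral_pow_past:
  "\<phi> \<in> past_functions T \<Longrightarrow> (future_integral T ^^ m) \<phi> \<in> past_functions T"
  by (induction m) (auto intro: future_integral_past)

text \<open>Any \<open>\<kappa> > 0\<close> is allowed, with \<open>A\<close> depending on it, so
  the decay beats every geometric rate. The weighted estimate with
  \<open>\<mu> = 1 / \<kappa>\<close> gains \<open>\<kappa>\<close> per integration, and on the
  bounded interval the weight can be removed at the cost of a constant.\<close>

lemma future_integral_pow_bound:
  assumes "\<phi> \<in> past_functions T" "0 < \<kappa>"
  obtains A where "0 \<le> A"
    "\<And>m t. t \<in> {l..T} \<Longrightarrow> pbound N ((future_integral T ^^ m) \<phi>) t (A * \<kappa> ^ m)"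
proof -
  define \<mu> where "\<mu> = 1 / \<kappa>"
  have l: "0 < \<mu>" using assms by (simp add: \<mu>_def)
  obtain B where B: "0 \<le> B" "\<And>t. t \<in> {l..T} \<Longrightarrow> pbound N \<phi> t B"
    using pbound_compact[OF past_functions_smooth[OF assms(1)], of "{l..T}" N] by auto
  \<comment> \<open>The factor \<open>exp (\<mu> * T)\<close> makes
    \<open>A * exp (- \<mu> * t)\<close> at least \<open>B\<close> for all
    \<open>t \<le> T\<close>.\<close>
  define A where "A = B * exp (\<mu> * T)"
  have A: "0 \<le> A" using B by (simp add: A_def)
  have *: "norm (dlist bs ((future_integral T ^^ m) \<phi>) t) \<le> A * \<kappa> ^ m * exp (- \<mu> * t)"
    if "set bs \<subseteq> Basis" "length bs \<le> N" "t \<in> {l..T}" for bs m t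
    using that(3)
  proof (induction m arbitrary: t)
    case 0
    have "norm (dlist bs \<phi> t) \<le> B" by (rule pboundD[OF B(2)]) (use 0 that in auto)
    also have "B * 1 \<le> B * exp (\<mu> * T - \<mu> * t)" using B 0 l by (intro mult_left_mono) auto
    then have "B \<le> A * exp (- \<mu> * t)" by (simp add: A_def exp_diff exp_minus field_simps)
    finally show ?case by simp
  next
    case (Suc m)
    have p: "(future_integral T ^^ m) \<phi> \<in> past_functions T" by (rule future_integral_pow_past[OF assms(1)])
    have "norm (future_integral T (dlist bs ((future_integral T ^^ m) \<phi>)) t) \<le> (A * \<kappa> ^ m) / \<mu> * exp (- \<mu> * t)"
      by (rule future_integral_bound[OF dlist_past[OF p] l Suc.IH Suc.prems]) (use that A assms in auto)
    then show ?case
      using that(1) by (simp add: dlist_future_integral[OF p] \<mu>_def mult_ac)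
  qed
  show thesis
  proof (rule that[of "A * exp (- \<mu> * l)"])
    show "0 \<le> A * exp (- \<mu> * l)" using A by simp
    fix m t assume t: "t \<in> {l..T}"
    have "A * \<kappa> ^ m * exp (- \<mu> * t) \<le> A * \<kappa> ^ m * exp (- \<mu> * l)"
      using t l A assms by (intro mult_left_mono) auto
    then show "pbound N ((future_integral T ^^ m) \<phi>) t (A * exp (- \<mu> * l) * \<kappa> ^ m)"
      using *[OF _ _ t, of _ m] unfolding pbound_def by (force simp: mult_ac)
  qed
qed

lemma neg_deriv_pow_future_integral_pow:
  assumes "\<phi> \<in> past_functions T"
  shows "(neg_deriv ^^ j) ((future_integral T ^^ (j + m)) \<phi>) = (future_integral T ^^ m) \<phi>"
proof (induction j)
  case (Suc j)
  have "(neg_deriv ^^ Suc j) ((future_integral T ^^ (Suc j + m)) \<phi>) =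
      (neg_deriv ^^ j) (neg_deriv (future_integral T ((future_integral T ^^ (j + m)) \<phi>)))"
    by (simp add: funpow_swap1)
  then show ?case using Suc neg_deriv_future_integral[OF future_integral_pow_past[OF assms]] by simp
qed simp

section \<open>Pairings of finite order in time and frequency\<close>

text \<open>Only \<open>\<phi>\<close> on \<open>{l..T}\<close> and \<open>h\<close> on
  \<open>L\<close> enter the bound, so \<open>w\<close> acts like a distribution of order
  \<open>N\<close> in each variable carried by a compact set, while being tested on functions
  without compact support. The majorants \<open>A\<close> and \<open>B\<close> stand in for
  norms.\<close>

definition pairing_le :: "real \<Rightarrow> real \<Rightarrow> 'a::euclidean_space set \<Rightarrow> nat \<Rightarrow> real \<Rightarrow>
    ((real \<Rightarrow> complex) \<Rightarrow> ('a \<Rightarrow> complex) \<Rightarrow> complex) \<Rightarrow> bool" where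
  "pairing_le l T L N C w \<longleftrightarrow> (\<forall>\<phi>\<in>past_functions T. \<forall>h A B. smooth_fn h \<longrightarrow> 0 \<le> A \<longrightarrow> 0 \<le> B \<longrightarrow>
      (\<forall>t\<in>{l..T}. pbound N \<phi> t A) \<longrightarrow> (\<forall>x\<in>L. pbound N h x B) \<longrightarrow> norm (w \<phi> h) \<le> C * A * B)"

lemma pairing_leD:
  assumes "pairing_le l T L N C w" "\<phi> \<in> past_functions T" "smooth_fn h" "0 \<le> A" "0 \<le> B"
    "\<And>t. t \<in> {l..T} \<Longrightarrow> pbound N \<phi> t A" "\<And>x. x \<in> L \<Longrightarrow> pbound N h x B"
  shows "norm (w \<phi> h) \<le> C * A * B"
  using assms unfolding pairing_le_def by blast

text \<open>Additivity is asked in the frequency argument, where multipliers are split into a part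
  near the zeros of a coefficient and a part away from them.\<close>

definition bounded_pairing ::
    "real \<Rightarrow> real \<Rightarrow> 'a::euclidean_space set \<Rightarrow> ((real \<Rightarrow> complex) \<Rightarrow> ('a \<Rightarrow> complex) \<Rightarrow> complex) \<Rightarrow> bool" where
  "bounded_pairing l T L w \<longleftrightarrow>
    (\<forall>\<phi>\<in>past_functions T. \<forall>h k. smooth_fn h \<longrightarrow> smooth_fn k \<longrightarrow> w \<phi> (\<lambda>x. h x + k x) = w \<phi> h + w \<phi> k) \<and>
    (\<exists>N. \<exists>C\<ge>0. pairing_le l T L N C w)"

lemma bounded_pairing_add:
  "bounded_pairing l T L w \<Longrightarrow> \<phi> \<in> past_functions T \<Longrightarrow> smooth_fn h \<Longrightarrow> smooth_fn k \<Longrightarrow>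
    w \<phi> (\<lambda>x. h x + k x) = w \<phi> h + w \<phi> k"
  by (simp add: bounded_pairing_def)

lemma bounded_pairingE:
  assumes "bounded_pairing l T L w"
  obtains N C where "0 \<le> C" "pairing_le l T L N C w"
  using assms by (auto simp: bounded_pairing_def)

text \<open>On functions where multiplication by \<open>a n\<close> is invertible, the equation expresses \<open>w\<close> through
  pairings with arbitrarily many integrations, which are arbitrarily small.\<close>
lemma pairing_zero_where_leading_invertible:
  assumes w: "bounded_pairing l T L w" and L: "compact L"
    and a: "\<And>j. j \<le> n \<Longrightarrow> smooth_fn (a j)"
    and eq: "\<And>\<phi> h. \<phi> \<in> past_functions T \<Longrightarrow> smooth_fn h \<Longrightarrow>
      (\<Sum>j\<le>n. w ((neg_deriv ^^ j) \<phi>) (\<lambda>x. a j x * h x)) = 0"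
    and c: "smooth_fn c" and h: "smooth_fn h" "\<And>x. c x * a n x * h x = h x"
    and \<phi>: "\<phi> \<in> past_functions T"
  shows "w \<phi> h = 0"
proof -
  obtain N C where C: "0 \<le> C" "pairing_le l T L N C w"
    using w by (rule bounded_pairingE)
  have "\<exists>M\<ge>0. \<forall>x\<in>L. pbound N (\<lambda>x. a j x * c x) x M" if "j \<le> n" for j
    using pbound_compact[OF smooth_mult[OF a[OF that] c] L] by metis
  then obtain M' where M': "\<And>j. j \<le> n \<Longrightarrow> 0 \<le> M' j \<and> (\<forall>x\<in>L. pbound N (\<lambda>x. a j x * c x) x (M' j))"
    by metis
  define M where "M = 2 ^ N * (\<Sum>j\<le>n. M' j)"
  have M0: "0 \<le> M" unfolding M_def using M' by (auto intro!: sum_nonneg mult_nonneg_nonneg)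
  have M: "pbound N (\<lambda>x. a j x * (c x * k x)) x (M * B)"
    if "j \<le> n" "smooth_fn k" "pbound N k x B" "x \<in> L" for j k x B
  proof -
    have "M' j \<le> (\<Sum>j\<le>n. M' j)" using M' that by (intro member_le_sum) auto
    then have "pbound N (\<lambda>x. a j x * c x) x (\<Sum>j\<le>n. M' j)"
      using M' that pbound_mono by blast
    from pbound_mult[OF smooth_mult[OF a[OF that(1)] c] that(2) this that(3)]
    show ?thesis by (simp add: M_def mult.assoc)
  qed
  \<comment> \<open>One use of the equation produces \<open>n\<close> terms, each with a factor
    \<open>M\<close> and at least one more integration worth \<open>\<kappa>\<close>. With
    \<open>n * M * \<kappa> \<le> 1/2\<close> every use halves the bound.\<close>
  define \<kappa> where "\<kappa> = 1 / (2 * (real n * M + 1))"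
  have \<kappa>: "0 < \<kappa>" "\<kappa> \<le> 1" "real n * M * \<kappa> \<le> 1/2"
    using M0 by (auto simp: \<kappa>_def field_simps add_pos_nonneg add_nonneg_pos)
  obtain A where A: "0 \<le> A" "\<And>m t. t \<in> {l..T} \<Longrightarrow> pbound N ((future_integral T ^^ m) \<phi>) t (A * \<kappa> ^ m)"
    using future_integral_pow_bound[OF \<phi> \<kappa>(1)] by metis
  \<comment> \<open>The claim is made for all \<open>m\<close> and all \<open>h\<close> on which
    \<open>c\<close> inverts \<open>a n\<close>, because one step replaces \<open>h\<close> by
    \<open>a j * c * h\<close>, which has the same property, and raises the number of integrations.
    The exponent \<open>k\<close> counts the steps.\<close>
  have key: "norm (w ((future_integral T ^^ m) \<phi>) h) \<le> C * A * \<kappa> ^ m * (1/2) ^ k * B"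
    if "smooth_fn h" "\<And>x. c x * a n x * h x = h x" "0 \<le> B" "\<And>x. x \<in> L \<Longrightarrow> pbound N h x B" for m k h B
    using that
  proof (induction k arbitrary: m h B)
    case 0
    then show ?case
      using pairing_leD[OF C(2) future_integral_pow_past[OF \<phi>, of m], of h "A * \<kappa> ^ m" B] A \<kappa> by (simp add: mult_ac)
  next
    case (Suc k)
    let ?J = "future_integral T"
    \<comment> \<open>Testing with \<open>n\<close> additional integrations and with
      \<open>c * h\<close> makes the term \<open>j = n\<close> the quantity to be estimated, while
      each term with \<open>j < n\<close> retains at least \<open>m + 1\<close>
      integrations.\<close>
    have "(\<Sum>j\<le>n. w ((neg_deriv ^^ j) ((?J ^^ (m + n)) \<phi>)) (\<lambda>x. a j x * (c x * h x))) = 0"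
      by (rule eq) (intro future_integral_pow_past \<phi> smooth_intros c Suc.prems)+
    moreover have "(neg_deriv ^^ j) ((?J ^^ (m + n)) \<phi>) = (?J ^^ (m + n - j)) \<phi>" if "j \<le> n" for j
      using neg_deriv_pow_future_integral_pow[OF \<phi>, of j "m + n - j"] that by simp
    ultimately have "(\<Sum>j\<le>n. w ((?J ^^ (m + n - j)) \<phi>) (\<lambda>x. a j x * (c x * h x))) = 0"
      by simp
    moreover have "(\<lambda>x. a n x * (c x * h x)) = h" using Suc.prems(2) by (auto simp: mult_ac)
    ultimately have "w ((?J ^^ m) \<phi>) h = - (\<Sum>j<n. w ((?J ^^ (m + n - j)) \<phi>) (\<lambda>x. a j x * (c x * h x)))"
      by (simp add: lessThan_Suc_atMost[symmetric] add_eq_0_iff)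
    then have "norm (w ((?J ^^ m) \<phi>) h) \<le> (\<Sum>j<n. norm (w ((?J ^^ (m + n - j)) \<phi>) (\<lambda>x. a j x * (c x * h x))))"
      by (simp add: norm_sum)
    also have "\<dots> \<le> (\<Sum>j<n. C * A * \<kappa> ^ (m + 1) * (1/2) ^ k * (M * B))"
    proof (rule sum_mono)
      fix j assume "j \<in> {..<n}"
      then have j: "j \<le> n" "m + 1 \<le> m + n - j" by auto
      have "norm (w ((?J ^^ (m + n - j)) \<phi>) (\<lambda>x. a j x * (c x * h x)))
          \<le> C * A * \<kappa> ^ (m + n - j) * (1/2) ^ k * (M * B)"
      proof (rule Suc.IH)
        show "c x * a n x * (a j x * (c x * h x)) = a j x * (c x * h x)" for x
          using Suc.prems(2)[of x] by (metis mult.assoc mult.left_commute)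
      qed (auto intro!: smooth_intros a j c Suc.prems M mult_nonneg_nonneg M0)
      also have "\<dots> \<le> C * A * \<kappa> ^ (m + 1) * (1/2) ^ k * (M * B)"
        using C(1) A(1) M0 Suc.prems \<kappa> j
        by (intro mult_right_mono mult_left_mono power_decreasing) auto
      finally show "norm (w ((?J ^^ (m + n - j)) \<phi>) (\<lambda>x. a j x * (c x * h x)))
          \<le> C * A * \<kappa> ^ (m + 1) * (1/2) ^ k * (M * B)" .
    qed
    also have "\<dots> = (real n * M * \<kappa>) * (C * A * \<kappa> ^ m * (1/2) ^ k * B)" by simp
    also have "\<dots> \<le> (1/2) * (C * A * \<kappa> ^ m * (1/2) ^ k * B)"
      using C(1) A(1) M0 Suc.prems \<kappa> by (intro mult_right_mono) auto
    finally show ?case by simp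
  qed
  obtain B where B: "0 \<le> B" "\<And>x. x \<in> L \<Longrightarrow> pbound N h x B"
    using pbound_compact[OF h(1) L] by metis
  have "norm (w \<phi> h) \<le> C * A * B * (1/2) ^ k" for k
    using key[OF h B, of 0 k] by (simp add: mult_ac)
  moreover have "(\<lambda>k. C * A * B * (1/2) ^ k) \<longlonglongrightarrow> C * A * B * 0"
    by (intro tendsto_intros LIMSEQ_realpow_zero) auto
  ultimately have "norm (w \<phi> h) \<le> 0"
    by (intro LIMSEQ_le_const[of _ 0]) auto
  then show ?thesis by simp
qed

subsection \<open>Uniqueness for pairings solving a degenerate equation\<close>

lemma smooth_Re: "smooth_fn f \<Longrightarrow> smooth_fn (\<lambda>x. complex_of_real (Re (f x)))"
  using smooth_mult[OF smooth_const[of "1/2"] smooth_add[OF _ smooth_cnj], of f f]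
  by (simp add: complex_add_cnj)

lemma pdir_Re_comp:
  assumes "smooth_fn F" "smooth_fn q" "b \<in> Basis"
  shows "pdir b (\<lambda>x. F (Re (q x))) = (\<lambda>x. of_real (Re (pdir b q x)) * pdir 1 F (Re (q x)))"
proof (rule ext, rule has_pdir_imp)
  fix x
  show "has_pdir b (\<lambda>x. F (Re (q x))) x (of_real (Re (pdir b q x)) * pdir 1 F (Re (q x)))"
  proof (rule has_pdir_comp)
    show "has_pdir 1 F t (pdir 1 F t)" for t
      by (rule smooth_fn_has_pdir[OF assms(1)]) simp
    show "((\<lambda>s. Re (q (x + s *\<^sub>R b))) has_vector_derivative Re (pdir b q x)) (at 0)"
      by (rule bounded_linear.has_vector_derivative[OF bounded_linear_Re smooth_fn_has_pdir[OF assms(2,3)]])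
  qed
qed

lemma pdir_power:
  assumes "smooth_fn a" "b \<in> Basis"
  shows "pdir b (\<lambda>x. a x ^ Suc k) = (\<lambda>x. of_nat (Suc k) * a x ^ k * pdir b a x)"
proof (induction k)
  case (Suc k)
  have "pdir b (\<lambda>x. a x * a x ^ Suc k) = (\<lambda>x. pdir b a x * a x ^ Suc k + a x * pdir b (\<lambda>x. a x ^ Suc k) x)"
    by (intro pdir_mult smooth_power assms)
  then show ?case unfolding Suc by (simp add: algebra_simps)
qed simp

lemma pdir_power_mult:
  assumes "smooth_fn a" "smooth_fn h" "b \<in> Basis"
  shows "pdir b (\<lambda>x. a x ^ Suc k * h x) =
    (\<lambda>x. a x ^ k * (of_nat (Suc k) * pdir b a x * h x + a x * pdir b h x))"
  using pdir_mult[OF smooth_power[OF assms(1)] assms(2,3), of "Suc k"] pdir_power[OF assms(1,3), of k]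
  by (simp add: algebra_simps)

lemma dlist_replicate_pdir: "dlist (replicate j b) (pdir b f) = dlist (replicate (Suc j) b) f"
  by (induction j) auto

text \<open>Modelled on a rescaled cutoff \<open>F (s / \<epsilon>)\<close>, whose derivatives cost
  one factor \<open>1 / \<epsilon>\<close> each. The range \<open>s \<ge> 0\<close> is the one
  reached by the square of \<open>norm (a x)\<close>, with which \<open>f\<close> gets
  composed.\<close>

definition concentrated :: "nat \<Rightarrow> real \<Rightarrow> real \<Rightarrow> (real \<Rightarrow> complex) \<Rightarrow> bool" where
  "concentrated N D \<epsilon> f \<longleftrightarrow> smooth_fn f \<and>
    (\<forall>j\<le>N. \<forall>s\<ge>0. norm (dlist (replicate j 1) f s) \<le> (if s < \<epsilon> then D / \<epsilon> ^ j else 0))"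

lemma concentrated_pdir: "concentrated (Suc N) D \<epsilon> f \<Longrightarrow> concentrated N (D / \<epsilon>) \<epsilon> (pdir 1 f)"
  unfolding concentrated_def
  by (auto simp: dlist_replicate_pdir smooth_fn_pdir simp del: replicate_Suc split: if_splits)

lemma concentrated_mono: "concentrated (Suc N) D \<epsilon> f \<Longrightarrow> concentrated N D \<epsilon> f"
  by (auto simp: concentrated_def)

text \<open>On the set where \<open>norm (a x)\<^sup>2 < \<epsilon>\<close> the high power of \<open>a\<close> compensates for the
  negative powers of \<open>\<epsilon>\<close> in the derivatives of the cutoff.\<close>
lemma concentrated_comp_pbound:
  fixes a :: "'a::euclidean_space \<Rightarrow> complex"
  assumes a: "smooth_fn a" and L: "compact L" and "smooth_fn h" "3 * N + 2 * i \<le> k"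
  shows "\<exists>C\<ge>0. \<forall>f D \<epsilon>. 0 < \<epsilon> \<longrightarrow> \<epsilon> \<le> 1 \<longrightarrow> 0 \<le> D \<longrightarrow> concentrated N D \<epsilon> f \<longrightarrow>
    (\<forall>x\<in>L. pbound N (\<lambda>x. f (Re (a x * cnj (a x))) * (a x ^ k * h x)) x (C * D * \<epsilon> ^ i))"
  using assms(3,4)
proof (induction N arbitrary: i k h)
  have norm_bound: "norm (f (Re (a x * cnj (a x))) * (a x ^ k * h x)) \<le> C * D * \<epsilon> ^ i"
    if "0 < \<epsilon>" "\<epsilon> \<le> 1" "0 \<le> D" "concentrated N D \<epsilon> f" "norm (h x) \<le> C" "2 * i \<le> k"
    for f h x C D \<epsilon> i k N
  proof -
    have C: "0 \<le> C" using that(5) norm_ge_zero order_trans by blast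
    have q: "Re (a x * cnj (a x)) = (norm (a x))\<^sup>2"
      by (simp add: complex_mult_cnj cmod_power2)
    have f: "norm (f ((norm (a x))\<^sup>2)) \<le> (if (norm (a x))\<^sup>2 < \<epsilon> then D else 0)"
    proof -
      have "norm (dlist (replicate 0 1) f ((norm (a x))\<^sup>2)) \<le> (if (norm (a x))\<^sup>2 < \<epsilon> then D / \<epsilon> ^ 0 else 0)"
        using that(4) zero_le_power2 unfolding concentrated_def by blast
      then show ?thesis by (simp split: if_splits)
    qed
    show ?thesis
    proof (cases "(norm (a x))\<^sup>2 < \<epsilon>")
      case True
      then have 1: "norm (a x) \<le> 1" using that(2) power2_le_imp_le[of "norm (a x)" 1] by simp
      have "norm (a x) ^ k \<le> norm (a x) ^ (2 * i)" by (rule power_decreasing) (use that 1 in auto)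
      also have "\<dots> \<le> \<epsilon> ^ i" unfolding power_mult by (rule power_mono) (use True in auto)
      finally have "norm (a x) ^ k \<le> \<epsilon> ^ i" .
      then have "norm (f ((norm (a x))\<^sup>2)) * (norm (a x) ^ k * norm (h x)) \<le> D * (\<epsilon> ^ i * C)"
        using f True that C by (intro mult_mono) auto
      then show ?thesis by (simp only: q norm_mult norm_power mult_ac)
    next
      case False
      then show ?thesis using f that C by (simp only: q norm_mult if_False norm_le_zero_iff) simp
    qed
  qed
  {
    case 0
    obtain C where C: "0 \<le> C" "\<And>x. x \<in> L \<Longrightarrow> pbound 0 h x C"
      using pbound_compact[OF 0(1) L] by metis
    show ?case
      by (rule exI[of _ C]) (use C norm_bound[of _ _ 0] 0 in \<open>auto simp: pbound_0\<close>)
  next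
    case (Suc N)
    obtain C0 where C0: "0 \<le> C0" "\<And>x. x \<in> L \<Longrightarrow> pbound 0 h x C0"
      using pbound_compact[OF Suc(2) L] by metis
    obtain k' where k: "k = Suc k'" using Suc.prems by (cases k) auto
    define q where "q = (\<lambda>x. a x * cnj (a x))"
    have q: "smooth_fn q" unfolding q_def by (intro smooth_intros a)
    \<comment> \<open>A derivative either falls on \<open>f\<close>, leaving \<open>a ^ k\<close>
      with the new multiplier \<open>H1 b\<close>, or on \<open>a ^ k * h\<close>, leaving
      \<open>a ^ k'\<close> with the new multiplier \<open>H2 b\<close>.\<close>
    define H1 where "H1 b = (\<lambda>x. of_real (Re (pdir b q x)) * h x)" for b
    define H2 where "H2 b = (\<lambda>x. of_nat k * pdir b a x * h x + a x * pdir b h x)" for b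
    have H: "smooth_fn (H1 b)" "smooth_fn (H2 b)" if "b \<in> Basis" for b
      unfolding H1_def H2_def by (intro smooth_intros smooth_Re smooth_fn_pdir a q Suc.prems that)+
    define P where "P N k h i C \<longleftrightarrow> 0 \<le> C \<and> (\<forall>f D \<epsilon>. 0 < \<epsilon> \<longrightarrow> \<epsilon> \<le> 1 \<longrightarrow> 0 \<le> D \<longrightarrow> concentrated N D \<epsilon> f \<longrightarrow>
    (\<forall>x\<in>L. pbound N (\<lambda>x. f (Re (q x)) * (a x ^ k * h x)) x (C * D * \<epsilon> ^ i)))" for N k h i and C :: real
    have PD: "pbound N (\<lambda>x. f (Re (q x)) * (a x ^ k * h x)) x (C * D * \<epsilon> ^ i)"
      if "P N k h i C" "0 < \<epsilon>" "\<epsilon> \<le> 1" "0 \<le> D" "concentrated N D \<epsilon> f" "x \<in> L" for N k h i C f D \<epsilon> x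
      using that unfolding P_def by blast
    \<comment> \<open>Three powers of \<open>a\<close> per derivative cover both cases. When
      \<open>f\<close> is differentiated its bound worsens by \<open>1 / \<epsilon>\<close>, so
      \<open>Suc i\<close> powers of \<open>\<epsilon>\<close> are requested, which takes two powers
      of \<open>a\<close>; in the other case one power of \<open>a\<close> is lost.\<close>
    have "\<exists>C. P N k (H1 b) (Suc i) C" "\<exists>C. P N k' (H2 b) i C" if "b \<in> Basis" for b
      using Suc.IH[OF H(1)[OF that], of "Suc i" k] Suc.IH[OF H(2)[OF that], of i k'] Suc.prems k
      by (auto simp: P_def q_def)
    then obtain C1 C2 where C12: "\<And>b. b \<in> Basis \<Longrightarrow> P N k (H1 b) (Suc i) (C1 b)"
      "\<And>b. b \<in> Basis \<Longrightarrow> P N k' (H2 b) i (C2 b)" by metis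
    define C where "C = C0 + (\<Sum>b\<in>Basis. C1 b + C2 b)"
    have C12': "0 \<le> C1 b" "0 \<le> C2 b" if "b \<in> Basis" for b
      using C12[OF that] by (auto simp: P_def)
    have C0': "C0 \<le> C" unfolding C_def using C12' by (simp add: sum_nonneg)
    have C1: "C1 b + C2 b \<le> C" if "b \<in> Basis" for b
      unfolding C_def using member_le_sum[OF that, of "\<lambda>b. C1 b + C2 b"] C12' C0 by (simp add: add_increasing)
    show ?case
    proof (intro exI[of _ C] conjI allI impI ballI)
      show "0 \<le> C" using C0' C0 by simp
      fix f and D \<epsilon> :: real and x
      assume *: "0 < \<epsilon>" "\<epsilon> \<le> 1" "0 \<le> D" "concentrated (Suc N) D \<epsilon> f" "x \<in> L"
      have f: "smooth_fn f" using * by (simp add: concentrated_def)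
      have "norm (f (Re (q x)) * (a x ^ k * h x)) \<le> C0 * D * \<epsilon> ^ i"
        unfolding q_def
        by (rule norm_bound[OF *(1,2,3,4)]) (use C0(2)[OF *(5)] Suc.prems in \<open>auto simp: pbound_0\<close>)
      also have "\<dots> \<le> C * D * \<epsilon> ^ i" using C0' * by (intro mult_right_mono) auto
      finally have 1: "norm (f (Re (q x)) * (a x ^ k * h x)) \<le> C * D * \<epsilon> ^ i" .
      have "pbound N (pdir b (\<lambda>x. f (Re (q x)) * (a x ^ k * h x))) x (C * D * \<epsilon> ^ i)" if b: "b \<in> Basis" for b
      proof -
        have sm: "smooth_fn (\<lambda>x. f (Re (q x)))" "smooth_fn (\<lambda>x. a x ^ k * h x)"
          by (intro smooth_comp smooth_intros f q a Suc.prems)+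
        have "pdir b (\<lambda>x. f (Re (q x)) * (a x ^ k * h x)) =
          (\<lambda>x. pdir 1 f (Re (q x)) * (a x ^ k * H1 b x) + f (Re (q x)) * (a x ^ k' * H2 b x))"
          unfolding pdir_mult[OF sm b] pdir_Re_comp[OF f q b]
          unfolding k pdir_power_mult[OF a Suc.prems(1) b] H1_def H2_def by (simp add: algebra_simps)
        moreover have "pbound N (\<lambda>x. pdir 1 f (Re (q x)) * (a x ^ k * H1 b x)) x (C1 b * (D / \<epsilon>) * \<epsilon> ^ Suc i)"
          by (rule PD[OF C12(1)[OF b] *(1,2) _ concentrated_pdir[OF *(4)] *(5)]) (use * in auto)
        moreover have "pbound N (\<lambda>x. f (Re (q x)) * (a x ^ k' * H2 b x)) x (C2 b * D * \<epsilon> ^ i)"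
          by (rule PD[OF C12(2)[OF b] *(1,2,3) concentrated_mono[OF *(4)] *(5)])
        ultimately have "pbound N (pdir b (\<lambda>x. f (Re (q x)) * (a x ^ k * h x))) x
            (C1 b * (D / \<epsilon>) * \<epsilon> ^ Suc i + C2 b * D * \<epsilon> ^ i)"
          using f smooth_fn_pdir[OF f, of 1]
          by (simp only:) (intro pbound_add smooth_comp smooth_intros q a H b; simp)
        also have "C1 b * (D / \<epsilon>) * \<epsilon> ^ Suc i + C2 b * D * \<epsilon> ^ i = (C1 b + C2 b) * (D * \<epsilon> ^ i)"
          using * by (simp add: field_simps)
        finally have "pbound N (pdir b (\<lambda>x. f (Re (q x)) * (a x ^ k * h x))) x ((C1 b + C2 b) * (D * \<epsilon> ^ i))" .
        moreover have "(C1 b + C2 b) * (D * \<epsilon> ^ i) \<le> C * D * \<epsilon> ^ i"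
          using mult_right_mono[OF C1[OF b], of "D * \<epsilon> ^ i"] * by (simp add: mult.assoc)
        ultimately show ?thesis using pbound_mono by blast
      qed
      then show "pbound (Suc N) (\<lambda>x. f (Re (a x * cnj (a x))) * (a x ^ k * h x)) x (C * D * \<epsilon> ^ i)"
        using 1 by (simp add: pbound_Suc q_def)
    qed
  }
qed

text \<open>It is 1 up to \<open>s = 1/2\<close>, which after rescaling becomes the threshold
  \<open>\<epsilon>/2\<close>, and 0 from \<open>s = 3/4\<close> on, so that all derivatives vanish
  for \<open>s \<ge> 1\<close> including the endpoint.\<close>

definition lower_cutoff :: "real \<Rightarrow> complex" where
  "lower_cutoff s = of_real (smooth_step (3 - 4 * s))"

lemma smooth_lower_cutoff: "smooth_fn lower_cutoff"
proof -
  have "smooth_fn (\<lambda>x::real. complex_of_real (smooth_step (Re (3 - 4 * complex_of_real x))))"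
    using smooth_linear[OF bounded_linear_ident]
    by (intro smooth_smooth_step smooth_intros) auto
  then show ?thesis by (simp add: lower_cutoff_def[abs_def])
qed

lemma concentrated_lower_cutoff:
  obtains D where "0 \<le> D" "\<And>\<epsilon>. 0 < \<epsilon> \<Longrightarrow> concentrated N D \<epsilon> (\<lambda>s. lower_cutoff ((1/\<epsilon>) *\<^sub>R s))"
proof -
  obtain D where D: "0 \<le> D" "\<And>s. s \<in> {0..1} \<Longrightarrow> pbound N lower_cutoff s D"
    using pbound_compact[OF smooth_lower_cutoff, of "{0..1}" N] by auto
  show thesis
  proof (rule that[OF D(1)])
    fix \<epsilon> :: real assume \<epsilon>: "0 < \<epsilon>"
    have *: "dlist (replicate j 1) (\<lambda>s. lower_cutoff (0 + (1/\<epsilon>) *\<^sub>R s)) =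
        (\<lambda>s. of_real (1/\<epsilon>) ^ length (replicate j (1::real)) * dlist (replicate j 1) lower_cutoff (0 + (1/\<epsilon>) *\<^sub>R s))" for j
      by (rule dlist_scale_shift[OF smooth_lower_cutoff]) (auto simp: set_replicate_conv_if)
    have 0: "dlist bs lower_cutoff s = 0" if "s \<ge> 1" for s bs
    proof -
      have "dlist bs lower_cutoff s = dlist bs (\<lambda>_. 0) s"
        by (rule dlist_local[of "{3/4<..}"]) (use that in \<open>auto simp: lower_cutoff_def smooth_step_zero\<close>)
      then show ?thesis by simp
    qed
    show "concentrated N D \<epsilon> (\<lambda>s. lower_cutoff ((1/\<epsilon>) *\<^sub>R s))"
      unfolding concentrated_def
    proof (intro conjI allI impI)
      show "smooth_fn (\<lambda>s. lower_cutoff ((1/\<epsilon>) *\<^sub>R s))"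
        using smooth_scale_shift[OF smooth_lower_cutoff, of 0 "1/\<epsilon>"] by simp
      fix j s assume j: "j \<le> N" and s: "(0::real) \<le> s"
      show "norm (dlist (replicate j 1) (\<lambda>s. lower_cutoff ((1/\<epsilon>) *\<^sub>R s)) s) \<le> (if s < \<epsilon> then D / \<epsilon> ^ j else 0)"
      proof (cases "s < \<epsilon>")
        case True
        then have "norm (dlist (replicate j 1) lower_cutoff (s / \<epsilon>)) \<le> D"
          using D(2)[of "s / \<epsilon>"] s \<epsilon> j by (intro pboundD[of N]) (auto simp: set_replicate_conv_if)
        then show ?thesis using True \<epsilon> *[of j]
          by (simp add: norm_mult norm_power norm_divide divide_right_mono power_divide)
      next
        case False
        then show ?thesis using *[of j] 0[of "s / \<epsilon>"] \<epsilon> by simp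
      qed
    qed
  qed
qed

lemma neg_deriv_past: "\<phi> \<in> past_functions T \<Longrightarrow> neg_deriv \<phi> \<in> past_functions T"
  using pdir_past[of \<phi> T] by (auto simp: neg_deriv_def[abs_def] past_functions_def smooth_uminus)

lemma neg_deriv_pow_past: "\<phi> \<in> past_functions T \<Longrightarrow> (neg_deriv ^^ n) \<phi> \<in> past_functions T"
  by (induction n) (auto intro: neg_deriv_past)

text \<open>The function \<open>a n ^ k * h\<close> is cut where the square of
  \<open>norm (a n x)\<close> is comparable to \<open>\<epsilon>\<close>. On the outer part
  \<open>a n\<close> is invertible, so \<open>w\<close> vanishes; the inner part is of size
  \<open>\<epsilon>\<close> in the norm of order \<open>N\<close> that controls \<open>w\<close>.
  The splitting is arbitrary, so \<open>\<epsilon>\<close> may tend to 0.\<close>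

lemma pairing_power_leading_zero:
  assumes w: "bounded_pairing l T L w" and L: "compact L"
    and a: "\<And>j. j \<le> n \<Longrightarrow> smooth_fn (a j)"
    and eq: "\<And>\<phi> h. \<phi> \<in> past_functions T \<Longrightarrow> smooth_fn h \<Longrightarrow>
      (\<Sum>j\<le>n. w ((neg_deriv ^^ j) \<phi>) (\<lambda>x. a j x * h x)) = 0"
  obtains k where "\<And>\<phi> h. \<phi> \<in> past_functions T \<Longrightarrow> smooth_fn h \<Longrightarrow> w \<phi> (\<lambda>x. a n x ^ k * h x) = 0"
proof -
  obtain N C0 where C0: "0 \<le> C0" "pairing_le l T L N C0 w"
    using w by (rule bounded_pairingE)
  \<comment> \<open>The exponent that \<open>concentrated_comp_pbound\<close> asks for at order
    \<open>N\<close> in order to gain one power of \<open>\<epsilon>\<close>, that is with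
    \<open>i = 1\<close>.\<close>
  define k where "k = 3 * N + 2 * 1"
  define q where "q = (\<lambda>x. a n x * cnj (a n x))"
  have an: "smooth_fn (a n)" using a by simp
  have q: "smooth_fn q" unfolding q_def by (intro smooth_intros an)
  have Re_q: "q x = of_real (Re (q x))" "Re (q x) \<ge> 0" for x
    by (auto simp: q_def complex_eq_iff)
  obtain D where D: "0 \<le> D" "\<And>\<epsilon>. 0 < \<epsilon> \<Longrightarrow> concentrated N D \<epsilon> (\<lambda>s. lower_cutoff ((1/\<epsilon>) *\<^sub>R s))"
    using concentrated_lower_cutoff by metis
  show thesis
  proof (rule that[of k])
    fix \<phi> h assume \<phi>: "\<phi> \<in> past_functions T" and h: "smooth_fn (h :: 'a \<Rightarrow> complex)"
    obtain A where A: "0 \<le> A" "\<And>t. t \<in> {l..T} \<Longrightarrow> pbound N \<phi> t A"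
      using pbound_compact[OF past_functions_smooth[OF \<phi>] compact_Icc] by metis
    obtain C where C: "0 \<le> C" "\<And>f D \<epsilon> x. 0 < \<epsilon> \<Longrightarrow> \<epsilon> \<le> 1 \<Longrightarrow> 0 \<le> D \<Longrightarrow> concentrated N D \<epsilon> f \<Longrightarrow> x \<in> L \<Longrightarrow>
        pbound N (\<lambda>x. f (Re (q x)) * (a n x ^ k * h x)) x (C * D * \<epsilon> ^ 1)"
      using concentrated_comp_pbound[OF an L h, of N 1 k] by (auto simp: k_def q_def)
    have small: "norm (w \<phi> (\<lambda>x. a n x ^ k * h x)) \<le> C0 * A * (C * D) * \<epsilon>" if \<epsilon>: "0 < \<epsilon>" "\<epsilon> \<le> 1" for \<epsilon>
    proof -
      define f where "f = (\<lambda>s. lower_cutoff ((1/\<epsilon>) *\<^sub>R s))"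
      have f: "concentrated N D \<epsilon> f" "smooth_fn f"
        using D(2)[OF \<epsilon>(1)] by (auto simp: f_def concentrated_def)
      define h1 where "h1 = (\<lambda>x. (1 - f (Re (q x))) * (a n x ^ k * h x))"
      define h2 where "h2 = (\<lambda>x. f (Re (q x)) * (a n x ^ k * h x))"
      have h12: "smooth_fn h1" "smooth_fn h2"
        unfolding h1_def h2_def by (intro smooth_intros smooth_comp f q an h)+
      \<comment> \<open>The flat term is positive exactly where
        \<open>Re (q x) < \<epsilon>/2\<close>, so \<open>d\<close> has no zeros and still equals
        \<open>q\<close> wherever \<open>h1\<close> can be nonzero. The quotient \<open>c\<close> is
        therefore smooth everywhere and inverts \<open>a n\<close> there.\<close>
      define d where "d = (\<lambda>x. q x + of_real (flat_exp (Re (of_real (\<epsilon>/2) - q x))))"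
      have d: "d x \<noteq> 0" for x
      proof -
        have "Re (q x) + flat_exp (\<epsilon>/2 - Re (q x)) > 0"
          using Re_q(2)[of x] flat_exp_pos[of "\<epsilon>/2 - Re (q x)"] flat_exp_nonneg[of "\<epsilon>/2 - Re (q x)"] \<epsilon>
          by (cases "Re (q x) > 0") auto
        then have "Re (d x) > 0" by (simp add: d_def)
        then show ?thesis by auto
      qed
      define c where "c = (\<lambda>x. cnj (a n x) / d x)"
      have "smooth_fn d" unfolding d_def by (intro smooth_intros smooth_flat_exp q)
      then have c: "smooth_fn c" unfolding c_def by (intro smooth_intros an d)
      have "c x * a n x * h1 x = h1 x" for x
      proof (cases "Re (q x) \<ge> \<epsilon>/2")
        case True
        then have "d x = q x" by (simp add: d_def flat_exp_zero)
        then have "c x * a n x = 1" using d[of x] by (simp add: c_def q_def)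
        then show ?thesis by simp
      next
        case False
        then have "f (Re (q x)) = 1"
          using \<epsilon> by (simp add: f_def lower_cutoff_def smooth_step_one field_simps)
        then show ?thesis by (simp add: h1_def)
      qed
      then have "w \<phi> h1 = 0"
        by (intro pairing_zero_where_leading_invertible[OF w L a eq c h12(1) _ \<phi>])
      moreover have "(\<lambda>x. a n x ^ k * h x) = (\<lambda>x. h1 x + h2 x)"
        by (auto simp: h1_def h2_def algebra_simps)
      ultimately have "w \<phi> (\<lambda>x. a n x ^ k * h x) = w \<phi> h2"
        using bounded_pairing_add[OF w \<phi> h12] by simp
      moreover have "norm (w \<phi> h2) \<le> C0 * A * (C * D * \<epsilon> ^ 1)"
        by (rule pairing_leD[OF C0(2) \<phi> h12(2) A(1) _ A(2)])
          (use C(2)[OF \<epsilon> D(1) f(1)] C(1) D(1) \<epsilon> in \<open>auto simp: h2_def\<close>)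
      ultimately show ?thesis by (simp add: mult.assoc)
    qed
    have "((\<lambda>\<epsilon>. C0 * A * (C * D) * \<epsilon>) \<longlongrightarrow> C0 * A * (C * D) * 0) (at_right 0)"
      by (intro tendsto_intros)
    moreover have "\<forall>\<^sub>F \<epsilon> in at_right 0. norm (w \<phi> (\<lambda>x. a n x ^ k * h x)) \<le> C0 * A * (C * D) * \<epsilon>"
      using eventually_at_right_real[of 0 1] by (rule eventually_mono) (use small in auto)
    ultimately have "norm (w \<phi> (\<lambda>x. a n x ^ k * h x)) \<le> C0 * A * (C * D) * 0"
      by (intro tendsto_lowerbound[where F = "at_right 0"]) auto
    then show "w \<phi> (\<lambda>x. a n x ^ k * h x) = 0" by simp
  qed
qed

text \<open>On the compact set \<open>L\<close> the multiplier has bounded derivatives, so the order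
  \<open>N\<close> is kept. This allows an induction to be applied to \<open>w\<close> twisted by a
  power of a coefficient.\<close>

lemma bounded_pairing_mult:
  assumes w: "bounded_pairing l T L w" and L: "compact L" and g: "smooth_fn g"
  shows "bounded_pairing l T L (\<lambda>\<phi> h. w \<phi> (\<lambda>x. g x * h x))"
proof -
  obtain N C where C: "0 \<le> C" "pairing_le l T L N C w"
    using w by (rule bounded_pairingE)
  obtain M where M: "0 \<le> M" "\<And>x. x \<in> L \<Longrightarrow> pbound N g x M"
    using pbound_compact[OF g L] by metis
  have "pairing_le l T L N (C * (2 ^ N * M)) (\<lambda>\<phi> h. w \<phi> (\<lambda>x. g x * h x))"
    unfolding pairing_le_def
  proof (intro ballI allI impI)
    fix \<phi> h A B assume *: "\<phi> \<in> past_functions T" "smooth_fn h" "0 \<le> A" "0 \<le> B"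
      "\<forall>t\<in>{l..T}. pbound N \<phi> t A" "\<forall>x\<in>L. pbound N h x B"
    have "norm (w \<phi> (\<lambda>x. g x * h x)) \<le> C * A * (2 ^ N * M * B)"
      by (rule pairing_leD[OF C(2) *(1)]) (use * M in \<open>auto intro!: smooth_intros g pbound_mult\<close>)
    then show "norm (w \<phi> (\<lambda>x. g x * h x)) \<le> C * (2 ^ N * M) * A * B" by (simp add: mult_ac)
  qed
  moreover have "w \<phi> (\<lambda>x. g x * (h x + k x)) = w \<phi> (\<lambda>x. g x * h x) + w \<phi> (\<lambda>x. g x * k x)"
    if "\<phi> \<in> past_functions T" "smooth_fn h" "smooth_fn k" for \<phi> h k
    using bounded_pairing_add[OF w that(1) smooth_mult[OF g that(2)] smooth_mult[OF g that(3)]]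
    by (simp add: distrib_left)
  ultimately show ?thesis
    using C M unfolding bounded_pairing_def by (intro conjI exI[of _ N] exI[of _ "C * (2 ^ N * M)"]) auto
qed

text \<open>Induction on the order: after a power of the leading coefficient \<open>a n\<close> has been shown to annihilate
  \<open>w\<close>, the exponent is lowered one by one, since on pairings annihilated by \<open>a n\<close> the equation
  has order below \<open>n\<close>. The function \<open>f\<close> records that the lost coefficient still annihilates.\<close>
theorem pairing_unique_continuation:
  assumes "bounded_pairing l T L w" and L: "compact L"
    and a: "\<And>j. j < n \<Longrightarrow> smooth_fn (a j)" and "smooth_fn f"
    and "\<And>\<phi> h. \<phi> \<in> past_functions T \<Longrightarrow> smooth_fn h \<Longrightarrow> w \<phi> (\<lambda>x. f x * h x) = 0"
    and "\<And>\<phi> h. \<phi> \<in> past_functions T \<Longrightarrow> smooth_fn h \<Longrightarrow>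
      (\<Sum>j<n. w ((neg_deriv ^^ j) \<phi>) (\<lambda>x. a j x * h x)) = 0"
    and "\<And>x. f x \<noteq> 0 \<or> (\<exists>j<n. a j x \<noteq> 0)"
    and "\<phi> \<in> past_functions T" "smooth_fn h"
  shows "w \<phi> h = 0"
  using assms(1) assms(3-9)
proof (induction n arbitrary: w f \<phi> h)
  case 0
  \<comment> \<open>With no coefficients left, the assumption on common zeros says that
    \<open>f\<close> has none, so every \<open>h\<close> is a multiple of \<open>f\<close>.\<close>
  then have "smooth_fn (\<lambda>x. h x / f x)" by (intro smooth_intros) auto
  from 0(4)[OF 0(7) this] 0(6) show ?case by simp
next
  case (Suc n)
  note IHn = Suc.IH and prems = Suc.prems
  have an: "smooth_fn (a n)" using Suc.prems(2) by simp
  have "\<exists>k. \<forall>\<phi> h. \<phi> \<in> past_functions T \<longrightarrow> smooth_fn h \<longrightarrow> w \<phi> (\<lambda>x. a n x ^ k * h x) = 0"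
  proof (rule pairing_power_leading_zero[OF prems(1) L, of n a])
    show "smooth_fn (a j)" if "j \<le> n" for j using prems(2) that by simp
    show "(\<Sum>j\<le>n. w ((neg_deriv ^^ j) \<phi>) (\<lambda>x. a j x * h x)) = 0"
      if "\<phi> \<in> past_functions T" "smooth_fn h" for \<phi> h
      using prems(5)[OF that] by (simp only: lessThan_Suc_atMost)
  qed blast
  then obtain k where k: "\<And>\<phi> h. \<phi> \<in> past_functions T \<Longrightarrow> smooth_fn h \<Longrightarrow> w \<phi> (\<lambda>x. a n x ^ k * h x) = 0"
    by blast
  have "\<forall>\<phi> h. \<phi> \<in> past_functions T \<longrightarrow> smooth_fn h \<longrightarrow> w \<phi> (\<lambda>x. a n x ^ (k - i) * h x) = 0" if "i \<le> k" for i
    using that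
  proof (induction i)
    case 0
    then show ?case using k by simp
  next
    case (Suc i)
    define m where "m = k - Suc i"
    have m: "k - i = Suc m" using Suc.prems by (simp add: m_def)
    have IH: "w \<phi> (\<lambda>x. a n x ^ m * (a n x * h x)) = 0" if "\<phi> \<in> past_functions T" "smooth_fn h" for \<phi> h
      using Suc.IH Suc.prems that unfolding m by (simp add: mult_ac)
    \<comment> \<open>This sum of squared moduli vanishes only at common zeros of \<open>f\<close>
      and \<open>a n\<close>, so no common zeros appear when \<open>a n\<close> is dropped from the
      coefficients. It annihilates the pairing twisted by \<open>a n ^ m\<close>, because
      \<open>f\<close> and \<open>a n\<close> both do.\<close>
    define f' where "f' = (\<lambda>x. f x * cnj (f x) + a n x * cnj (a n x))"
    have "w \<phi> (\<lambda>x. a n x ^ m * h x) = 0" if "\<phi> \<in> past_functions T" "smooth_fn h" for \<phi> h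
    proof (rule IHn[where w = "\<lambda>\<phi> h. w \<phi> (\<lambda>x. a n x ^ m * h x)" and f = f'])
      show "bounded_pairing l T L (\<lambda>\<phi> h. w \<phi> (\<lambda>x. a n x ^ m * h x))"
        by (intro bounded_pairing_mult prems(1) L smooth_intros an)
      show "smooth_fn f'" unfolding f'_def by (intro smooth_intros an prems(3))
      show "w \<phi> (\<lambda>x. a n x ^ m * (f' x * h x)) = 0" if "\<phi> \<in> past_functions T" "smooth_fn h" for \<phi> h
      proof -
        have "(\<lambda>x. a n x ^ m * (f' x * h x)) =
          (\<lambda>x. f x * (a n x ^ m * cnj (f x) * h x) + a n x ^ m * (a n x * (cnj (a n x) * h x)))"
          by (auto simp: f'_def algebra_simps)
        then show ?thesis
          using bounded_pairing_add[OF prems(1) that(1), of "\<lambda>x. f x * (a n x ^ m * cnj (f x) * h x)"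
              "\<lambda>x. a n x ^ m * (a n x * (cnj (a n x) * h x))"]
            prems(4)[OF that(1), of "\<lambda>x. a n x ^ m * cnj (f x) * h x"]
            IH[OF that(1), of "\<lambda>x. cnj (a n x) * h x"] that(2)
          by (simp add: smooth_intros an prems(3))
      qed
      show "(\<Sum>j<n. w ((neg_deriv ^^ j) \<phi>) (\<lambda>x. a n x ^ m * (a j x * h x))) = 0"
        if "\<phi> \<in> past_functions T" "smooth_fn h" for \<phi> h
      proof -
        have "(\<Sum>j<Suc n. w ((neg_deriv ^^ j) \<phi>) (\<lambda>x. a j x * (a n x ^ m * h x))) = 0"
          by (intro prems(5) that smooth_intros an)
        then have *: "(\<Sum>j<Suc n. w ((neg_deriv ^^ j) \<phi>) (\<lambda>x. a n x ^ m * (a j x * h x))) = 0"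
          by (simp add: mult.left_commute)
        have "(neg_deriv ^^ n) \<phi> \<in> past_functions T"
          using that(1) by (rule neg_deriv_pow_past)
        from IH[OF this that(2)] * show ?thesis by simp
      qed
      show "f' x \<noteq> 0 \<or> (\<exists>j<n. a j x \<noteq> 0)" for x
      proof (rule disjCI)
        assume *: "\<not> (\<exists>j<n. a j x \<noteq> 0)"
        have "f x \<noteq> 0 \<or> a n x \<noteq> 0"
          using prems(6)[of x] * less_Suc_eq by auto
        moreover have "f' x = of_real ((norm (f x))\<^sup>2 + (norm (a n x))\<^sup>2)"
          by (simp only: f'_def of_real_add complex_norm_square)
        moreover have "(norm (f x))\<^sup>2 + (norm (a n x))\<^sup>2 \<noteq> 0"
          using calculation(1) by (simp add: sum_power2_eq_zero_iff)
        ultimately show "f' x \<noteq> 0" by (metis of_real_eq_0_iff)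
      qed
    qed (use that prems(2) in auto)
    then show ?case unfolding m_def by blast
  qed
  from this[of k] show ?case using Suc.prems(7,8) by simp
qed

subsection \<open>Continuity of distributions and tempered distributions\<close>

text \<open>One index serves for the weight and for the number of derivatives, as in
  \<open>schwartz_norm\<close>; being an upper bound, it includes the finiteness of the
  supremum.\<close>

definition sbound :: "nat \<Rightarrow> ('a::euclidean_space \<Rightarrow> complex) \<Rightarrow> real \<Rightarrow> bool" where
  "sbound N f B \<longleftrightarrow> (\<forall>x. pbound N f x (B / (1 + norm x) ^ N))"

lemma sbound_nonneg:
  fixes f :: "'a::euclidean_space \<Rightarrow> complex"
  assumes "sbound N f B"
  shows "0 \<le> B"
proof -
  have "pbound N f 0 (B / (1 + norm (0::'a)) ^ N)" using assms unfolding sbound_def by blast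
  from pbound_nonneg[OF this] show ?thesis by simp
qed

lemma sboundD:
  assumes "sbound N f B" "set bs \<subseteq> Basis" "length bs \<le> N"
  shows "(1 + norm x) ^ N * norm (dlist bs f x) \<le> B"
proof -
  have "norm (dlist bs f x) \<le> B / (1 + norm x) ^ N"
    using assms by (intro pboundD[of N]) (auto simp: sbound_def)
  moreover have "0 < (1 + norm x) ^ N" by (intro zero_less_power add_pos_nonneg) auto
  ultimately show ?thesis by (simp add: pos_le_divide_eq mult.commute)
qed

lemma sboundI:
  assumes "\<And>bs x. set bs \<subseteq> Basis \<Longrightarrow> length bs \<le> N \<Longrightarrow> (1 + norm x) ^ N * norm (dlist bs f x) \<le> B"
  shows "sbound N f B"
  unfolding sbound_def pbound_def
proof (intro allI impI)
  fix x :: 'a and bs :: "'a list" assume "set bs \<subseteq> Basis \<and> length bs \<le> N"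
  then have "(1 + norm x) ^ N * norm (dlist bs f x) \<le> B" using assms by blast
  moreover have "0 < (1 + norm x) ^ N" by (intro zero_less_power add_pos_nonneg) auto
  ultimately show "norm (dlist bs f x) \<le> B / (1 + norm x) ^ N" by (simp add: pos_le_divide_eq mult.commute)
qed

lemma sbound_mono:
  assumes "sbound N f B" "N' \<le> N" "B \<le> B'"
  shows "sbound N' f B'"
proof (rule sboundI)
  fix x :: 'a and bs :: "'a list" assume bs: "set bs \<subseteq> Basis" "length bs \<le> N'"
  have "(1 + norm x) ^ N' * norm (dlist bs f x) \<le> (1 + norm x) ^ N * norm (dlist bs f x)"
    using assms by (intro mult_right_mono power_increasing) auto
  also have "\<dots> \<le> B" using assms bs by (intro sboundD) auto
  finally show "(1 + norm x) ^ N' * norm (dlist bs f x) \<le> B'" using assms by simp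
qed

lemma sbound_cmult: "smooth_fn f \<Longrightarrow> sbound N f A \<Longrightarrow> sbound N (\<lambda>x. c * f x) (norm c * A)"
  unfolding sbound_def using pbound_cmult by fastforce

lemma sbound_add: "smooth_fn f \<Longrightarrow> smooth_fn g \<Longrightarrow> sbound N f A \<Longrightarrow> sbound N g B \<Longrightarrow> sbound N (\<lambda>x. f x + g x) (A + B)"
  unfolding sbound_def using pbound_add by (fastforce simp: add_divide_distrib)

lemma sbound_dlist:
  assumes "sbound (N + length cs) f B" "set cs \<subseteq> Basis"
  shows "sbound N (dlist cs f) B"
proof (rule sboundI)
  fix x :: 'a and bs :: "'a list" assume bs: "set bs \<subseteq> Basis" "length bs \<le> N"
  have "(1 + norm x) ^ N * norm (dlist (bs @ cs) f x) \<le> (1 + norm x) ^ (N + length cs) * norm (dlist (bs @ cs) f x)"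
    by (intro mult_right_mono power_increasing) auto
  also have "\<dots> \<le> B" using assms bs by (intro sboundD) auto
  finally show "(1 + norm x) ^ N * norm (dlist bs (dlist cs f) x) \<le> B" by (simp add: dlist_append)
qed

lemma schwartz_iff_sbound:
  fixes f :: "'a::euclidean_space \<Rightarrow> complex"
  shows "schwartz f \<longleftrightarrow> smooth_fn f \<and> (\<forall>N. \<exists>B. sbound N f B)"
proof safe
  assume f: "schwartz f"
  then show "smooth_fn f" by (simp add: schwartz_def)
  fix N
  define D where "D = {bs :: 'a list. set bs \<subseteq> Basis \<and> length bs \<le> N}"
  have "\<exists>B. \<forall>x. (1 + norm x) ^ N * norm (dlist bs f x) \<le> B" if "bs \<in> D" for bs
  proof -
    have "bounded (range (\<lambda>x. (1 + norm x) ^ N * norm (dlist bs f x)))"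
      using f that by (auto simp: schwartz_def D_def)
    then obtain B where "\<forall>y\<in>range (\<lambda>x. (1 + norm x) ^ N * norm (dlist bs f x)). norm y \<le> B"
      unfolding bounded_iff by blast
    then have "(1 + norm x) ^ N * norm (dlist bs f x) \<le> B" for x
      using norm_ge_zero[of x] by (auto simp: abs_mult dest: spec[of _ x])
    then show ?thesis by blast
  qed
  then obtain B where B: "\<And>bs x. bs \<in> D \<Longrightarrow> (1 + norm x) ^ N * norm (dlist bs f x) \<le> B bs" by metis
  have fin: "finite D" unfolding D_def by (rule finite_Basis_lists)
  have "sbound N f (\<Sum>bs\<in>D. \<bar>B bs\<bar>)"
  proof (rule sboundI)
    fix bs :: "'a list" and x assume "set bs \<subseteq> Basis" "length bs \<le> N"
    then have bs: "bs \<in> D" by (simp add: D_def)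
    have "(1 + norm x) ^ N * norm (dlist bs f x) \<le> \<bar>B bs\<bar>" using B[OF bs, of x] by simp
    also have "\<dots> \<le> (\<Sum>bs\<in>D. \<bar>B bs\<bar>)" by (rule member_le_sum[OF bs _ fin]) auto
    finally show "(1 + norm x) ^ N * norm (dlist bs f x) \<le> (\<Sum>bs\<in>D. \<bar>B bs\<bar>)" .
  qed
  then show "\<exists>B. sbound N f B" by blast
next
  assume f: "smooth_fn f" "\<forall>N. \<exists>B. sbound N f B"
  show "schwartz f"
    unfolding schwartz_def
  proof (intro conjI allI impI f(1))
    fix bs :: "'a list" and N assume bs: "set bs \<subseteq> Basis"
    obtain B where B: "sbound (N + length bs) f B" using f(2) by blast
    have "norm ((1 + norm x) ^ N * norm (dlist bs f x)) \<le> B" for x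
      using sboundD[OF sbound_dlist[OF B bs], of "[]" x] by (simp add: abs_mult)
    then show "bounded (range (\<lambda>x. (1 + norm x) ^ N * norm (dlist bs f x)))"
      unfolding bounded_iff by blast
  qed
qed

lemma schwartz_smooth: "schwartz f \<Longrightarrow> smooth_fn f"
  by (simp add: schwartz_def)

lemma schwartz_add: "schwartz f \<Longrightarrow> schwartz g \<Longrightarrow> schwartz (\<lambda>x. f x + g x)"
  unfolding schwartz_iff_sbound by (blast intro: sbound_add smooth_add)

lemma schwartz_cmult:
  assumes "schwartz f"
  shows "schwartz (\<lambda>x. c * f x)"
proof -
  have f: "smooth_fn f" "\<exists>B. sbound N f B" for N using assms by (auto simp: schwartz_iff_sbound)
  have "\<exists>B. sbound N (\<lambda>x. c * f x) B" for N
    using f(2)[of N] sbound_cmult[OF f(1), of N _ c] by blast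
  then show ?thesis using smooth_mult[OF smooth_const f(1)] by (simp add: schwartz_iff_sbound)
qed

lemma schwartz_diff: "schwartz f \<Longrightarrow> schwartz g \<Longrightarrow> schwartz (\<lambda>x. f x - g x)"
  using schwartz_add[OF _ schwartz_cmult, of f g "-1"] by simp

lemma schwartz_dlist: "schwartz f \<Longrightarrow> set bs \<subseteq> Basis \<Longrightarrow> schwartz (dlist bs f)"
  unfolding schwartz_iff_sbound by (blast intro: sbound_dlist smooth_fn_dlist)

lemma schwartz_zero: "schwartz (\<lambda>x. 0)"
  unfolding schwartz_iff_sbound sbound_def pbound_def by (auto intro!: smooth_const exI[of _ 0])

lemma test_fn_schwartz:
  assumes "test_fn (f :: 'a::euclidean_space \<Rightarrow> complex)"
  shows "schwartz f"
  unfolding schwartz_iff_sbound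
proof (intro conjI allI)
  fix N
  obtain B where B: "0 \<le> B" "\<And>x. pbound N f x B" using pbound_test[OF assms] by metis
  obtain R where R: "0 < R" "\<And>x. x \<in> tsupport f \<Longrightarrow> norm x \<le> R"
  proof -
    have "bounded (tsupport f)" using assms unfolding test_fn_def by (blast intro: compact_imp_bounded)
    then show thesis using that by (auto simp: bounded_pos)
  qed
  show "\<exists>B. sbound N f B"
  proof (intro exI sboundI)
    fix bs :: "'a list" and x assume bs: "set bs \<subseteq> Basis" "length bs \<le> N"
    show "(1 + norm x) ^ N * norm (dlist bs f x) \<le> (1 + R) ^ N * B"
    proof (cases "x \<in> tsupport f")
      case True
      then show ?thesis using R pboundD[OF B(2) bs] by (intro mult_mono power_mono) auto
    next
      case False
      then show ?thesis using R B by (simp add: dlist_eq_0_outside)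
    qed
  qed
qed (rule test_fn_smooth[OF assms])

text \<open>The supremum \<open>schwartz_norm\<close> can be compared with \<open>B\<close> once it
  is known to be finite, which \<open>sbound\<close> guarantees. The absolute value of
  \<open>C\<close> makes the estimate monotone, so any majorant may replace the norm.\<close>

lemma temperedE:
  fixes U :: "('a::euclidean_space \<Rightarrow> complex) \<Rightarrow> complex"
  assumes "tempered U"
  obtains N C where "0 \<le> C" "\<And>f B. schwartz f \<Longrightarrow> sbound N f B \<Longrightarrow> norm (U f) \<le> C * B"
proof -
  obtain C N where C: "\<And>f. schwartz f \<Longrightarrow> norm (U f) \<le> C * schwartz_norm N f"
    using assms unfolding tempered_def by blast
  show thesis
  proof (rule that[of "\<bar>C\<bar>" N])
    fix f :: "'a \<Rightarrow> complex" and B assume f: "schwartz f" "sbound N f B"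
    let ?S = "{(bs, x). set bs \<subseteq> (Basis :: 'a set) \<and> length bs \<le> N}"
    let ?F = "\<lambda>bx. (1 + norm (snd bx)) ^ N * norm (dlist (fst bx) f (snd bx))"
    have le: "?F bx \<le> B" if "bx \<in> ?S" for bx
      using sboundD[OF f(2)] that by auto
    have ne: "([], 0) \<in> ?S" by simp
    have "schwartz_norm N f \<le> B"
      unfolding schwartz_norm_def by (rule cSUP_least) (use ne le in blast)+
    moreover have "?F ([], 0) \<le> schwartz_norm N f"
      unfolding schwartz_norm_def by (rule cSUP_upper[OF ne]) (use le in \<open>auto intro!: bdd_aboveI2\<close>)
    then have "0 \<le> schwartz_norm N f" by (rule order_trans[rotated]) simp
    ultimately have "C * schwartz_norm N f \<le> \<bar>C\<bar> * B" by (intro mult_mono) auto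
    then show "norm (U f) \<le> \<bar>C\<bar> * B" using C[OF f(1)] by simp
  qed simp
qed

lemma distributionE:
  fixes U :: "('a::euclidean_space \<Rightarrow> complex) \<Rightarrow> complex"
  assumes "distribution U" "compact K"
  obtains N C where "0 \<le> C"
    "\<And>f B. smooth_fn f \<Longrightarrow> (\<And>x. x \<notin> K \<Longrightarrow> f x = 0) \<Longrightarrow> (\<And>x. pbound N f x B) \<Longrightarrow> norm (U f) \<le> C * B"
proof -
  have "\<forall>K. compact K \<longrightarrow> (\<exists>C N. \<forall>f. test_fn f \<and> tsupport f \<subseteq> K \<longrightarrow> norm (U f) \<le> C * supnorm_N N f)"
    using assms(1) unfolding distribution_def by (rule conjunct2)
  then have "\<exists>C N. \<forall>f. test_fn f \<and> tsupport f \<subseteq> K \<longrightarrow> norm (U f) \<le> C * supnorm_N N f"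
    by (elim allE[of _ K] impE) (rule assms(2))
  then obtain C N where C: "\<And>f. test_fn f \<Longrightarrow> tsupport f \<subseteq> K \<Longrightarrow> norm (U f) \<le> C * supnorm_N N f"
    by blast
  show thesis
  proof (rule that[of "\<bar>C\<bar>" N])
    fix f :: "'a \<Rightarrow> complex" and B assume f: "smooth_fn f" "\<And>x. x \<notin> K \<Longrightarrow> f x = 0" "\<And>x. pbound N f x B"
    have "{x. f x \<noteq> 0} \<subseteq> K" using f(2) by blast
    then have sup: "tsupport f \<subseteq> K" "test_fn f"
      using closure_minimal[OF _ compact_imp_closed[OF assms(2)]] f(1)
        bounded_subset[OF compact_imp_bounded[OF assms(2)]]
      by (simp_all add: tsupport_def test_fn_iff)
    let ?S = "{(bs, x). set bs \<subseteq> (Basis :: 'a set) \<and> length bs \<le> N}"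
    let ?F = "\<lambda>bx. norm (dlist (fst bx) f (snd bx))"
    have le: "?F bx \<le> B" if "bx \<in> ?S" for bx
      using pboundD[OF f(3)] that by auto
    have ne: "([], 0) \<in> ?S" by simp
    have "supnorm_N N f \<le> B"
      unfolding supnorm_N_def by (rule cSUP_least) (use ne le in blast)+
    moreover have "?F ([], 0) \<le> supnorm_N N f"
      unfolding supnorm_N_def by (rule cSUP_upper[OF ne]) (use le in \<open>auto intro!: bdd_aboveI2\<close>)
    then have "0 \<le> supnorm_N N f" by (rule order_trans[rotated]) simp
    ultimately have "C * supnorm_N N f \<le> \<bar>C\<bar> * B" by (intro mult_mono) auto
    then show "norm (U f) \<le> \<bar>C\<bar> * B" using C[OF sup(2,1)] by simp
  qed simp
qed

lemma distribution_lin: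
  "distribution U \<Longrightarrow> test_fn f \<Longrightarrow> test_fn g \<Longrightarrow> U (\<lambda>x. c * f x + g x) = c * U f + U g"
  by (simp add: distribution_def)

lemma distribution_zero: "distribution U \<Longrightarrow> U (\<lambda>x. 0) = 0"
  using distribution_lin[OF _ test_fn_zero test_fn_zero, of U 1] by simp

lemma distribution_add: "distribution U \<Longrightarrow> test_fn f \<Longrightarrow> test_fn g \<Longrightarrow> U (\<lambda>x. f x + g x) = U f + U g"
  using distribution_lin[of U f g 1] by simp

lemma distribution_cmult: "distribution U \<Longrightarrow> test_fn f \<Longrightarrow> U (\<lambda>x. c * f x) = c * U f"
  using distribution_lin[of U f "\<lambda>x. 0" c] by (simp add: test_fn_zero distribution_zero)

lemma distribution_diff: "distribution U \<Longrightarrow> test_fn f \<Longrightarrow> test_fn g \<Longrightarrow> U (\<lambda>x. f x - g x) = U f - U g"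
  using distribution_lin[of U g f "-1"] by simp

lemma distribution_sum:
  "distribution U \<Longrightarrow> (\<And>i. i \<in> I \<Longrightarrow> test_fn (f i)) \<Longrightarrow> U (\<lambda>x. \<Sum>i\<in>I. f i x) = (\<Sum>i\<in>I. U (f i))"
proof (induction I rule: infinite_finite_induct)
  case (insert i I)
  then show ?case using distribution_add[of U "f i" "\<lambda>x. \<Sum>i\<in>I. f i x"] by (simp add: test_fn_sum)
qed (simp_all add: distribution_zero)

lemma tempered_lin:
  "tempered U \<Longrightarrow> schwartz f \<Longrightarrow> schwartz g \<Longrightarrow> U (\<lambda>x. c * f x + g x) = c * U f + U g"
  by (simp add: tempered_def)

lemma tempered_zero: "tempered U \<Longrightarrow> U (\<lambda>x. 0) = 0"
  using tempered_lin[OF _ schwartz_zero schwartz_zero, of U 1] by simp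

lemma tempered_add: "tempered U \<Longrightarrow> schwartz f \<Longrightarrow> schwartz g \<Longrightarrow> U (\<lambda>x. f x + g x) = U f + U g"
  using tempered_lin[of U f g 1] by simp

lemma tempered_cmult: "tempered U \<Longrightarrow> schwartz f \<Longrightarrow> U (\<lambda>x. c * f x) = c * U f"
  using tempered_lin[of U f "\<lambda>x. 0" c] by (simp add: schwartz_zero tempered_zero)

lemma tempered_diff: "tempered U \<Longrightarrow> schwartz f \<Longrightarrow> schwartz g \<Longrightarrow> U (\<lambda>x. f x - g x) = U f - U g"
  using tempered_lin[of U g f "-1"] by simp

text \<open>The rate \<open>C / real (Suc n)\<close>, with \<open>C\<close> depending on
  \<open>N\<close>, is the concrete form of convergence in the Schwartz topology that all
  approximation results below deliver.\<close>

lemma tempered_tendsto_0: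
  assumes "tempered U" "\<And>n. schwartz (f n)" "schwartz g"
    and "\<And>N. \<exists>C. \<forall>n. sbound N (\<lambda>x. f n x - g x) (C / real (Suc n))"
  shows "(\<lambda>n. U (f n)) \<longlonglongrightarrow> U g"
proof -
  obtain N C where C: "0 \<le> C" "\<And>f B. schwartz f \<Longrightarrow> sbound N f B \<Longrightarrow> norm (U f) \<le> C * B"
    using temperedE[OF assms(1)] by metis
  obtain D where D: "\<And>n. sbound N (\<lambda>x. f n x - g x) (D / real (Suc n))" using assms(4) by blast
  have "norm (U (f n) - U g) \<le> C * (D / real (Suc n))" for n
    using C(2)[OF schwartz_diff[OF assms(2,3)] D, of n] tempered_diff[OF assms(1,2,3), of n] by simp
  moreover have "(\<lambda>n. C * (D / real (Suc n))) \<longlonglongrightarrow> C * 0"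
    by (intro tendsto_intros LIMSEQ_Suc[OF lim_const_over_n])
  ultimately have "(\<lambda>n. U (f n) - U g) \<longlonglongrightarrow> 0"
    by (intro Lim_null_comparison[of "\<lambda>n. U (f n) - U g" "\<lambda>n. C * (D / real (Suc n))"]) auto
  then show ?thesis by (simp add: LIM_zero_iff)
qed

section \<open>Smooth limits and the gliding hump\<close>

lemma set_real_Basis: "set bs \<subseteq> (Basis :: real set) \<Longrightarrow> bs = replicate (length bs) 1"
  by (metis Basis_real_def replicate_eqI singletonD subset_iff)

lemma pbound_real_iff:
  fixes f :: "real \<Rightarrow> complex"
  shows "pbound N f x B \<longleftrightarrow> (\<forall>j\<le>N. norm (dlist (replicate j 1) f x) \<le> B)"
proof
  assume *: "pbound N f x B"
  show "\<forall>j\<le>N. norm (dlist (replicate j 1) f x) \<le> B"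
    by (intro allI impI pboundD[OF *]) (auto simp: set_replicate_conv_if)
next
  assume *: "\<forall>j\<le>N. norm (dlist (replicate j 1) f x) \<le> B"
  show "pbound N f x B"
    unfolding pbound_def using * set_real_Basis by metis
qed

text \<open>Controlling the \<open>j\<close>-th derivative from index \<open>j\<close> on is enough
  for each derivative to converge uniformly; the limits are then derivatives of one another, and the
  class of all these limits is closed under differentiation.\<close>

lemma smooth_limit:
  fixes S :: "nat \<Rightarrow> real \<Rightarrow> complex"
  assumes S: "\<And>k. smooth_fn (S k)"
    and cauchy: "\<And>j k t. j \<le> k \<Longrightarrow> norm (dlist (replicate j 1) (S (Suc k)) t - dlist (replicate j 1) (S k) t) \<le> (1/2) ^ k"
  obtains \<Phi> where "smooth_fn \<Phi>" "\<And>t. (\<lambda>k. S k t) \<longlonglongrightarrow> \<Phi> t"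
    "\<And>N k t. N \<le> k \<Longrightarrow> pbound N (\<lambda>t. \<Phi> t - S k t) t (2 * (1/2) ^ k)"
proof -
  define s where "s j k t = dlist (replicate j 1) (S k) t" for j k t
  \<comment> \<open>Keeping the subtracted tail makes the telescoping estimate reproduce itself in
    the induction on \<open>m\<close>.\<close>
  have diff: "norm (s j (k + m) t - s j k t) \<le> 2 * (1/2) ^ k - 2 * (1/2) ^ (k + m)" if "j \<le> k" for j k m t
  proof (induction m)
    case (Suc m)
    have "norm (s j (Suc (k + m)) t - s j k t) \<le> norm (s j (Suc (k + m)) t - s j (k + m) t) + norm (s j (k + m) t - s j k t)"
      using norm_triangle_ineq[of "s j (Suc (k + m)) t - s j (k + m) t" "s j (k + m) t - s j k t"] by simp
    also have "\<dots> \<le> (1/2) ^ (k + m) + (2 * (1/2) ^ k - 2 * (1/2) ^ (k + m))"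
      using cauchy[of j "k + m" t] that Suc by (intro add_mono) (auto simp: s_def)
    finally show ?case by simp
  qed simp
  have diff': "norm (s j m t - s j k t) \<le> 2 * (1/2) ^ k" if "j \<le> k" "k \<le> m" for j k m t
    using diff[OF that(1), of "m - k" t] that zero_le_power[of "1/2::real" m]
    by (simp del: zero_le_power) 
  have conv: "convergent (\<lambda>k. s j k t)" for j t
  proof (rule Cauchy_convergent, rule CauchyI)
    fix e :: real assume "0 < e"
    have "(\<lambda>k. 4 * (1/2::real) ^ k) \<longlonglongrightarrow> 4 * 0" by (intro tendsto_intros LIMSEQ_realpow_zero) auto
    then have "\<forall>\<^sub>F k in sequentially. 4 * (1/2::real) ^ k < e \<and> j \<le> k"
      using \<open>0 < e\<close> by (intro eventually_conj order_tendstoD(2)[of _ "4 * 0"] eventually_ge_at_top) auto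
    then obtain K where K: "4 * (1/2::real) ^ K < e" "j \<le> K" using eventually_happens by fastforce
    have "norm (s j m t - s j n t) < e" if "m \<ge> K" "n \<ge> K" for m n
      using norm_triangle_ineq4[of "s j m t - s j K t" "s j n t - s j K t"]
        diff'[OF K(2) that(1), of t] diff'[OF K(2) that(2), of t] K(1) by simp
    then show "\<exists>M. \<forall>m\<ge>M. \<forall>n\<ge>M. norm (s j m t - s j n t) < e" by blast
  qed
  define \<Phi> where "\<Phi> j t = lim (\<lambda>k. s j k t)" for j t
  have lim: "(\<lambda>k. s j k t) \<longlonglongrightarrow> \<Phi> j t" for j t
    using conv convergent_LIMSEQ_iff unfolding \<Phi>_def by blast
  have bound: "norm (\<Phi> j t - s j k t) \<le> 2 * (1/2) ^ k" if "j \<le> k" for j k t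
    by (rule tendsto_upperbound[of "\<lambda>m. norm (s j m t - s j k t)" _ sequentially])
      (auto intro!: tendsto_intros lim eventually_sequentiallyI[of k] diff' that)
  have der: "(\<Phi> j has_vector_derivative \<Phi> (Suc j) t) (at t)" for j t
  proof -
    have "\<exists>g. \<forall>x\<in>UNIV. (\<lambda>n. s j n x) \<longlonglongrightarrow> g x \<and> (g has_derivative (\<lambda>h. h *\<^sub>R \<Phi> (Suc j) x)) (at x within UNIV)"
    proof (rule has_derivative_sequence[where f' = "\<lambda>n x h. h *\<^sub>R s (Suc j) n x" and ?x0.0 = 0])
      show "(\<lambda>n. s j n 0) \<longlonglongrightarrow> \<Phi> j 0" by (rule lim)
      show "(s j n has_derivative (\<lambda>h. h *\<^sub>R s (Suc j) n x)) (at x within UNIV)" for n x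
        using smooth_fn_has_vector_derivative[OF smooth_fn_dlist[OF S, of "replicate j 1" n]]
        by (auto simp: s_def[abs_def] has_vector_derivative_def set_replicate_conv_if)
      fix e :: real assume "0 < e"
      have "(\<lambda>k. 2 * (1/2::real) ^ k) \<longlonglongrightarrow> 2 * 0" by (intro tendsto_intros LIMSEQ_realpow_zero) auto
      then have "\<forall>\<^sub>F k in sequentially. 2 * (1/2::real) ^ k < e"
        using \<open>0 < e\<close> by (intro order_tendstoD(2)[of _ "2 * 0"]) auto
      moreover have "\<forall>\<^sub>F k in sequentially. k \<ge> Suc j" by (rule eventually_ge_at_top)
      ultimately show "\<forall>\<^sub>F n in sequentially. \<forall>x\<in>UNIV. \<forall>h. norm (h *\<^sub>R s (Suc j) n x - h *\<^sub>R \<Phi> (Suc j) x) \<le> e * norm h"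
      proof eventually_elim
        case (elim n)
        have "norm (s (Suc j) n x - \<Phi> (Suc j) x) \<le> e" for x
          using bound[OF elim(2), of x] elim(1) by (simp add: norm_minus_commute)
        then have "\<bar>h\<bar> * norm (s (Suc j) n x - \<Phi> (Suc j) x) \<le> \<bar>h\<bar> * e" for x h
          by (intro mult_left_mono) auto
        then show ?case
          by (simp add: scaleR_diff_right[symmetric] mult.commute[of e])
      qed
    qed auto
    then obtain g where g: "\<And>x. (\<lambda>n. s j n x) \<longlonglongrightarrow> g x" "(g has_derivative (\<lambda>h. h *\<^sub>R \<Phi> (Suc j) t)) (at t)"
      by auto
    have "g = \<Phi> j" using LIMSEQ_unique[OF g(1) lim] by auto
    then show ?thesis using g(2) by (simp add: has_vector_derivative_def)
  qed
  have smooth: "smooth_fn (\<Phi> j)" for j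
  proof (rule smooth_fn_coinduct[where P = "\<lambda>f. \<exists>j. f = \<Phi> j"])
    fix f and b :: real assume "\<exists>j. f = \<Phi> j"
    then obtain j where j: "f = \<Phi> j" by blast
    show "continuous_on UNIV f"
      unfolding j continuous_on_eq_continuous_at[OF open_UNIV]
      using has_vector_derivative_continuous[OF der] by blast
    assume "b \<in> Basis"
    then show "\<exists>f'. (\<exists>j. f' = \<Phi> j) \<and> (\<forall>x. has_pdir b f x (f' x))"
      using has_pdirI_real[OF der[of j]] j by auto
  qed blast
  have dl: "dlist (replicate i 1) (\<Phi> 0) = \<Phi> i" for i
  proof (induction i)
    case (Suc i)
    then show ?case using has_pdir_imp[OF has_pdirI_real[OF der[of i]]] by auto
  qed simp
  show thesis
  proof (rule that[of "\<Phi> 0"])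
    show "(\<lambda>k. S k t) \<longlonglongrightarrow> \<Phi> 0 t" for t using lim[of 0 t] by (simp add: s_def)
    show "pbound N (\<lambda>t. \<Phi> 0 t - S k t) t (2 * (1/2) ^ k)" if "N \<le> k" for N k t
      using bound[of _ k t] that
      by (auto simp: pbound_real_iff dlist_diff[OF smooth S] set_replicate_conv_if dl s_def)
  qed (rule smooth)
qed

text \<open>A gliding hump argument: if the functionals \<open>b n\<close> were large on the small functions \<open>\<phi> n\<close>, then
  signs could be chosen such that they are unbounded on a sum of a subsequence of the \<open>\<phi> n\<close>.\<close>
lemma gliding_hump:
  fixes \<phi> :: "nat \<Rightarrow> real \<Rightarrow> complex" and b :: "nat \<Rightarrow> (real \<Rightarrow> complex) \<Rightarrow> complex"
  assumes b: "\<And>n. distribution (b n)" and K: "compact K"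
    and \<phi>: "\<And>m. smooth_fn (\<phi> m)" "\<And>m t. t \<notin> K \<Longrightarrow> \<phi> m t = 0" "\<And>m t. pbound m (\<phi> m) t ((1/2) ^ m)"
    and bounded: "\<And>\<Phi>. test_fn \<Phi> \<Longrightarrow> \<exists>R. \<forall>n. norm (b n \<Phi>) \<le> R"
  shows "\<exists>m. norm (b m (\<phi> m)) < real m"
proof (rule ccontr)
  assume "\<not> (\<exists>m. norm (b m (\<phi> m)) < real m)"
  then have large: "norm (b m (\<phi> m)) \<ge> real m" for m by (simp add: not_less)
  define adm where "adm f \<longleftrightarrow> smooth_fn f \<and> (\<forall>t. t \<notin> K \<longrightarrow> f t = 0)" for f :: "real \<Rightarrow> complex"
  have adm_test: "test_fn f" if "adm f" for f
  proof -
    have "{x. f x \<noteq> 0} \<subseteq> K" using that by (auto simp: adm_def)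
    then show ?thesis
      using that bounded_subset[OF compact_imp_bounded[OF K]] by (auto simp: test_fn_iff adm_def)
  qed
  have adm_\<phi>: "adm (\<phi> m)" for m using \<phi> by (auto simp: adm_def)
  have tail: "\<exists>M. \<forall>m\<ge>M. norm (b i (\<phi> m)) \<le> e" if "0 < e" for e i
  proof -
    obtain C N where C: "0 \<le> C"
      "\<forall>f B. smooth_fn f \<longrightarrow> (\<forall>x. x \<notin> K \<longrightarrow> f x = 0) \<longrightarrow> (\<forall>x. pbound N f x B) \<longrightarrow> norm (b i f) \<le> C * B"
      using distributionE[OF b[of i] K] by metis
    have "(\<lambda>m. C * (1/2::real) ^ m) \<longlonglongrightarrow> C * 0" by (intro tendsto_intros LIMSEQ_realpow_zero) auto
    then have "\<forall>\<^sub>F m in sequentially. C * (1/2::real) ^ m < e"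
      using that by (intro order_tendstoD(2)[of _ "C * 0"]) auto
    then have "\<forall>\<^sub>F m in sequentially. N \<le> m \<and> C * (1/2::real) ^ m < e"
      by (intro eventually_conj eventually_ge_at_top)
    then have "\<forall>\<^sub>F m in sequentially. norm (b i (\<phi> m)) \<le> e"
    proof (rule eventually_mono)
      fix m assume m: "N \<le> m \<and> C * (1/2::real) ^ m < e"
      have "\<forall>t. pbound N (\<phi> m) t ((1/2) ^ m)" using pbound_mono[OF \<phi>(3)] m by auto
      then have "norm (b i (\<phi> m)) \<le> C * (1/2) ^ m" using C(2) \<phi>(1,2) by blast
      then show "norm (b i (\<phi> m)) \<le> e" using m by simp
    qed
    then show ?thesis by (simp add: eventually_sequentially)
  qed
  define P where "P k x \<longleftrightarrow> k \<le> fst x \<and> adm (snd x) \<and> norm (b (fst x) (snd x)) \<ge> real (fst x)"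
    for k and x :: "nat \<times> (real \<Rightarrow> complex)"
  define Q where "Q k x y \<longleftrightarrow> fst x < fst y \<and> (\<forall>i\<le>fst x. norm (b i (\<phi> (fst y))) \<le> (1/2) ^ k) \<and>
      (snd y = (\<lambda>t. snd x t + \<phi> (fst y) t) \<or> snd y = (\<lambda>t. snd x t - \<phi> (fst y) t))"
    for k and x y :: "nat \<times> (real \<Rightarrow> complex)"
  have "\<exists>g. \<forall>k. P k (g k) \<and> Q k (g k) (g (Suc k))"
  proof (rule dependent_nat_choice)
    show "\<exists>x. P 0 x" by (rule exI[of _ "(0, \<phi> 0)"]) (simp add: P_def adm_\<phi>)
    fix x k assume x: "P k x"
    obtain n S where nS: "x = (n, S)" by fastforce
    have S: "adm S" "k \<le> n" using x by (auto simp: P_def nS)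
    have "\<exists>M. \<forall>i. \<forall>m\<ge>M i. norm (b i (\<phi> m)) \<le> (1/2) ^ k"
      using tail[of "(1/2) ^ k"] by (intro choice) auto
    then obtain M where M: "\<And>i m. m \<ge> M i \<Longrightarrow> norm (b i (\<phi> m)) \<le> (1/2) ^ k" by blast
    \<comment> \<open>The sum exceeds each threshold \<open>M i\<close>, so the new hump is small
      for every \<open>b i\<close> with \<open>i \<le> n\<close>; \<open>Suc n\<close> makes the
      indices strictly increasing.\<close>
    define n' where "n' = Suc n + (\<Sum>i\<le>n. M i)"
    have n': "norm (b i (\<phi> n')) \<le> (1/2) ^ k" if "i \<le> n" for i
      using member_le_sum[of i "{..n}" M] that by (intro M) (simp add: n'_def)
    define Sp Sm where "Sp = (\<lambda>t. S t + \<phi> n' t)" and "Sm = (\<lambda>t. S t - \<phi> n' t)"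
    have adm_pm: "adm Sp" "adm Sm"
      using S(1) adm_\<phi>[of n'] by (auto simp: Sp_def Sm_def adm_def intro!: smooth_intros)
    \<comment> \<open>The two candidates differ by twice the hump, on which \<open>b n'\<close> has
      norm at least \<open>n'\<close>. Hence for one of the signs the value on the new partial sum
      has norm at least \<open>n'\<close>.\<close>
    have "b n' Sp - b n' Sm = 2 * b n' (\<phi> n')"
      using distribution_add[OF b adm_test[OF S(1)] adm_test[OF adm_\<phi>], of n' n']
        distribution_diff[OF b adm_test[OF S(1)] adm_test[OF adm_\<phi>], of n' n']
      by (simp add: Sp_def Sm_def)
    then have "2 * norm (b n' (\<phi> n')) \<le> norm (b n' Sp) + norm (b n' Sm)"
      using norm_triangle_ineq4[of "b n' Sp" "b n' Sm"] by (simp add: norm_mult)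
    then have "norm (b n' Sp) \<ge> real n' \<or> norm (b n' Sm) \<ge> real n'"
      using large[of n'] by linarith
    then have "P (Suc k) (n', Sp) \<or> P (Suc k) (n', Sm)"
      using adm_pm S(2) by (auto simp: P_def n'_def)
    moreover have "Q k x (n', Sp)" "Q k x (n', Sm)"
      using n' by (auto simp: Q_def nS Sp_def Sm_def n'_def)
    ultimately show "\<exists>y. P (Suc k) y \<and> Q k x y" by blast
  qed
  then obtain g where g: "\<And>k. P k (g k)" "\<And>k. Q k (g k) (g (Suc k))" by blast
  define n S where "n k = fst (g k)" and "S k = snd (g k)" for k
  have n: "k \<le> n k" "n k < n (Suc k)" for k using g by (auto simp: P_def Q_def n_def)
  have S: "adm (S k)" "norm (b (n k) (S k)) \<ge> real (n k)" for k
    using g(1)[of k] by (auto simp: P_def S_def n_def)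
  have step: "S (Suc k) = (\<lambda>t. S k t + \<phi> (n (Suc k)) t) \<or> S (Suc k) = (\<lambda>t. S k t - \<phi> (n (Suc k)) t)" for k
    using g(2)[of k] by (auto simp: Q_def S_def n_def)
  have small: "norm (b i (\<phi> (n (Suc k)))) \<le> (1/2) ^ k" if "i \<le> n k" for i k
    using g(2)[of k] that by (auto simp: Q_def n_def)
  have smS: "smooth_fn (S k)" for k using S(1) by (simp add: adm_def)
  have "\<exists>\<Phi>. smooth_fn \<Phi> \<and> (\<forall>t. (\<lambda>k. S k t) \<longlonglongrightarrow> \<Phi> t) \<and>
    (\<forall>N k t. N \<le> k \<longrightarrow> pbound N (\<lambda>t. \<Phi> t - S k t) t (2 * (1/2) ^ k))"
  proof (rule smooth_limit[OF smS])
    fix j k t assume jk: "j \<le> (k::nat)"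
    have bs: "set (replicate j (1::real)) \<subseteq> Basis" by (auto simp: set_replicate_conv_if)
    have "norm (dlist (replicate j 1) (\<phi> (n (Suc k))) t) \<le> (1/2) ^ n (Suc k)"
      using n(1)[of "Suc k"] jk bs by (intro pboundD[OF \<phi>(3)]) auto
    also have "\<dots> \<le> (1/2) ^ k" using n(1)[of "Suc k"] by (intro power_decreasing) auto
    finally show "norm (dlist (replicate j 1) (S (Suc k)) t - dlist (replicate j 1) (S k) t) \<le> (1/2) ^ k"
      using step[of k] by (auto simp: dlist_add[OF smS \<phi>(1) bs] dlist_diff[OF smS \<phi>(1) bs])
  qed blast
  then obtain \<Phi> where \<Phi>: "smooth_fn \<Phi>" "\<And>t. (\<lambda>k. S k t) \<longlonglongrightarrow> \<Phi> t"
    "\<And>N k t. N \<le> k \<Longrightarrow> pbound N (\<lambda>t. \<Phi> t - S k t) t (2 * (1/2) ^ k)" by blast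
  have adm\<Phi>: "adm \<Phi>"
  proof -
    have "\<Phi> t = 0" if "t \<notin> K" for t
    proof -
      have "(\<lambda>k. S k t) = (\<lambda>k. 0)" using S(1) that by (auto simp: adm_def)
      then show ?thesis using \<Phi>(2)[of t] LIMSEQ_unique tendsto_const by metis
    qed
    then show ?thesis using \<Phi>(1) by (simp add: adm_def)
  qed
  obtain R where R: "\<And>n. norm (b n \<Phi>) \<le> R" using bounded[OF adm_test[OF adm\<Phi>]] by blast
  \<comment> \<open>All later humps together change \<open>b (n k)\<close> by at most the geometric
    sum 2, and continuity of \<open>b (n k)\<close> carries the lower bound over to the limit
    \<open>\<Phi>\<close>.\<close>
  have "real (n k) \<le> R + 2" for k
  proof -
    have mono: "n k \<le> n m" if "k \<le> m" for m
      using that n(2) lift_Suc_mono_le[of n k m] by (simp add: less_imp_le)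
    have "norm (b (n k) (S (k + m)) - b (n k) (S k)) \<le> 2 * (1/2) ^ k - 2 * (1/2) ^ (k + m)" for m
    proof (induction m)
      case (Suc m)
      have "b (n k) (S (Suc (k + m))) - b (n k) (S (k + m)) \<in> {b (n k) (\<phi> (n (Suc (k + m)))), - b (n k) (\<phi> (n (Suc (k + m))))}"
        using step[of "k + m"] distribution_add[OF b adm_test[OF S(1)] adm_test[OF adm_\<phi>], of "n k" "k + m"]
          distribution_diff[OF b adm_test[OF S(1)] adm_test[OF adm_\<phi>], of "n k" "k + m"] by auto
      then have "norm (b (n k) (S (Suc (k + m))) - b (n k) (S (k + m))) \<le> (1/2) ^ (k + m)"
        using small[OF mono[of "k + m"]] by auto
      then have "norm (b (n k) (S (Suc (k + m))) - b (n k) (S k)) \<le> (1/2) ^ (k + m) + (2 * (1/2) ^ k - 2 * (1/2) ^ (k + m))"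
        using Suc norm_triangle_ineq[of "b (n k) (S (Suc (k + m))) - b (n k) (S (k + m))" "b (n k) (S (k + m)) - b (n k) (S k)"]
        by simp
      then show ?case by simp
    qed simp
    note tele = this
    have 1: "norm (b (n k) (S (k + m)) - b (n k) (S k)) \<le> 2" for m
    proof -
      have "(1/2::real) ^ k \<le> 1" "0 \<le> (1/2::real) ^ (k + m)" by (simp_all add: power_le_one)
      then show ?thesis using tele[of m] by linarith
    qed
    obtain C N where C: "0 \<le> C"
      "\<forall>f B. smooth_fn f \<longrightarrow> (\<forall>x. x \<notin> K \<longrightarrow> f x = 0) \<longrightarrow> (\<forall>x. pbound N f x B) \<longrightarrow> norm (b (n k) f) \<le> C * B"
      using distributionE[OF b[of "n k"] K] by metis
    have 2: "norm (b (n k) \<Phi>) \<ge> real (n k) - 2 - C * (2 * (1/2) ^ m)" if "m \<ge> N" "m \<ge> k" for m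
    proof -
      have "adm (\<lambda>t. \<Phi> t - S m t)" using adm\<Phi> S(1)[of m] by (auto simp: adm_def intro!: smooth_intros)
      then have "norm (b (n k) (\<lambda>t. \<Phi> t - S m t)) \<le> C * (2 * (1/2) ^ m)"
        using C(2) \<Phi>(3)[OF that(1)] by (auto simp: adm_def)
      then have "norm (b (n k) \<Phi> - b (n k) (S m)) \<le> C * (2 * (1/2) ^ m)"
        using distribution_diff[OF b adm_test[OF adm\<Phi>] adm_test[OF S(1)], of "n k" m] by simp
      moreover have "norm (b (n k) (S m) - b (n k) (S k)) \<le> 2" using 1[of "m - k"] that by simp
      ultimately show ?thesis
        using S(2)[of k] norm_triangle_ineq2[of "b (n k) (S k)" "b (n k) (S k) - b (n k) \<Phi>"]
          norm_triangle_ineq[of "b (n k) \<Phi> - b (n k) (S m)" "b (n k) (S m) - b (n k) (S k)"]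
        by (simp add: norm_minus_commute)
    qed
    have "(\<lambda>m. real (n k) - 2 - C * (2 * (1/2::real) ^ m)) \<longlonglongrightarrow> real (n k) - 2 - C * (2 * 0)"
      by (intro tendsto_intros LIMSEQ_realpow_zero) auto
    then have "real (n k) - 2 - C * (2 * 0) \<le> norm (b (n k) \<Phi>)"
      by (rule LIMSEQ_le_const2) (use 2 in \<open>auto intro!: exI[of _ "max N k"]\<close>)
    then show ?thesis using R[of "n k"] by simp
  qed
  then have "real k \<le> R + 2" for k using n(1)[of k] of_nat_mono order_trans by blast
  then show False using reals_Archimedean2[of "R + 2"] by (meson not_le)
qed

subsection \<open>The Fourier transform of test functions\<close>

text \<open>From the index of a norm controlling \<open>U\<close> on, the values are at most
  \<open>C\<close>, and finitely many remain. This supplies the pointwise boundedness that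
  \<open>gliding_hump\<close> asks for.\<close>

lemma sbound_tendsto_bounded:
  assumes U: "tempered U" and \<psi>: "\<And>m. schwartz (\<psi> m)" "\<And>m. sbound m (\<psi> m) 1"
  shows "\<exists>R. \<forall>m. norm (U (\<psi> m)) \<le> R"
proof -
  obtain N C where C: "0 \<le> C" "\<forall>f B. schwartz f \<longrightarrow> sbound N f B \<longrightarrow> norm (U f) \<le> C * B"
    using temperedE[OF U] by metis
  have late: "norm (U (\<psi> m)) \<le> C" if "N \<le> m" for m
    using C(2) \<psi>(1)[of m] sbound_mono[OF \<psi>(2)[of m] that order_refl] by fastforce
  have "norm (U (\<psi> m)) \<le> C + (\<Sum>i<N. norm (U (\<psi> i)))" for m
  proof (cases "N \<le> m")
    case True
    then show ?thesis using late[OF True] sum_nonneg[of "{..<N}" "\<lambda>i. norm (U (\<psi> i))"] by simp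
  next
    case False
    then have "norm (U (\<psi> m)) \<le> (\<Sum>i<N. norm (U (\<psi> i)))" by (intro member_le_sum) auto
    then show ?thesis using C(1) by simp
  qed
  then show ?thesis by blast
qed

text \<open>By contradiction: a violating pair for every order \<open>m\<close> is normalised so
  that the time factors become as small as \<open>gliding_hump\<close> requires and the space
  factors stay bounded under each tempered functional, while the pairing still exceeds
  \<open>m\<close>.\<close>

lemma joint_continuity:
  fixes u :: "(real \<Rightarrow> complex) \<Rightarrow> ('a::euclidean_space \<Rightarrow> complex) \<Rightarrow> complex"
  assumes d: "\<And>\<psi>. schwartz \<psi> \<Longrightarrow> distribution (\<lambda>\<phi>. u \<phi> \<psi>)"
    and t: "\<And>\<phi>. test_fn \<phi> \<Longrightarrow> tempered (u \<phi>)" and K: "compact K"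
  shows "\<exists>N C. 0 \<le> C \<and> (\<forall>\<phi> \<psi> A B. smooth_fn \<phi> \<longrightarrow> (\<forall>t. t \<notin> K \<longrightarrow> \<phi> t = 0) \<longrightarrow> schwartz \<psi> \<longrightarrow>
    (\<forall>t. pbound N \<phi> t A) \<longrightarrow> sbound N \<psi> B \<longrightarrow> norm (u \<phi> \<psi>) \<le> C * A * B)"
proof (rule ccontr)
  assume "\<not> ?thesis"
  \<comment> \<open>In the constant \<open>m * 2 ^ m\<close> the power of 2 pays for shrinking the
    time factor to size \<open>(1/2) ^ m\<close>, and \<open>m\<close> is the growth to be
    contradicted.\<close>
  then have "\<exists>\<phi> \<psi> A B. smooth_fn \<phi> \<and> (\<forall>t. t \<notin> K \<longrightarrow> \<phi> t = 0) \<and> schwartz \<psi> \<and>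
    (\<forall>t. pbound m \<phi> t A) \<and> sbound m \<psi> B \<and> \<not> norm (u \<phi> \<psi>) \<le> (real m * 2 ^ m) * A * B" for m
    by (metis mult_nonneg_nonneg of_nat_0_le_iff zero_le_numeral zero_le_power)
  then obtain \<phi> \<psi> A B where *: "\<And>m. smooth_fn (\<phi> m)" "\<And>m t. t \<notin> K \<Longrightarrow> \<phi> m t = 0" "\<And>m. schwartz (\<psi> m)"
    "\<And>m t. pbound m (\<phi> m) t (A m)" "\<And>m. sbound m (\<psi> m) (B m)"
    "\<And>m. norm (u (\<phi> m) (\<psi> m)) > (real m * 2 ^ m) * A m * B m"
    unfolding not_le by metis
  have test: "test_fn (\<phi> m)" for m
  proof -
    have "{t. \<phi> m t \<noteq> 0} \<subseteq> K" using *(2) by auto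
    then show ?thesis
      using *(1) bounded_subset[OF compact_imp_bounded[OF K]] by (auto simp: test_fn_iff)
  qed
  have A: "0 < A m" for m
  proof (rule ccontr)
    assume "\<not> 0 < A m"
    then have "A m = 0" using pbound_nonneg[OF *(4)[of m 0]] by simp
    then have "\<phi> m = (\<lambda>t. 0)" using pbound_norm[OF *(4)[of m]] by auto
    then show False using *(6)[of m] distribution_zero[OF d[OF *(3)]] \<open>A m = 0\<close> by simp
  qed
  have B: "0 < B m" for m
  proof (rule ccontr)
    assume "\<not> 0 < B m"
    then have "B m = 0" using sbound_nonneg[OF *(5)[of m]] by simp
    then have "\<psi> m = (\<lambda>t. 0)"
      using pbound_norm[of m "\<psi> m" _ 0] *(5)[of m] by (auto simp: sbound_def)
    then show False using *(6)[of m] tempered_zero[OF t[OF test]] \<open>B m = 0\<close> by simp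
  qed
  define \<phi>' where "\<phi>' m = (\<lambda>t. of_real ((1/2) ^ m / A m) * \<phi> m t)" for m
  define \<psi>' where "\<psi>' m = (\<lambda>t. of_real (1 / B m) * \<psi> m t)" for m
  have \<psi>': "schwartz (\<psi>' m)" "sbound m (\<psi>' m) 1" for m
    using schwartz_cmult[OF *(3)[of m], of "of_real (1 / B m)"]
      sbound_cmult[OF schwartz_smooth[OF *(3)] *(5), of m "of_real (1 / B m)"] B[of m]
    by (auto simp: \<psi>'_def norm_divide)
  have "\<exists>m. norm (u (\<phi>' m) (\<psi>' m)) < real m"
  proof (rule gliding_hump[where b = "\<lambda>m \<phi>. u \<phi> (\<psi>' m)" and \<phi> = \<phi>', OF _ K])
    show "distribution (\<lambda>\<phi>. u \<phi> (\<psi>' m))" for m by (rule d[OF \<psi>'(1)])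
    show "smooth_fn (\<phi>' m)" for m unfolding \<phi>'_def by (intro smooth_intros *)
    show "\<phi>' m t = 0" if "t \<notin> K" for m t using *(2)[OF that] by (simp add: \<phi>'_def)
    show "pbound m (\<phi>' m) t ((1/2) ^ m)" for m t
      using pbound_cmult[OF *(1,4), of m "of_real ((1/2) ^ m / A m)" t] A[of m]
      by (simp add: \<phi>'_def norm_divide norm_mult norm_power)
    show "\<exists>R. \<forall>n. norm (u \<Phi> (\<psi>' n)) \<le> R" if "test_fn \<Phi>" for \<Phi>
      by (rule sbound_tendsto_bounded[OF t[OF that] \<psi>'])
  qed
  then obtain m where m: "norm (u (\<phi>' m) (\<psi>' m)) < real m" by blast
  have "u (\<phi>' m) (\<psi>' m) = of_real ((1/2) ^ m / A m) * (of_real (1 / B m) * u (\<phi> m) (\<psi> m))"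
    using distribution_cmult[OF d[OF \<psi>'(1)[of m]] test[of m], of "of_real ((1/2) ^ m / A m)"]
      tempered_cmult[OF t[OF test[of m]] *(3)[of m], of "of_real (1 / B m)"]
    by (simp add: \<phi>'_def \<psi>'_def)
  then have "norm (u (\<phi>' m) (\<psi>' m)) = norm (u (\<phi> m) (\<psi> m)) / (2 ^ m * A m * B m)"
    using A[of m] B[of m] by (simp add: norm_mult norm_divide norm_power power_divide)
  then have "norm (u (\<phi> m) (\<psi> m)) < real m * (2 ^ m * A m * B m)"
    using m A[of m] B[of m] by (simp add: pos_divide_less_eq)
  then show False using *(6)[of m] by (simp add: mult_ac)
qed

section \<open>Integrals of compactly supported functions\<close>

lemma compact_support_has_integral:
  fixes f :: "'a::euclidean_space \<Rightarrow> complex"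
  assumes "continuous_on UNIV f" "\<And>x. x \<notin> cbox a b \<Longrightarrow> f x = 0"
  shows "(f has_integral integral (cbox a b) f) UNIV"
proof -
  have "(f has_integral integral (cbox a b) f) (cbox a b)"
    using assms(1) continuous_on_subset by (intro integrable_integral integrable_continuous) blast
  then show ?thesis by (rule has_integral_on_superset) (use assms in auto)
qed

lemma compact_support_integral:
  fixes f :: "'a::euclidean_space \<Rightarrow> complex"
  assumes "continuous_on UNIV f" "\<And>x. x \<notin> cbox a b \<Longrightarrow> f x = 0"
  shows "integral UNIV f = integral (cbox a b) f" "f integrable_on UNIV"
  using compact_support_has_integral[OF assms] by (auto simp: has_integral_iff)

lemma bounded_supportE:
  fixes f :: "'a::euclidean_space \<Rightarrow> complex"
  assumes "bounded {x. f x \<noteq> 0}"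
  obtains a where "\<And>x. x \<notin> cbox (-a) a \<Longrightarrow> f x = 0"
  using bounded_subset_cbox_symmetric[OF assms] by (metis (mono_tags) mem_Collect_eq subsetD)

lemma test_fn_integrable: "test_fn f \<Longrightarrow> f integrable_on UNIV"
  by (metis bounded_supportE compact_support_integral(2) smooth_fn_continuous test_fn_iff)

lemma integral_affine:
  fixes f :: "'a::euclidean_space \<Rightarrow> complex"
  assumes "continuous_on UNIV f" "bounded {x. f x \<noteq> 0}" "m \<noteq> 0"
  shows "integral UNIV (\<lambda>x. f (m *\<^sub>R x + c)) = integral UNIV f / of_real (\<bar>m\<bar> ^ DIM('a))"
proof -
  obtain a where a: "\<And>x. x \<notin> cbox (-a) a \<Longrightarrow> f x = 0" using bounded_supportE[OF assms(2)] by metis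
  let ?h = "\<lambda>x. (1 / m) *\<^sub>R x + -((1 / m) *\<^sub>R c)"
  have "(f has_integral integral UNIV f) (cbox (-a) a)"
    using assms(1) continuous_on_subset
    by (subst compact_support_integral(1)[OF assms(1) a]) (auto intro!: integrable_integral integrable_continuous)
  from has_integral_affinity[OF this assms(3), of c]
  have "((\<lambda>x. f (m *\<^sub>R x + c)) has_integral (1 / (\<bar>m\<bar> ^ DIM('a))) *\<^sub>R integral UNIV f) (?h ` cbox (-a) a)" .
  then have "((\<lambda>x. f (m *\<^sub>R x + c)) has_integral (1 / (\<bar>m\<bar> ^ DIM('a))) *\<^sub>R integral UNIV f) UNIV"
  proof (rule has_integral_on_superset)
    fix x assume x: "x \<notin> ?h ` cbox (-a) a"
    have "?h (m *\<^sub>R x + c) = x" using assms(3) by (simp add: algebra_simps)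
    then have "m *\<^sub>R x + c \<notin> cbox (-a) a" using x by (metis imageI)
    then show "f (m *\<^sub>R x + c) = 0" by (rule a)
  qed simp
  then show ?thesis by (simp add: integral_unique scaleR_conv_of_real divide_inverse mult.commute)
qed

text \<open>Differentiation under the integral sign takes place over a fixed compact box. The
  derivative only concerns small shifts along \<open>b\<close>, so one box for all
  \<open>\<bar>s\<bar> \<le> 1\<close> suffices, also when the support moves with the
  parameter.\<close>

lemma has_pdir_integral:
  fixes H :: "'a::euclidean_space \<Rightarrow> 'b::euclidean_space \<Rightarrow> complex"
  assumes der: "\<And>x \<xi>. has_pdir b (\<lambda>x. H x \<xi>) x (H' x \<xi>)"
    and cont: "\<And>x. continuous_on UNIV (H x)" and cont': "continuous_on UNIV (\<lambda>(x, \<xi>). H' x \<xi>)"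
    and supp: "\<And>s \<xi>. \<bar>s\<bar> \<le> 1 \<Longrightarrow> \<xi> \<notin> cbox c d \<Longrightarrow> H (x + s *\<^sub>R b) \<xi> = 0 \<and> H' (x + s *\<^sub>R b) \<xi> = 0"
  shows "has_pdir b (\<lambda>x. integral UNIV (H x)) x (integral UNIV (H' x))"
proof -
  let ?U = "{-1..1::real}"
  have cont_H': "continuous_on UNIV (H' y)" for y
  proof -
    have "continuous_on UNIV (\<lambda>\<xi>. (\<lambda>(x, \<xi>). H' x \<xi>) (y, \<xi>))"
      by (rule continuous_on_compose2[OF cont']) (auto intro!: continuous_intros)
    then show ?thesis by simp
  qed
  have "((\<lambda>s. integral (cbox c d) (H (x + s *\<^sub>R b))) has_vector_derivative integral (cbox c d) (H' (x + 0 *\<^sub>R b))) (at 0 within ?U)"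
  proof (rule leibniz_rule_vector_derivative[where f = "\<lambda>s. H (x + s *\<^sub>R b)" and fx = "\<lambda>s. H' (x + s *\<^sub>R b)"])
    show "((\<lambda>s. H (x + s *\<^sub>R b) \<xi>) has_vector_derivative H' (x + s *\<^sub>R b) \<xi>) (at s within ?U)" for s \<xi>
      by (rule has_vector_derivative_at_within, rule has_pdir_line[where f' = "\<lambda>x. H' x \<xi>"], rule der)
    show "H (x + s *\<^sub>R b) integrable_on cbox c d" for s
      using cont continuous_on_subset by (intro integrable_continuous) blast
    have "continuous_on (?U \<times> cbox c d) (\<lambda>p. (\<lambda>(x, \<xi>). H' x \<xi>) (x + fst p *\<^sub>R b, snd p))"
      by (rule continuous_on_compose2[OF cont']) (auto intro!: continuous_intros)
    then show "continuous_on (?U \<times> cbox c d) (\<lambda>(s, \<xi>). H' (x + s *\<^sub>R b) \<xi>)"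
      by (simp add: case_prod_beta)
  qed auto
  then have "((\<lambda>s. integral (cbox c d) (H (x + s *\<^sub>R b))) has_vector_derivative integral (cbox c d) (H' x)) (at 0 within {-1<..<1})"
    by (auto intro: has_vector_derivative_within_subset)
  then have *: "((\<lambda>s. integral (cbox c d) (H (x + s *\<^sub>R b))) has_vector_derivative integral (cbox c d) (H' x)) (at 0)"
    by (subst (asm) at_within_open) auto
  have "integral UNIV (H' x) = integral (cbox c d) (H' x)"
    using supp[of 0] by (intro compact_support_integral cont_H') auto
  moreover have "((\<lambda>s. integral UNIV (H (x + s *\<^sub>R b))) has_vector_derivative integral (cbox c d) (H' x)) (at 0)"
  proof (rule has_vector_derivative_transform_within_open[OF *])
    show "integral (cbox c d) (H (x + s *\<^sub>R b)) = integral UNIV (H (x + s *\<^sub>R b))" if "s \<in> {-1<..<1}" for s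
      using supp[of s] that by (intro compact_support_integral(1)[symmetric] cont) auto
  qed auto
  ultimately show ?thesis by simp
qed

lemma continuous_on_integral_param:
  fixes H :: "'a::euclidean_space \<Rightarrow> 'b::euclidean_space \<Rightarrow> complex"
  assumes cont: "continuous_on UNIV (\<lambda>(x, \<xi>). H x \<xi>)" and supp: "\<And>x \<xi>. \<xi> \<notin> cbox c d \<Longrightarrow> H x \<xi> = 0"
  shows "continuous_on UNIV (\<lambda>x. integral UNIV (H x))"
proof -
  have "continuous_on UNIV (H y)" for y
  proof -
    have "continuous_on UNIV (\<lambda>\<xi>. (\<lambda>(x, \<xi>). H x \<xi>) (y, \<xi>))"
      by (rule continuous_on_compose2[OF cont]) (auto intro!: continuous_intros)
    then show ?thesis by simp
  qed
  then have "integral UNIV (H x) = integral (cbox c d) (H x)" for x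
    using supp by (intro compact_support_integral)
  moreover have "continuous_on UNIV (\<lambda>x. integral (cbox c d) (H x))"
    by (rule integral_continuous_on_param) (rule continuous_on_subset[OF cont], simp)
  ultimately show ?thesis by simp
qed

text \<open>The integral of a translate of \<open>h\<close> is independent of the translation, so
  its derivative vanishes; differentiated under the integral sign it becomes the integral of
  \<open>pdir b h\<close>.\<close>

lemma integral_pdir_zero:
  fixes h :: "'a::euclidean_space \<Rightarrow> complex"
  assumes "test_fn h" "b \<in> Basis"
  shows "integral UNIV (pdir b h) = 0"
proof -
  have sm: "smooth_fn h" "smooth_fn (pdir b h)" using assms by (auto intro: test_fn_smooth smooth_fn_pdir)
  have bd: "bounded {x. h x \<noteq> 0}" "bounded {x. pdir b h x \<noteq> 0}"
    using test_fn_bounded[OF assms(1)] test_fn_bounded[OF test_fn_dlist[OF assms(1), of "[b]"]] assms(2) by auto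
  then obtain r where r: "\<And>x. h x \<noteq> 0 \<Longrightarrow> norm x \<le> r" "\<And>x. pdir b h x \<noteq> 0 \<Longrightarrow> norm x \<le> r"
    using bounded_Un[of "{x. h x \<noteq> 0}" "{x. pdir b h x \<noteq> 0}"] by (auto simp: bounded_iff)
  \<comment> \<open>The additional 1 in the radius absorbs the shifts by
    \<open>s *\<^sub>R b\<close> with \<open>\<bar>s\<bar> \<le> 1\<close>.\<close>
  obtain a :: 'a where a: "cball 0 (r + 1) \<subseteq> cbox (-a) a"
    using bounded_subset_cbox_symmetric[OF bounded_cball] by metis
  have "has_pdir b (\<lambda>x. integral UNIV (\<lambda>\<xi>. h (\<xi> + x))) 0 (integral UNIV (\<lambda>\<xi>. pdir b h (\<xi> + 0)))"
  proof (rule has_pdir_integral[where H = "\<lambda>x \<xi>. h (\<xi> + x)" and H' = "\<lambda>x \<xi>. pdir b h (\<xi> + x)" and c = "-a" and d = a])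
    show "has_pdir b (\<lambda>x. h (\<xi> + x)) x (pdir b h (\<xi> + x))" for x \<xi>
      using smooth_fn_has_pdir[OF sm(1) assms(2), of "\<xi> + x"] by (simp add: add.assoc)
    show "continuous_on UNIV (\<lambda>\<xi>. h (\<xi> + x))" for x
      by (rule continuous_on_compose2[OF smooth_fn_continuous[OF sm(1)]]) (auto intro!: continuous_intros)
    show "continuous_on UNIV (\<lambda>(x, \<xi>). pdir b h (\<xi> + x))"
      unfolding case_prod_beta
      by (rule continuous_on_compose2[OF smooth_fn_continuous[OF sm(2)]]) (auto intro!: continuous_intros)
    fix s :: real and \<xi> assume s: "\<bar>s\<bar> \<le> 1" and "\<xi> \<notin> cbox (-a) a"
    then have "\<xi> \<notin> cball 0 (r + 1)" using a by blast
    then have "r + 1 < norm \<xi>" by simp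
    moreover have "norm (s *\<^sub>R b) \<le> 1" using s assms(2) by simp
    moreover have "norm \<xi> \<le> norm (\<xi> + s *\<^sub>R b) + norm (s *\<^sub>R b)"
      using norm_triangle_ineq4[of "\<xi> + s *\<^sub>R b" "s *\<^sub>R b"] by simp
    ultimately have "r < norm (\<xi> + s *\<^sub>R b)" by linarith
    then show "h (\<xi> + (0 + s *\<^sub>R b)) = 0 \<and> pdir b h (\<xi> + (0 + s *\<^sub>R b)) = 0"
      using r[of "\<xi> + s *\<^sub>R b"] by (auto simp: not_le[symmetric])
  qed
  moreover have "integral UNIV (\<lambda>\<xi>. h (\<xi> + x)) = integral UNIV h" for x
    using integral_affine[OF smooth_fn_continuous[OF sm(1)] bd(1), of 1 x] by simp
  ultimately have "((\<lambda>s::real. integral UNIV h) has_vector_derivative integral UNIV (pdir b h)) (at 0)"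
    by simp
  then show ?thesis using vector_derivative_unique_at[OF _ has_vector_derivative_const] by blast
qed

section \<open>The Fourier integral and its exchange of derivatives and coordinates\<close>

text \<open>No normalising constant. The argument \<open>g\<close> lives in frequency and the result
  in space: a derivative in \<open>x\<close> multiplies \<open>g\<close> by
  \<open>- \<i> * of_real (\<xi> \<bullet> b)\<close>, so a tempered distribution applied to
  \<open>fourier g\<close> is its transform applied to \<open>g\<close>.\<close>

definition fourier :: "('a::euclidean_space \<Rightarrow> complex) \<Rightarrow> 'a \<Rightarrow> complex" where
  "fourier g x = integral UNIV (\<lambda>\<xi>. g \<xi> * exp (- \<i> * of_real (x \<bullet> \<xi>)))"

lemma smooth_character: "smooth_fn (\<lambda>\<xi>::'a::euclidean_space. exp (- \<i> * complex_of_real (x \<bullet> \<xi>)))"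
  by (rule smooth_exp_linear) (rule bounded_linear_inner_right)

lemma has_pdir_character:
  fixes x :: "'a::euclidean_space"
  shows "has_pdir b (\<lambda>\<xi>. exp (- \<i> * complex_of_real (x \<bullet> \<xi>))) \<xi> (- \<i> * of_real (x \<bullet> b) * exp (- \<i> * of_real (x \<bullet> \<xi>)))"
proof -
  have "((\<lambda>z. exp (- \<i> * z)) has_field_derivative exp (- \<i> * of_real (x \<bullet> \<xi>)) * (- \<i>)) (at (of_real (x \<bullet> \<xi> + (x \<bullet> b) * 0)))"
    by (auto intro!: derivative_eq_intros)
  from has_vector_derivative_real_field[OF this]
  have "((\<lambda>t. exp (- \<i> * complex_of_real t)) has_vector_derivative exp (- \<i> * of_real (x \<bullet> \<xi>)) * (- \<i>)) (at (x \<bullet> \<xi> + (x \<bullet> b) * 0))" .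
  from has_vector_derivative_affine[OF this]
  show ?thesis by (simp add: inner_add_right scaleR_conv_of_real mult_ac)
qed

lemma has_pdir_fourier:
  fixes g :: "'a::euclidean_space \<Rightarrow> complex"
  assumes g: "test_fn g"
  shows "has_pdir b (fourier g) x (fourier (\<lambda>\<xi>. - \<i> * of_real (\<xi> \<bullet> b) * g \<xi>) x)"
proof -
  obtain a where a: "\<And>x. x \<notin> cbox (-a) a \<Longrightarrow> g x = 0" using bounded_supportE[OF test_fn_bounded[OF g]] by metis
  have cont: "continuous_on S g" for S
    using smooth_fn_continuous[OF test_fn_smooth[OF g]] continuous_on_subset by blast
  show ?thesis
    unfolding fourier_def[abs_def]
  proof (rule has_pdir_integral[where c = "-a" and d = a])
    show "has_pdir b (\<lambda>x. g \<xi> * exp (- \<i> * of_real (x \<bullet> \<xi>))) x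
        (- \<i> * of_real (\<xi> \<bullet> b) * g \<xi> * exp (- \<i> * of_real (x \<bullet> \<xi>)))" for x \<xi>
      using has_vector_derivative_mult_right[OF has_pdir_character[of \<xi> x b], of "g \<xi>"]
      by (simp add: inner_commute mult_ac)
    show "continuous_on UNIV (\<lambda>\<xi>. g \<xi> * exp (- \<i> * of_real (x \<bullet> \<xi>)))" for x
      by (intro continuous_intros cont)
    show "continuous_on UNIV (\<lambda>(x, \<xi>). - \<i> * of_real (\<xi> \<bullet> b) * g \<xi> * exp (- \<i> * of_real (x \<bullet> \<xi>)))"
      unfolding case_prod_beta
      by (intro continuous_intros continuous_on_compose2[OF cont[of UNIV]]) auto
  qed (use a in auto)
qed

lemma test_fn_coord_mult: "test_fn g \<Longrightarrow> test_fn (\<lambda>\<xi>::'a::euclidean_space. c * of_real (\<xi> \<bullet> b) * g \<xi>)"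
  by (intro test_fn_mult_left smooth_intros smooth_linear bounded_linear_inner_left)

lemma smooth_fourier:
  fixes g :: "'a::euclidean_space \<Rightarrow> complex"
  assumes g: "test_fn g"
  shows "smooth_fn (fourier g)"
proof (rule smooth_fn_coinduct[where P = "\<lambda>f. \<exists>g. test_fn g \<and> f = fourier g"])
  show "\<exists>h. test_fn h \<and> fourier g = fourier h" using g by blast
next
  fix f :: "'a \<Rightarrow> complex" assume "\<exists>g. test_fn g \<and> f = fourier g"
  then obtain g where g: "test_fn g" "f = fourier g" by blast
  obtain a where a: "\<And>x. x \<notin> cbox (-a) a \<Longrightarrow> g x = 0" using bounded_supportE[OF test_fn_bounded[OF g(1)]] by metis
  show "continuous_on UNIV f"
    unfolding g(2) fourier_def[abs_def]
  proof (rule continuous_on_integral_param[where c = "-a" and d = a])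
    show "continuous_on UNIV (\<lambda>(x, \<xi>). g \<xi> * exp (- \<i> * of_real (x \<bullet> \<xi>)))"
      unfolding case_prod_beta
      by (intro continuous_intros continuous_on_compose2[OF smooth_fn_continuous[OF test_fn_smooth[OF g(1)]]]) auto
  qed (use a in auto)
next
  fix f :: "'a \<Rightarrow> complex" and b :: 'a assume "\<exists>g. test_fn g \<and> f = fourier g"
  then show "\<exists>f'. (\<exists>g. test_fn g \<and> f' = fourier g) \<and> (\<forall>x. has_pdir b f x (f' x))"
    using has_pdir_fourier test_fn_coord_mult by blast
qed

lemma pdir_fourier: "test_fn g \<Longrightarrow> pdir b (fourier g) = fourier (\<lambda>\<xi>. - \<i> * of_real (\<xi> \<bullet> b) * g \<xi>)"
  by (rule ext, rule has_pdir_imp, rule has_pdir_fourier)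

lemma dlist_fourier:
  fixes g :: "'a::euclidean_space \<Rightarrow> complex"
  assumes "test_fn g"
  shows "dlist bs (fourier g) = fourier (\<lambda>\<xi>. (\<Prod>b\<leftarrow>bs. - \<i> * of_real (\<xi> \<bullet> b)) * g \<xi>) \<and>
    test_fn (\<lambda>\<xi>. (\<Prod>b\<leftarrow>bs. - \<i> * of_real (\<xi> \<bullet> b)) * g \<xi>)"
proof (induction bs)
  case (Cons b bs)
  then show ?case
    using pdir_fourier[of "\<lambda>\<xi>. (\<Prod>b\<leftarrow>bs. - \<i> * of_real (\<xi> \<bullet> b)) * g \<xi>" b]
      test_fn_coord_mult[of "\<lambda>\<xi>. (\<Prod>b\<leftarrow>bs. - \<i> * of_real (\<xi> \<bullet> b)) * g \<xi>" "- \<i>" b]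
    by (simp add: mult.assoc)
qed (use assms in simp)

lemma fourier_cmult: "fourier (\<lambda>\<xi>. c * g \<xi>) x = c * fourier g x"
  unfolding fourier_def mult.assoc by simp

lemma test_fn_character: "test_fn g \<Longrightarrow> test_fn (\<lambda>\<xi>. g \<xi> * exp (- \<i> * of_real (x \<bullet> \<xi>)))"
  by (rule test_fn_mult_right[OF _ smooth_character])

lemma fourier_add:
  assumes "test_fn g" "test_fn h"
  shows "fourier (\<lambda>\<xi>. g \<xi> + h \<xi>) x = fourier g x + fourier h x"
  unfolding fourier_def distrib_right
  by (intro Henstock_Kurzweil_Integration.integral_add test_fn_integrable test_fn_character assms)

text \<open>Integration by parts: \<open>integral_pdir_zero\<close> applied to \<open>g\<close>
  times the character.\<close>

lemma coord_mult_fourier: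
  fixes g :: "'a::euclidean_space \<Rightarrow> complex"
  assumes g: "test_fn g" and b: "b \<in> Basis"
  shows "of_real (x \<bullet> b) * fourier g x = - \<i> * fourier (pdir b g) x"
proof -
  have sm: "smooth_fn g" using g by (rule test_fn_smooth)
  have "pdir b (\<lambda>\<xi>. exp (- \<i> * complex_of_real (x \<bullet> \<xi>))) =
    (\<lambda>\<xi>. - \<i> * of_real (x \<bullet> b) * exp (- \<i> * of_real (x \<bullet> \<xi>)))"
    by (rule ext, rule has_pdir_imp, rule has_pdir_character)
  then have "pdir b (\<lambda>\<xi>. g \<xi> * exp (- \<i> * complex_of_real (x \<bullet> \<xi>))) =
    (\<lambda>\<xi>. pdir b g \<xi> * exp (- \<i> * of_real (x \<bullet> \<xi>)) + (- \<i> * of_real (x \<bullet> b)) * (g \<xi> * exp (- \<i> * of_real (x \<bullet> \<xi>))))"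
    using pdir_mult[OF sm smooth_character b, of x] by (simp add: algebra_simps)
  moreover have "integral UNIV (pdir b (\<lambda>\<xi>. g \<xi> * exp (- \<i> * complex_of_real (x \<bullet> \<xi>)))) = 0"
    by (rule integral_pdir_zero[OF test_fn_character[OF g] b])
  moreover have "test_fn (pdir b g)" using test_fn_dlist[OF g, of "[b]"] b by simp
  ultimately have "fourier (pdir b g) x + (- \<i> * of_real (x \<bullet> b)) * fourier g x = 0"
    using Henstock_Kurzweil_Integration.integral_add[OF test_fn_integrable[OF test_fn_character, of "pdir b g" x]
        test_fn_integrable[OF test_fn_cmult[OF test_fn_character[OF g]], of "- \<i> * of_real (x \<bullet> b)" x]]
    unfolding fourier_def by simp
  then have "\<i> * (fourier (pdir b g) x + (- \<i> * of_real (x \<bullet> b)) * fourier g x) = 0" by simp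
  then show ?thesis by (simp add: distrib_left eq_neg_iff_add_eq_0 add.commute flip: mult.assoc)
qed

subsection \<open>Density of Fourier transforms of test functions\<close>

lemma test_fn_pdir: "test_fn g \<Longrightarrow> b \<in> Basis \<Longrightarrow> test_fn (pdir b g)"
  using test_fn_dlist[of g "[b]"] by simp

lemma coord_power_fourier:
  fixes g :: "'a::euclidean_space \<Rightarrow> complex"
  assumes "test_fn g" "b \<in> Basis"
  shows "of_real (x \<bullet> b) ^ k * fourier g x = (- \<i>) ^ k * fourier (dlist (replicate k b) g) x"
  using assms(1)
proof (induction k arbitrary: g)
  case (Suc k)
  have "of_real (x \<bullet> b) ^ Suc k * fourier g x = of_real (x \<bullet> b) ^ k * (of_real (x \<bullet> b) * fourier g x)"
    by (simp add: mult_ac)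
  also have "\<dots> = - \<i> * (of_real (x \<bullet> b) ^ k * fourier (pdir b g) x)"
    unfolding coord_mult_fourier[OF Suc.prems assms(2)] by simp
  also have "\<dots> = - \<i> * ((- \<i>) ^ k * fourier (dlist (replicate k b) (pdir b g)) x)"
    by (simp only: Suc.IH[OF test_fn_pdir[OF Suc.prems assms(2)]])
  finally show ?case unfolding dlist_replicate_pdir by simp
qed simp

lemma fourier_norm_le:
  fixes g :: "'a::euclidean_space \<Rightarrow> complex"
  assumes "smooth_fn g" "\<And>\<xi>. \<xi> \<notin> cbox a b \<Longrightarrow> g \<xi> = 0" "\<And>\<xi>. norm (g \<xi>) \<le> B"
  shows "norm (fourier g x) \<le> B * measure lborel (cbox a b)"
proof -
  let ?f = "\<lambda>\<xi>. g \<xi> * exp (- \<i> * of_real (x \<bullet> \<xi>))"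
  have cont: "continuous_on UNIV ?f"
    by (intro continuous_intros smooth_fn_continuous[OF assms(1)])
  have "norm (integral (cbox a b) ?f) \<le> B * measure lborel (cbox a b)"
  proof (rule has_integral_bound)
    show "0 \<le> B" using assms(3)[of 0] norm_ge_zero order_trans by blast
    show "(?f has_integral integral (cbox a b) ?f) (cbox a b)"
      by (intro integrable_integral integrable_continuous continuous_on_subset[OF cont]) simp
    show "norm (?f \<xi>) \<le> B" for \<xi> using assms(3)[of \<xi>] by (simp add: norm_mult norm_exp_eq_Re)
  qed
  then show ?thesis
    unfolding fourier_def using compact_support_integral(1)[OF cont, of a b] assms(2) by simp
qed

text \<open>The largest coordinate dominates \<open>norm x\<close> up to a dimensional factor. Pure
  powers of single coordinates appear because \<open>coord_power_fourier\<close> turns each of them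
  into derivatives in one direction.\<close>

lemma weight_le:
  fixes x :: "'a::euclidean_space"
  shows "(1 + norm x) ^ N \<le> (1 + real DIM('a)) ^ N * (1 + (\<Sum>b\<in>Basis. \<bar>x \<bullet> b\<bar> ^ N))"
proof -
  let ?M = "Max ((\<lambda>b. \<bar>x \<bullet> b\<bar>) ` Basis)"
  have "?M \<in> (\<lambda>b. \<bar>x \<bullet> b\<bar>) ` Basis" by (intro Max_in) auto
  then obtain b0 where b0: "b0 \<in> Basis" "\<bar>x \<bullet> b0\<bar> = ?M" by force
  have b0': "\<bar>x \<bullet> b\<bar> \<le> \<bar>x \<bullet> b0\<bar>" if "b \<in> Basis" for b
    unfolding b0(2) using that by (intro Max_ge) auto
  define m where "m = max 1 \<bar>x \<bullet> b0\<bar>"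
  have "norm x \<le> (\<Sum>b\<in>Basis. \<bar>x \<bullet> b\<bar>)" by (rule norm_le_l1)
  also have "\<dots> \<le> (\<Sum>b\<in>(Basis::'a set). m)" using b0' by (intro sum_mono) (auto simp: m_def le_max_iff_disj)
  finally have "1 + norm x \<le> (1 + real DIM('a)) * m" by (simp add: distrib_right m_def)
  then have "(1 + norm x) ^ N \<le> (1 + real DIM('a)) ^ N * m ^ N"
    unfolding power_mult_distrib[symmetric] by (rule power_mono) simp
  moreover have "m ^ N \<le> 1 + (\<Sum>b\<in>Basis. \<bar>x \<bullet> b\<bar> ^ N)"
  proof (cases "1 \<le> \<bar>x \<bullet> b0\<bar>")
    case True
    then have "m ^ N = \<bar>x \<bullet> b0\<bar> ^ N" by (simp add: m_def)
    also have "\<dots> \<le> (\<Sum>b\<in>Basis. \<bar>x \<bullet> b\<bar> ^ N)" by (rule member_le_sum[OF b0(1)]) auto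
    finally show ?thesis by simp
  qed (auto simp: m_def sum_nonneg)
  ultimately show ?thesis
    by (meson mult_left_mono order_trans add_nonneg_nonneg of_nat_0_le_iff zero_le_one zero_le_power)
qed

lemma smooth_prod_list: "(\<And>b. b \<in> set bs \<Longrightarrow> smooth_fn (f b)) \<Longrightarrow> smooth_fn (\<lambda>x. \<Prod>b\<leftarrow>bs. f b x)"
  by (induction bs) (auto intro: smooth_intros)

lemma box_test_fn:
  assumes "smooth_fn g" "\<And>\<xi>. \<xi> \<notin> cbox a b \<Longrightarrow> g \<xi> = 0"
  shows "test_fn g"
proof -
  have "{\<xi>. g \<xi> \<noteq> 0} \<subseteq> cbox a b" using assms(2) by auto
  then show ?thesis using assms(1) bounded_subset[OF bounded_cbox] by (auto simp: test_fn_iff)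
qed

text \<open>Derivatives in space become the polynomial multipliers \<open>P bs\<close>, the weight
  becomes at most \<open>N\<close> derivatives in frequency, and the box bounds the integral. The
  constant depends only on the box and \<open>N\<close>, and \<open>N\<close> is the same on both
  sides: a continuity estimate in space turns into one of finite order in frequency.\<close>

lemma fourier_sbound:
  fixes a :: "'a::euclidean_space"
  shows "\<exists>C\<ge>0. \<forall>g B. smooth_fn g \<longrightarrow> (\<forall>\<xi>. \<xi> \<notin> cbox a c \<longrightarrow> g \<xi> = 0) \<longrightarrow> (\<forall>\<xi>\<in>cbox a c. pbound N g \<xi> B) \<longrightarrow>
    0 \<le> B \<longrightarrow> sbound N (fourier g) (C * B)"
proof -
  define D where "D = {bs :: 'a list. set bs \<subseteq> Basis \<and> length bs \<le> N}"
  have fin: "finite D" unfolding D_def by (rule finite_Basis_lists)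
  define P where "P bs = (\<lambda>\<xi>. \<Prod>b\<leftarrow>bs. - \<i> * complex_of_real (\<xi> \<bullet> b))" for bs :: "'a list"
  have smP: "smooth_fn (P bs)" for bs
    unfolding P_def by (intro smooth_prod_list smooth_intros smooth_linear bounded_linear_inner_left)
  have "\<exists>M\<ge>0. \<forall>\<xi>\<in>cbox a c. pbound N (P bs) \<xi> M" for bs
    using pbound_compact[OF smP[of bs] compact_cbox[of a c], of N] by metis
  then obtain M where M: "\<And>bs. 0 \<le> M bs" "\<And>bs \<xi>. \<xi> \<in> cbox a c \<Longrightarrow> pbound N (P bs) \<xi> (M bs)" by metis
  define K where "K = (\<Sum>bs\<in>D. M bs)"
  have K: "0 \<le> K" "\<And>bs \<xi>. bs \<in> D \<Longrightarrow> \<xi> \<in> cbox a c \<Longrightarrow> pbound N (P bs) \<xi> K"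
    unfolding K_def using M member_le_sum[OF _ _ fin, of _ M] pbound_mono[OF M(2) order_refl] by (auto simp: sum_nonneg)
  let ?V = "measure lborel (cbox a c)"
  define C where "C = (1 + real DIM('a)) ^ N * ((1 + real DIM('a)) * (2 ^ N * K * ?V))"
  have C0: "0 \<le> C" unfolding C_def using K(1) by (intro mult_nonneg_nonneg zero_le_power add_nonneg_nonneg) auto
  have "sbound N (fourier g) (C * B)"
    if g: "smooth_fn g" "\<forall>\<xi>. \<xi> \<notin> cbox a c \<longrightarrow> g \<xi> = 0" "\<forall>\<xi>\<in>cbox a c. pbound N g \<xi> B" "0 \<le> B" for g B
  proof (rule sboundI)
    fix bs :: "'a list" and x :: 'a assume bs: "set bs \<subseteq> Basis" "length bs \<le> N"
    have tg: "test_fn g" using box_test_fn[OF g(1)] g(2) by blast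
    define h where "h = (\<lambda>\<xi>. P bs \<xi> * g \<xi>)"
    have h: "dlist bs (fourier g) = fourier h" "smooth_fn h" "\<And>\<xi>. \<xi> \<notin> cbox a c \<Longrightarrow> h \<xi> = 0"
      using dlist_fourier[OF tg, of bs] g(2) smooth_mult[OF smP g(1)] by (simp_all add: h_def P_def)
    have th: "test_fn h" by (rule box_test_fn[OF h(2,3)])
    have dh0: "dlist cs h \<xi> = 0" if "\<xi> \<notin> cbox a c" for cs \<xi>
      using dlist_local[of "- cbox a c" h "\<lambda>_. 0" \<xi> cs] h(3) that by (auto simp: closed_cbox)
    have "pbound N h \<xi> (2 ^ N * K * B)" if "\<xi> \<in> cbox a c" for \<xi>
      unfolding h_def using K(2) bs g that by (intro pbound_mult smP) (auto simp: D_def)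
    then have dh: "norm (dlist cs h \<xi>) \<le> 2 ^ N * K * B" if "set cs \<subseteq> Basis" "length cs \<le> N" for cs \<xi>
      using dh0[of \<xi> cs] pboundD[OF _ that] K(1) g(4) by (cases "\<xi> \<in> cbox a c") auto
    let ?W = "2 ^ N * K * B * ?V"
    have 1: "\<bar>x \<bullet> b\<bar> ^ k * norm (fourier h x) \<le> ?W" if "b \<in> Basis" "k \<le> N" for b k
    proof -
      have "\<bar>x \<bullet> b\<bar> ^ k * norm (fourier h x) = norm (of_real (x \<bullet> b) ^ k * fourier h x)"
        by (simp add: norm_mult norm_power)
      also have "\<dots> = norm (fourier (dlist (replicate k b) h) x)"
        unfolding coord_power_fourier[OF th that(1)] by (simp add: norm_mult norm_power)
      also have "\<dots> \<le> ?W"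
        by (rule fourier_norm_le) (use that dh dh0 h(2) in \<open>auto intro!: smooth_fn_dlist simp: set_replicate_conv_if split: if_splits\<close>)
      finally show ?thesis .
    qed
    have "(1 + norm x) ^ N * norm (fourier h x) \<le>
        (1 + real DIM('a)) ^ N * (1 + (\<Sum>b\<in>Basis. \<bar>x \<bullet> b\<bar> ^ N)) * norm (fourier h x)"
      by (intro mult_right_mono weight_le) auto
    also have "\<dots> = (1 + real DIM('a)) ^ N * (norm (fourier h x) + (\<Sum>b\<in>Basis. \<bar>x \<bullet> b\<bar> ^ N * norm (fourier h x)))"
      by (simp add: distrib_right sum_distrib_right)
    also have "\<dots> \<le> (1 + real DIM('a)) ^ N * (?W + (\<Sum>b\<in>(Basis::'a set). ?W))"
      using 1[of _ 0] 1[of _ N] SOME_Basis by (intro mult_left_mono add_mono sum_mono) auto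
    also have "\<dots> = C * B" by (simp add: C_def algebra_simps)
    finally show "(1 + norm x) ^ N * norm (dlist bs (fourier g) x) \<le> C * B" by (simp add: h(1))
  qed
  then show ?thesis using C0 by blast
qed

lemma schwartz_fourier:
  fixes g :: "'a::euclidean_space \<Rightarrow> complex"
  assumes "test_fn g"
  shows "schwartz (fourier g)"
  unfolding schwartz_iff_sbound
proof (intro conjI allI)
  fix N
  obtain a where a: "\<And>x. x \<notin> cbox (-a) a \<Longrightarrow> g x = 0" using bounded_supportE[OF test_fn_bounded[OF assms]] by metis
  obtain B where B: "0 \<le> B" "\<And>x. pbound N g x B" using pbound_test[OF assms] by metis
  obtain C where "\<forall>g B. smooth_fn g \<longrightarrow> (\<forall>\<xi>. \<xi> \<notin> cbox (-a) a \<longrightarrow> g \<xi> = 0) \<longrightarrow> (\<forall>\<xi>\<in>cbox (-a) a. pbound N g \<xi> B) \<longrightarrow>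
    0 \<le> B \<longrightarrow> sbound N (fourier g) (C * B)" using fourier_sbound by blast
  then show "\<exists>B. sbound N (fourier g) B" using a B test_fn_smooth[OF assms] by blast
qed (rule smooth_fourier[OF assms])

lemma test_fn_scale:
  fixes G :: "'a::euclidean_space \<Rightarrow> complex"
  assumes "test_fn G" "\<epsilon> \<noteq> 0"
  shows "test_fn (\<lambda>\<xi>. G (c + \<epsilon> *\<^sub>R \<xi>))"
proof -
  obtain r where r: "\<And>x. G x \<noteq> 0 \<Longrightarrow> norm x \<le> r" using test_fn_bounded[OF assms(1)] by (auto simp: bounded_iff)
  have "norm \<xi> \<le> (r + norm c) / \<bar>\<epsilon>\<bar>" if "G (c + \<epsilon> *\<^sub>R \<xi>) \<noteq> 0" for \<xi>
  proof -
    have "\<bar>\<epsilon>\<bar> * norm \<xi> \<le> r + norm c"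
      using r[OF that] norm_triangle_ineq4[of "c + \<epsilon> *\<^sub>R \<xi>" c] by simp
    then show ?thesis using assms(2) by (simp add: field_simps)
  qed
  then show ?thesis
    using smooth_scale_shift[OF test_fn_smooth[OF assms(1)]] by (auto simp: test_fn_iff bounded_iff)
qed

lemma test_fn_cont: "test_fn f \<Longrightarrow> continuous_on S f"
  using smooth_fn_continuous test_fn_smooth continuous_on_subset by blast

text \<open>The common box support reduces both iterated integrals to boxes, where continuity gives
  the exchange.\<close>

lemma integral_test_swap:
  fixes F :: "'a::euclidean_space \<Rightarrow> 'b::euclidean_space \<Rightarrow> complex"
  assumes cont: "continuous_on UNIV (\<lambda>(x, y). F x y)"
    and supp: "\<And>x y. x \<notin> cbox a b \<or> y \<notin> cbox c d \<Longrightarrow> F x y = 0"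
  shows "integral UNIV (\<lambda>x. integral UNIV (F x)) = integral UNIV (\<lambda>y. integral UNIV (\<lambda>x. F x y))"
proof -
  have c1: "continuous_on UNIV (F x)" for x
  proof -
    have "continuous_on UNIV (\<lambda>y. (\<lambda>(x, y). F x y) (x, y))"
      by (rule continuous_on_compose2[OF cont]) (auto intro!: continuous_intros)
    then show ?thesis by simp
  qed
  have c2: "continuous_on UNIV (\<lambda>x. F x y)" for y
  proof -
    have "continuous_on UNIV (\<lambda>x. (\<lambda>(x, y). F x y) (x, y))"
      by (rule continuous_on_compose2[OF cont]) (auto intro!: continuous_intros)
    then show ?thesis by simp
  qed
  have cont': "continuous_on UNIV (\<lambda>(y, x). F x y)"
  proof -
    have "continuous_on UNIV (\<lambda>p. (\<lambda>(x, y). F x y) (snd p, fst p))"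
      by (rule continuous_on_compose2[OF cont]) (auto intro!: continuous_intros)
    then show ?thesis by (simp add: case_prod_beta)
  qed
  have i1: "integral UNIV (F x) = integral (cbox c d) (F x)" for x
    by (rule compact_support_integral(1)[OF c1]) (use supp in auto)
  have i2: "integral UNIV (\<lambda>x. F x y) = integral (cbox a b) (\<lambda>x. F x y)" for y
    by (rule compact_support_integral(1)[OF c2]) (use supp in auto)
  have "integral UNIV (\<lambda>x. integral UNIV (F x)) = integral (cbox a b) (\<lambda>x. integral UNIV (F x))"
  proof (rule compact_support_integral(1))
    show "continuous_on UNIV (\<lambda>x. integral UNIV (F x))"
      by (rule continuous_on_integral_param[OF cont]) (use supp in auto)
    show "integral UNIV (F x) = 0" if "x \<notin> cbox a b" for x
      using supp that by (subst integral_cong[of _ _ "\<lambda>_. 0"]) auto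
  qed
  moreover have "integral UNIV (\<lambda>y. integral UNIV (\<lambda>x. F x y)) = integral (cbox c d) (\<lambda>y. integral UNIV (\<lambda>x. F x y))"
  proof (rule compact_support_integral(1))
    show "continuous_on UNIV (\<lambda>y. integral UNIV (\<lambda>x. F x y))"
      by (rule continuous_on_integral_param[OF cont']) (use supp in auto)
    show "integral UNIV (\<lambda>x. F x y) = 0" if "y \<notin> cbox c d" for y
      using supp that by (subst integral_cong[of _ _ "\<lambda>_. 0"]) auto
  qed
  moreover have "integral (cbox a b) (\<lambda>x. integral (cbox c d) (F x)) = integral (cbox c d) (\<lambda>y. integral (cbox a b) (\<lambda>x. F x y))"
    by (rule integral_swap_continuous) (rule continuous_on_subset[OF cont], simp)
  ultimately show ?thesis by (simp add: i1 i2)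
qed

lemma fourier_scale:
  fixes G :: "'a::euclidean_space \<Rightarrow> complex"
  assumes "test_fn G" "0 < \<epsilon>"
  shows "fourier (\<lambda>\<xi>. G (\<epsilon> *\<^sub>R \<xi>)) w = fourier G ((1 / \<epsilon>) *\<^sub>R w) / of_real (\<epsilon> ^ DIM('a))"
proof -
  let ?K = "\<lambda>\<eta>. G \<eta> * exp (- \<i> * of_real (((1 / \<epsilon>) *\<^sub>R w) \<bullet> \<eta>))"
  have K: "test_fn ?K" by (rule test_fn_character[OF assms(1)])
  have "integral UNIV (\<lambda>\<xi>. ?K (\<epsilon> *\<^sub>R \<xi> + 0)) = integral UNIV ?K / of_real (\<bar>\<epsilon>\<bar> ^ DIM('a))"
    by (rule integral_affine[OF test_fn_cont[OF K] test_fn_bounded[OF K]]) (use assms in simp)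
  then show ?thesis using assms(2) by (simp add: fourier_def)
qed

text \<open>Transforming twice with the window \<open>G (\<epsilon> *\<^sub>R \<xi>)\<close> in
  between averages \<open>f\<close> around \<open>x\<close> at scale \<open>\<epsilon>\<close> with
  kernel \<open>fourier G\<close>, by Fubini and the substitution
  \<open>y = x - \<epsilon> *\<^sub>R z\<close>. As \<open>\<epsilon>\<close> tends to 0 this takes
  the part of an inversion formula.\<close>

lemma fourier_window:
  fixes G f :: "'a::euclidean_space \<Rightarrow> complex"
  assumes G: "test_fn G" and f: "test_fn f" and \<epsilon>: "0 < \<epsilon>"
  shows "fourier (\<lambda>\<xi>. G (\<epsilon> *\<^sub>R \<xi>) * fourier f (- \<xi>)) x = integral UNIV (\<lambda>z. f (x - \<epsilon> *\<^sub>R z) * fourier G z)"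
proof -
  let ?G = "\<lambda>\<xi>. G (\<epsilon> *\<^sub>R \<xi>)"
  have tG: "test_fn ?G" using test_fn_scale[OF G, of \<epsilon> 0] \<epsilon> by simp
  obtain a where a: "\<And>x. x \<notin> cbox (-a) a \<Longrightarrow> ?G x = 0" using bounded_supportE[OF test_fn_bounded[OF tG]] by metis
  obtain b where b: "\<And>x. x \<notin> cbox (-b) b \<Longrightarrow> f x = 0" using bounded_supportE[OF test_fn_bounded[OF f]] by metis
  define F where "F \<xi> y = f y * (?G \<xi> * exp (- \<i> * of_real ((x - y) \<bullet> \<xi>)))" for \<xi> y
  have "fourier (\<lambda>\<xi>. ?G \<xi> * fourier f (- \<xi>)) x = integral UNIV (\<lambda>\<xi>. integral UNIV (F \<xi>))"
  proof -
    have "?G \<xi> * fourier f (- \<xi>) * exp (- \<i> * of_real (x \<bullet> \<xi>)) = integral UNIV (F \<xi>)" for \<xi>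
    proof -
      have "integral UNIV (\<lambda>y. ?G \<xi> * exp (- \<i> * of_real (x \<bullet> \<xi>)) * (f y * exp (- \<i> * of_real (- \<xi> \<bullet> y))))
        = ?G \<xi> * exp (- \<i> * of_real (x \<bullet> \<xi>)) * fourier f (- \<xi>)"
        by (simp add: fourier_def)
      moreover have "F \<xi> = (\<lambda>y. ?G \<xi> * exp (- \<i> * of_real (x \<bullet> \<xi>)) * (f y * exp (- \<i> * of_real (- \<xi> \<bullet> y))))"
        by (auto simp: F_def inner_diff_left inner_commute algebra_simps exp_add exp_diff exp_minus field_simps)
      ultimately show ?thesis by (simp add: mult_ac)
    qed
    then show ?thesis by (simp add: fourier_def[of "\<lambda>\<xi>. ?G \<xi> * fourier f (- \<xi>)"])
  qed
  also have "\<dots> = integral UNIV (\<lambda>y. integral UNIV (\<lambda>\<xi>. F \<xi> y))"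
  proof (rule integral_test_swap)
    show "continuous_on UNIV (\<lambda>(\<xi>, y). F \<xi> y)"
      unfolding F_def case_prod_beta
      by (intro continuous_intros continuous_on_compose2[OF test_fn_cont[OF f, of UNIV]]
          continuous_on_compose2[OF test_fn_cont[OF G, of UNIV]]) auto
    show "F \<xi> y = 0" if "\<xi> \<notin> cbox (-a) a \<or> y \<notin> cbox (-b) b" for \<xi> y
      using that a b by (auto simp: F_def)
  qed
  also have "\<dots> = integral UNIV (\<lambda>y. f y * fourier ?G (x - y))"
    by (simp add: F_def fourier_def)
  also have "\<dots> = integral UNIV (\<lambda>y. f y * fourier G ((1 / \<epsilon>) *\<^sub>R (x - y))) / of_real (\<epsilon> ^ DIM('a))"
    by (simp add: fourier_scale[OF G \<epsilon>] divide_inverse flip: mult.assoc)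
  also have "integral UNIV (\<lambda>y. f y * fourier G ((1 / \<epsilon>) *\<^sub>R (x - y))) =
      integral UNIV (\<lambda>z. f (x - \<epsilon> *\<^sub>R z) * fourier G z) * of_real (\<epsilon> ^ DIM('a))"
  proof -
    let ?k = "\<lambda>z. f (x - \<epsilon> *\<^sub>R z) * fourier G z"
    have tk: "test_fn ?k"
      using test_fn_mult_right[OF test_fn_scale[OF f, of "- \<epsilon>" x] smooth_fourier[OF G]] \<epsilon> by simp
    have "integral UNIV (\<lambda>y. ?k ((- 1 / \<epsilon>) *\<^sub>R y + (1 / \<epsilon>) *\<^sub>R x)) = integral UNIV ?k / of_real (\<bar>- 1 / \<epsilon>\<bar> ^ DIM('a))"
      by (rule integral_affine[OF test_fn_cont[OF tk] test_fn_bounded[OF tk]]) (use \<epsilon> in simp)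
    moreover have "(\<lambda>y. ?k ((- 1 / \<epsilon>) *\<^sub>R y + (1 / \<epsilon>) *\<^sub>R x)) = (\<lambda>y. f y * fourier G ((1 / \<epsilon>) *\<^sub>R (x - y)))"
      using \<epsilon> by (auto simp: scaleR_add_right scaleR_diff_right)
    ultimately show ?thesis using \<epsilon> by (simp add: power_divide)
  qed
  finally show ?thesis using \<epsilon> by simp
qed

section \<open>Correlations and their transforms\<close>

text \<open>The convolution of \<open>g\<close> with the reflection of \<open>k\<close>. When
  \<open>k\<close> is the conjugate of \<open>g\<close>, its transform is the squared modulus of
  \<open>fourier g\<close>.\<close>

definition correlation :: "('a::euclidean_space \<Rightarrow> complex) \<Rightarrow> ('a \<Rightarrow> complex) \<Rightarrow> 'a \<Rightarrow> complex" where
  "correlation g k \<zeta> = integral UNIV (\<lambda>\<xi>. g \<xi> * k (\<xi> - \<zeta>))"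

lemma smooth_correlation:
  fixes g k :: "'a::euclidean_space \<Rightarrow> complex"
  assumes g: "test_fn g" and "smooth_fn k"
  shows "smooth_fn (correlation g k)"
proof -
  obtain a where a: "\<And>x. x \<notin> cbox (-a) a \<Longrightarrow> g x = 0" using bounded_supportE[OF test_fn_bounded[OF g]] by metis
  show ?thesis
  proof (rule smooth_fn_coinduct[where P = "\<lambda>f. \<exists>k. smooth_fn k \<and> f = correlation g k"])
    show "\<exists>h. smooth_fn h \<and> correlation g k = correlation g h" using assms by blast
  next
    fix f :: "'a \<Rightarrow> complex" assume "\<exists>k. smooth_fn k \<and> f = correlation g k"
    then obtain k where k: "smooth_fn k" "f = correlation g k" by blast
    show "continuous_on UNIV f"
      unfolding k(2) correlation_def[abs_def]
    proof (rule continuous_on_integral_param[where c = "-a" and d = a])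
      show "continuous_on UNIV (\<lambda>(x, \<xi>). g \<xi> * k (\<xi> - x))"
        unfolding case_prod_beta
        by (intro continuous_intros continuous_on_compose2[OF test_fn_cont[OF g, of UNIV]]
          continuous_on_compose2[OF smooth_fn_continuous[OF k(1)]]) auto
    qed (use a in auto)
  next
    fix f :: "'a \<Rightarrow> complex" and b :: 'a assume "\<exists>k. smooth_fn k \<and> f = correlation g k" and b: "b \<in> Basis"
    then obtain k where k: "smooth_fn k" "f = correlation g k" by blast
    define k' where "k' = (\<lambda>x. - pdir b k x)"
    have k': "smooth_fn k'" unfolding k'_def by (intro smooth_intros smooth_fn_pdir k b)
    have "has_pdir b f x (correlation g k' x)" for x
      unfolding k(2) correlation_def[abs_def]
    proof (rule has_pdir_integral[where c = "-a" and d = a])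
      show "has_pdir b (\<lambda>x. g \<xi> * k (\<xi> - x)) x (g \<xi> * k' (\<xi> - x))" for x \<xi>
      proof -
        have "pdir b (\<lambda>x. k (\<xi> - x)) = (\<lambda>x. of_real (-1) * pdir b k (\<xi> - x))"
          by (rule pdir_affine[OF k(1) b]) (simp add: algebra_simps)
        moreover have "smooth_fn (\<lambda>x. k (\<xi> - x))" using smooth_scale_shift[OF k(1), of \<xi> "-1"] by simp
        ultimately have "has_pdir b (\<lambda>x. k (\<xi> - x)) x (k' (\<xi> - x))"
          using smooth_fn_has_pdir[of "\<lambda>x. k (\<xi> - x)" b x] b by (simp add: k'_def)
        then show ?thesis by (rule has_vector_derivative_mult_right)
      qed
      show "continuous_on UNIV (\<lambda>\<xi>. g \<xi> * k (\<xi> - x))" for x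
        by (intro continuous_intros test_fn_cont[OF g] continuous_on_compose2[OF smooth_fn_continuous[OF k(1)]]) auto
      show "continuous_on UNIV (\<lambda>(x, \<xi>). g \<xi> * k' (\<xi> - x))"
        unfolding case_prod_beta
        by (intro continuous_intros continuous_on_compose2[OF test_fn_cont[OF g, of UNIV]]
          continuous_on_compose2[OF smooth_fn_continuous[OF k']]) auto
    qed (use a in auto)
    then show "\<exists>f'. (\<exists>k. smooth_fn k \<and> f' = correlation g k) \<and> (\<forall>x. has_pdir b f x (f' x))"
      using k' by blast
  qed
qed

lemma correlation_support:
  fixes g k :: "'a::euclidean_space \<Rightarrow> complex"
  assumes "test_fn g" "test_fn k"
  shows "bounded {\<zeta>. correlation g k \<zeta> \<noteq> 0}"
proof -
  obtain r where r: "\<And>x. g x \<noteq> 0 \<Longrightarrow> norm x \<le> r" using test_fn_bounded[OF assms(1)] by (auto simp: bounded_iff)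
  obtain s where s: "\<And>x. k x \<noteq> 0 \<Longrightarrow> norm x \<le> s" using test_fn_bounded[OF assms(2)] by (auto simp: bounded_iff)
  have "norm \<zeta> \<le> r + s" if "correlation g k \<zeta> \<noteq> 0" for \<zeta>
  proof -
    obtain \<xi> where "g \<xi> * k (\<xi> - \<zeta>) \<noteq> 0"
    proof (rule ccontr)
      assume "\<not> thesis"
      then have "(\<lambda>\<xi>. g \<xi> * k (\<xi> - \<zeta>)) = (\<lambda>\<xi>. 0)" using that by blast
      then show False using \<open>correlation g k \<zeta> \<noteq> 0\<close> by (simp add: correlation_def)
    qed
    then have "norm \<xi> \<le> r" "norm (\<xi> - \<zeta>) \<le> s" using r s by auto
    then show ?thesis using norm_triangle_ineq4[of \<xi> "\<xi> - \<zeta>"] by simp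
  qed
  then show ?thesis by (auto simp: bounded_iff)
qed

lemma test_fn_correlation: "test_fn g \<Longrightarrow> test_fn k \<Longrightarrow> test_fn (correlation g k)"
  using smooth_correlation correlation_support test_fn_iff by blast

lemma fourier_correlation:
  fixes g k :: "'a::euclidean_space \<Rightarrow> complex"
  assumes g: "test_fn g" and k: "test_fn k"
  shows "fourier (correlation g k) x = fourier g x * fourier k (- x)"
proof -
  define F where "F \<zeta> \<xi> = g \<xi> * (k (\<xi> - \<zeta>) * exp (- \<i> * of_real (x \<bullet> \<zeta>)))" for \<zeta> \<xi>
  obtain a where a: "\<And>x. x \<notin> cbox (-a) a \<Longrightarrow> g x = 0" using bounded_supportE[OF test_fn_bounded[OF g]] by metis
  obtain r where r: "\<And>x. g x \<noteq> 0 \<Longrightarrow> norm x \<le> r" using test_fn_bounded[OF g] by (auto simp: bounded_iff)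
  obtain s where s: "\<And>x. k x \<noteq> 0 \<Longrightarrow> norm x \<le> s" using test_fn_bounded[OF k] by (auto simp: bounded_iff)
  obtain c :: 'a where c: "cball 0 (r + s) \<subseteq> cbox (-c) c" using bounded_subset_cbox_symmetric[OF bounded_cball] by metis
  have inner: "integral UNIV (\<lambda>\<zeta>. F \<zeta> \<xi>) = g \<xi> * exp (- \<i> * of_real (x \<bullet> \<xi>)) * fourier k (- x)" for \<xi>
  proof -
    let ?K = "\<lambda>\<eta>. k \<eta> * exp (- \<i> * of_real (- x \<bullet> \<eta>))"
    have K: "test_fn ?K" by (rule test_fn_character[OF k])
    have "integral UNIV (\<lambda>\<zeta>. ?K ((-1) *\<^sub>R \<zeta> + \<xi>)) = integral UNIV ?K / of_real (\<bar>-1\<bar> ^ DIM('a))"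
      by (rule integral_affine[OF test_fn_cont[OF K] test_fn_bounded[OF K]]) simp
    then have "integral UNIV (\<lambda>\<zeta>. ?K (\<xi> - \<zeta>)) = fourier k (- x)" by (simp add: fourier_def)
    moreover have "(\<lambda>\<zeta>. F \<zeta> \<xi>) = (\<lambda>\<zeta>. g \<xi> * exp (- \<i> * of_real (x \<bullet> \<xi>)) * ?K (\<xi> - \<zeta>))"
      by (auto simp: F_def inner_diff_right algebra_simps exp_diff exp_minus field_simps)
    ultimately show ?thesis by simp
  qed
  have "fourier (correlation g k) x = integral UNIV (\<lambda>\<zeta>. integral UNIV (F \<zeta>))"
  proof -
    have "correlation g k \<zeta> * exp (- \<i> * of_real (x \<bullet> \<zeta>)) = integral UNIV (F \<zeta>)" for \<zeta>
      unfolding F_def correlation_def mult.assoc[symmetric] by simp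
    then show ?thesis by (simp add: fourier_def)
  qed
  also have "\<dots> = integral UNIV (\<lambda>\<xi>. integral UNIV (\<lambda>\<zeta>. F \<zeta> \<xi>))"
  proof (rule integral_test_swap)
    show "continuous_on UNIV (\<lambda>(\<zeta>, \<xi>). F \<zeta> \<xi>)"
      unfolding F_def case_prod_beta
      by (intro continuous_intros continuous_on_compose2[OF test_fn_cont[OF g, of UNIV]]
          continuous_on_compose2[OF test_fn_cont[OF k, of UNIV]]) auto
    show "F \<zeta> \<xi> = 0" if "\<zeta> \<notin> cbox (-c) c \<or> \<xi> \<notin> cbox (-a) a" for \<zeta> \<xi>
    proof (rule ccontr)
      assume *: "F \<zeta> \<xi> \<noteq> 0"
      then have "norm \<xi> \<le> r" "norm (\<xi> - \<zeta>) \<le> s" using r s by (auto simp: F_def)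
      then have "\<zeta> \<in> cball 0 (r + s)" using norm_triangle_ineq4[of \<xi> "\<xi> - \<zeta>"] by simp
      then have "\<zeta> \<in> cbox (-c) c" using c by blast
      then show False using that * a by (auto simp: F_def)
    qed
  qed
  also have "\<dots> = integral UNIV (\<lambda>\<xi>. g \<xi> * exp (- \<i> * of_real (x \<bullet> \<xi>)) * fourier k (- x))"
    by (simp only: inner)
  finally show ?thesis by (simp add: fourier_def[of g])
qed

lemma test_fn_cnj: "test_fn g \<Longrightarrow> test_fn (\<lambda>x. cnj (g x))"
  by (auto simp: test_fn_iff intro: smooth_intros)

lemma fourier_autocorrelation:
  fixes g :: "'a::euclidean_space \<Rightarrow> complex"
  assumes g: "test_fn g"
  shows "fourier (correlation g (\<lambda>x. cnj (g x))) x = of_real ((norm (fourier g x))\<^sup>2)"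
proof -
  have "fourier (\<lambda>x. cnj (g x)) (- x) = cnj (fourier g x)"
    unfolding fourier_def integral_cnj by (simp add: exp_cnj)
  then show ?thesis
    by (simp add: fourier_correlation[OF g test_fn_cnj[OF g]] complex_norm_square del: of_real_power)
qed

section \<open>Integrability of rapidly decreasing functions\<close>

lemma nn_integral_inverse_1_plus_square_finite: "(\<integral>\<^sup>+x. ennreal (1 / (1 + x\<^sup>2)) \<partial>lborel) < \<infinity>"
proof -
  have half: "(\<integral>\<^sup>+x. ennreal (1 / (1 + x\<^sup>2)) * indicator {0..} x \<partial>lborel) = ennreal (pi / 2 - arctan 0)"
  proof (rule nn_integral_FTC_atLeast)
    show "(arctan has_real_derivative 1 / (1 + x\<^sup>2)) (at x)" for x
      using DERIV_arctan[of x] by (simp add: divide_inverse)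
  qed (auto intro: tendsto_arctan_at_top)
  have "(\<integral>\<^sup>+x. ennreal (1 / (1 + x\<^sup>2)) * indicator {..0} x \<partial>lborel) =
      (\<integral>\<^sup>+x. ennreal (1 / (1 + (0 + (-1) * x)\<^sup>2)) * indicator {..0} (0 + (-1) * x) \<partial>lborel)"
    by (subst nn_integral_real_affine[where c = "-1" and t = 0]) auto
  also have "\<dots> = (\<integral>\<^sup>+x. ennreal (1 / (1 + x\<^sup>2)) * indicator {0..} x \<partial>lborel)"
    by (intro nn_integral_cong) (auto simp: indicator_def)
  finally have half': "(\<integral>\<^sup>+x. ennreal (1 / (1 + x\<^sup>2)) * indicator {..0} x \<partial>lborel) = ennreal (pi / 2 - arctan 0)"
    using half by simp
  have "(\<integral>\<^sup>+x. ennreal (1 / (1 + x\<^sup>2)) \<partial>lborel) \<le>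
      (\<integral>\<^sup>+x. ennreal (1 / (1 + x\<^sup>2)) * indicator {0..} x + ennreal (1 / (1 + x\<^sup>2)) * indicator {..0} x \<partial>lborel)"
    by (intro nn_integral_mono) (auto simp: indicator_def)
  also have "\<dots> = ennreal (pi / 2 - arctan 0) + ennreal (pi / 2 - arctan 0)"
    by (subst nn_integral_add) (auto simp: half half')
  also have "\<dots> < \<infinity>" by simp
  finally show ?thesis .
qed

text \<open>The product form reduces the integral to a power of the one-dimensional integral of
  \<open>1 / (1 + x\<^sup>2)\<close>.\<close>

lemma weight_integrable:
  "(\<lambda>x::'a::euclidean_space. \<Prod>b\<in>Basis. 1 / (1 + (x \<bullet> b)\<^sup>2)) integrable_on UNIV"
proof (rule integrable_on_lborel, rule integrableI_bounded)
  have "(\<integral>\<^sup>+x. ennreal (norm (\<Prod>b\<in>Basis. 1 / (1 + (x \<bullet> b)\<^sup>2))) \<partial>(lborel :: 'a measure)) =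
      (\<integral>\<^sup>+x. (\<Prod>b\<in>Basis. ennreal (1 / (1 + (x \<bullet> b)\<^sup>2))) \<partial>(lborel :: 'a measure))"
    by (simp add: prod_ennreal prod_nonneg)
  also have "\<dots> = (\<Prod>b\<in>(Basis::'a set). (\<integral>\<^sup>+x. ennreal (1 / (1 + x\<^sup>2)) \<partial>lborel))"
    by (rule nn_integral_lborel_prod) auto
  also have "\<dots> < \<infinity>"
  proof -
    obtain r where r: "0 \<le> r" "(\<integral>\<^sup>+x. ennreal (1 / (1 + x\<^sup>2)) \<partial>lborel) = ennreal r"
      using nn_integral_inverse_1_plus_square_finite
      by (cases "\<integral>\<^sup>+x. ennreal (1 / (1 + x\<^sup>2)) \<partial>lborel" rule: ennreal_cases) auto
    then show ?thesis by (simp add: ennreal_power)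
  qed
  finally show "(\<integral>\<^sup>+x. ennreal (norm (\<Prod>b\<in>Basis. 1 / (1 + (x \<bullet> b)\<^sup>2))) \<partial>(lborel :: 'a measure)) < \<infinity>" .
qed simp

lemma sbound_integrable:
  fixes f :: "'a::euclidean_space \<Rightarrow> complex"
  assumes f: "schwartz f"
  shows "(\<lambda>x. (1 + norm x) ^ N * norm (f x)) integrable_on UNIV"
proof -
  \<comment> \<open>Each of the \<open>DIM('a)\<close> factors
    \<open>1 + (x \<bullet> b)\<^sup>2\<close> is dominated by two powers of
    \<open>1 + norm x\<close>.\<close>
  let ?M = "N + 2 * DIM('a)"
  obtain B where B: "sbound ?M f B" using f by (auto simp: schwartz_iff_sbound)
  show ?thesis
  proof (rule measurable_bounded_by_integrable_imp_integrable_real)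
    have "continuous_on UNIV (\<lambda>x. (1 + norm x) ^ N * norm (f x))"
      by (intro continuous_intros smooth_fn_continuous schwartz_smooth f)
    then show "(\<lambda>x. (1 + norm x) ^ N * norm (f x)) \<in> borel_measurable (lebesgue_on UNIV)"
      by (rule continuous_imp_measurable_on_sets_lebesgue) simp
    show "(\<lambda>x::'a. B * (\<Prod>b\<in>Basis. 1 / (1 + (x \<bullet> b)\<^sup>2))) integrable_on UNIV"
      by (intro integrable_on_mult_right weight_integrable)
    fix x :: 'a
    have "(\<Prod>b\<in>(Basis::'a set). 1 + (x \<bullet> b)\<^sup>2) \<le> (\<Prod>b\<in>(Basis::'a set). (1 + norm x)\<^sup>2)"
    proof (rule prod_mono, safe)
      fix b :: 'a assume "b \<in> Basis"
      then have "\<bar>x \<bullet> b\<bar> \<le> norm x" by (rule Basis_le_norm)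
      then have "(x \<bullet> b)\<^sup>2 \<le> (norm x)\<^sup>2" by (metis abs_ge_zero power2_abs power_mono)
      then show "1 + (x \<bullet> b)\<^sup>2 \<le> (1 + norm x)\<^sup>2"
        using norm_ge_zero[of x] by (simp add: power2_sum del: norm_ge_zero)
    qed simp
    also have "\<dots> = (1 + norm x) ^ (2 * DIM('a))" by (simp add: power_mult)
    finally have 1: "(\<Prod>b\<in>(Basis::'a set). 1 + (x \<bullet> b)\<^sup>2) \<le> (1 + norm x) ^ (2 * DIM('a))" .
    have 2: "0 < (\<Prod>b\<in>(Basis::'a set). 1 + (x \<bullet> b)\<^sup>2)"
      by (intro prod_pos) (simp add: add_pos_nonneg)
    have "(\<Prod>b\<in>(Basis::'a set). 1 + (x \<bullet> b)\<^sup>2) * ((1 + norm x) ^ N * norm (f x)) \<le>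
        (1 + norm x) ^ (2 * DIM('a)) * ((1 + norm x) ^ N * norm (f x))"
      by (intro mult_right_mono 1) auto
    also have "\<dots> \<le> B" using sboundD[OF B, of "[]" x] by (simp add: power_add mult_ac)
    finally have "(1 + norm x) ^ N * norm (f x) \<le> B / (\<Prod>b\<in>(Basis::'a set). 1 + (x \<bullet> b)\<^sup>2)"
      using 2 by (simp add: pos_le_divide_eq mult.commute)
    then show "\<bar>(1 + norm x) ^ N * norm (f x)\<bar> \<le> B * (\<Prod>b\<in>Basis. 1 / (1 + (x \<bullet> b)\<^sup>2))"
      by (simp add: abs_mult prod_dividef)
  qed simp
qed

section \<open>Approximation by Fourier transforms and by test functions\<close>

lemma pdir_line_bound:
  assumes "smooth_fn f" "b \<in> Basis" "\<And>x. norm (pdir b f x) \<le> B"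
  shows "norm (f (x + t *\<^sub>R b) - f x) \<le> B * \<bar>t\<bar>"
proof -
  have der: "((\<lambda>s. f (x + s *\<^sub>R b)) has_derivative (\<lambda>h. h *\<^sub>R pdir b f (x + s *\<^sub>R b))) (at s within UNIV)" for s
    using has_pdir_line[OF smooth_fn_has_pdir[OF assms(1,2)], of x s] by (simp add: has_vector_derivative_def)
  have "norm (f (x + t *\<^sub>R b) - f (x + 0 *\<^sub>R b)) \<le> B * norm (t - 0)"
  proof (rule differentiable_bound[OF convex_UNIV der])
    show "onorm (\<lambda>h. h *\<^sub>R pdir b f (x + s *\<^sub>R b)) \<le> B" for s
    proof (rule onorm_le)
      fix h
      have "\<bar>h\<bar> * norm (pdir b f (x + s *\<^sub>R b)) \<le> \<bar>h\<bar> * B" by (intro mult_left_mono assms(3)) simp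
      then show "norm (h *\<^sub>R pdir b f (x + s *\<^sub>R b)) \<le> B * norm h" by (simp add: mult.commute)
    qed
  qed auto
  then show ?thesis by simp
qed

text \<open>Smoothness provides partial derivatives only, so \<open>x\<close> is moved to
  \<open>x + v\<close> one coordinate at a time, each move costing
  \<open>B * \<bar>v \<bullet> b\<bar>\<close>.\<close>

lemma test_fn_lipschitz:
  fixes f :: "'a::euclidean_space \<Rightarrow> complex"
  assumes f: "test_fn f"
  obtains M where "0 \<le> M" "\<And>x v. norm (f (x + v) - f x) \<le> M * norm v"
proof -
  obtain B where B: "0 \<le> B" "\<And>x. pbound 1 f x B" using pbound_test[OF f] by metis
  have pd: "norm (pdir b f x) \<le> B" if "b \<in> Basis" for b x
    using pboundD[OF B(2), of "[b]" x] that by simp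
  have "norm (f (x + v) - f x) \<le> (B * real DIM('a)) * norm v" for x v
  proof -
    have "norm (f (x + (\<Sum>b\<in>S. (v \<bullet> b) *\<^sub>R b)) - f x) \<le> (\<Sum>b\<in>S. B * \<bar>v \<bullet> b\<bar>)" if "S \<subseteq> Basis" for S
      using finite_subset[OF that finite_Basis] that
    proof (induction S rule: finite_induct)
      case (insert b S)
      let ?y = "x + (\<Sum>b\<in>S. (v \<bullet> b) *\<^sub>R b)"
      have "norm (f (?y + (v \<bullet> b) *\<^sub>R b) - f ?y) \<le> B * \<bar>v \<bullet> b\<bar>"
        using insert by (intro pdir_line_bound test_fn_smooth f pd) auto
      then have "norm (f (?y + (v \<bullet> b) *\<^sub>R b) - f x) \<le> B * \<bar>v \<bullet> b\<bar> + (\<Sum>b\<in>S. B * \<bar>v \<bullet> b\<bar>)"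
        using insert norm_triangle_ineq[of "f (?y + (v \<bullet> b) *\<^sub>R b) - f ?y" "f ?y - f x"] by simp
      moreover have "x + (\<Sum>b\<in>insert b S. (v \<bullet> b) *\<^sub>R b) = ?y + (v \<bullet> b) *\<^sub>R b"
        using insert by (simp add: algebra_simps)
      ultimately show ?case by (simp only: sum.insert[OF insert(1,2)])
    qed simp
    from this[of Basis] have "norm (f (x + v) - f x) \<le> (\<Sum>b\<in>Basis. B * \<bar>v \<bullet> b\<bar>)"
      by (simp add: euclidean_representation)
    also have "\<dots> \<le> (\<Sum>b\<in>(Basis::'a set). B * norm v)"
      by (intro sum_mono mult_left_mono B Basis_le_norm)
    finally show ?thesis by (simp add: mult_ac)
  qed
  then show thesis using that[of "B * real DIM('a)"] B by simp
qed

text \<open>A derivative in \<open>x\<close> brings down a coordinate of \<open>\<xi>\<close>, which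
  turns \<open>fourier f (- \<xi>)\<close> into the transform of a derivative of \<open>f\<close>.
  Approximating all derivatives thus reduces to averaging \<open>dlist bs f\<close>.\<close>

lemma dlist_fourier_window:
  fixes G f :: "'a::euclidean_space \<Rightarrow> complex"
  assumes G: "test_fn G" and f: "test_fn f" and bs: "set bs \<subseteq> Basis"
  shows "dlist bs (fourier (\<lambda>\<xi>. G \<xi> * fourier f (- \<xi>))) = fourier (\<lambda>\<xi>. G \<xi> * fourier (dlist bs f) (- \<xi>))"
  using bs
proof (induction bs)
  case (Cons b bs)
  let ?h = "dlist bs f"
  have h: "test_fn ?h" "test_fn (pdir b ?h)" using Cons test_fn_dlist[OF f, of bs] test_fn_dlist[OF f, of "b # bs"] by auto
  have sm: "smooth_fn (\<lambda>\<xi>. fourier ?h (- \<xi>))" using smooth_scale_shift[OF smooth_fourier[OF h(1)], of 0 "-1"] by simp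
  have "pdir b (fourier (\<lambda>\<xi>. G \<xi> * fourier ?h (- \<xi>))) = fourier (\<lambda>\<xi>. - \<i> * of_real (\<xi> \<bullet> b) * (G \<xi> * fourier ?h (- \<xi>)))"
    by (rule pdir_fourier[OF test_fn_mult_right[OF G sm]])
  also have "(\<lambda>\<xi>. - \<i> * of_real (\<xi> \<bullet> b) * (G \<xi> * fourier ?h (- \<xi>))) = (\<lambda>\<xi>. G \<xi> * fourier (pdir b ?h) (- \<xi>))"
  proof
    fix \<xi>
    have "of_real (- \<xi> \<bullet> b) * fourier ?h (- \<xi>) = - \<i> * fourier (pdir b ?h) (- \<xi>)"
      by (rule coord_mult_fourier[OF h(1)]) (use Cons in auto)
    then have "\<i> * (of_real (- \<xi> \<bullet> b) * fourier ?h (- \<xi>)) = fourier (pdir b ?h) (- \<xi>)" by simp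
    then have "- \<i> * of_real (\<xi> \<bullet> b) * fourier ?h (- \<xi>) = fourier (pdir b ?h) (- \<xi>)" by (simp add: mult.assoc)
    then show "- \<i> * of_real (\<xi> \<bullet> b) * (G \<xi> * fourier ?h (- \<xi>)) = G \<xi> * fourier (pdir b ?h) (- \<xi>)"
      by (metis mult.left_commute)
  qed
  finally show ?case using Cons by simp
qed simp

text \<open>At the origin the transform is the integral of a continuous nonnegative function with
  value 1 at 0.\<close>

lemma fourier_cutoff_nonzero: "fourier (cutoff :: 'a::euclidean_space \<Rightarrow> complex) 0 \<noteq> 0"
proof
  assume 0: "fourier (cutoff :: 'a \<Rightarrow> complex) 0 = 0"
  obtain a :: 'a where a: "cball 0 2 \<subseteq> cbox (-a) a" using bounded_subset_cbox_symmetric[OF bounded_cball] by metis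
  have z: "cutoff x = 0" if "x \<notin> cbox (-a) a" for x :: 'a
    using cutoff_zero[of x] a that by force
  have cont: "continuous_on S (cutoff :: 'a \<Rightarrow> complex)" for S by (rule test_fn_cont[OF test_fn_cutoff])
  have "((cutoff :: 'a \<Rightarrow> complex) has_integral 0) (cbox (-a) a)"
    using 0 compact_support_integral(1)[OF cont z] integrable_integral[OF integrable_continuous[OF cont], of "-a" a]
    by (simp add: fourier_def)
  then have "((\<lambda>x::'a. Re (cutoff x)) has_integral Re 0) (cbox (-a) a)"
    by (rule has_integral_Re)
  then have *: "((\<lambda>x::'a. Re (cutoff x)) has_integral 0) (cbox (-a) a)" by simp
  have "(0::'a) \<in> interior (cball 0 2)" by simp
  then have "(0::'a) \<in> interior (cbox (-a) a)" using interior_mono[OF a] by blast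
  then have 1: "(0::'a) \<in> box (-a) a" by (simp add: interior_cbox)
  have cont_Re: "continuous_on (cbox (-a) a) (\<lambda>x::'a. Re (cutoff x))" by (intro continuous_intros cont)
  have "Re (cutoff (0::'a)) = 0"
    by (rule has_integral_0_cbox_imp_0[OF cont_Re _ *])
      (use 1 box_subset_cbox in \<open>auto simp: cutoff_def smooth_step_nonneg\<close>)
  then show False using cutoff_one[of "0::'a"] by simp
qed

lemma integrable_fourier:
  assumes "test_fn G"
  shows "fourier G integrable_on UNIV"
proof (rule measurable_bounded_by_integrable_imp_integrable)
  show "fourier G \<in> borel_measurable (lebesgue_on UNIV)"
    by (rule continuous_imp_measurable_on_sets_lebesgue[OF smooth_fn_continuous[OF smooth_fourier[OF assms]]]) simp
  show "(\<lambda>x. (1 + norm x) ^ 0 * norm (fourier G x)) integrable_on UNIV"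
    by (rule sbound_integrable[OF schwartz_fourier[OF assms]])
qed auto

text \<open>Taking an autocorrelation for \<open>G\<close> makes its transform nonnegative, so that no inversion formula
  is needed to see that the integral is nonzero.\<close>
lemma kernel_nonzero_integral:
  obtains G :: "'a::euclidean_space \<Rightarrow> complex" where "test_fn G" "integral UNIV (fourier G) \<noteq> 0"
proof
  let ?g = "cutoff :: 'a \<Rightarrow> complex"
  define G where "G = correlation ?g (\<lambda>x. cnj (?g x))"
  show G: "test_fn G" unfolding G_def by (intro test_fn_correlation test_fn_cutoff test_fn_cnj)
  define \<kappa> where "\<kappa> = (\<lambda>x. (norm (fourier ?g x))\<^sup>2)"
  have eq: "fourier G x = of_real (\<kappa> x)" for x
    unfolding G_def \<kappa>_def by (rule fourier_autocorrelation[OF test_fn_cutoff])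
  show "integral UNIV (fourier G) \<noteq> 0"
  proof
    assume 0: "integral UNIV (fourier G) = 0"
    have "(fourier G has_integral 0) UNIV"
      using integrable_integral[OF integrable_fourier[OF G]] 0 by simp
    then have "((\<lambda>x. Re (fourier G x)) has_integral Re 0) UNIV" by (rule has_integral_Re)
    then have int: "(\<kappa> has_integral 0) UNIV" by (simp add: eq)
    have cont: "continuous_on S \<kappa>" for S
      unfolding \<kappa>_def
      by (intro continuous_intros continuous_on_subset[OF smooth_fn_continuous[OF smooth_fourier[OF test_fn_cutoff]]]) auto
    have nn: "\<kappa> x \<ge> 0" for x by (simp add: \<kappa>_def)
    have "integral (cbox (-One) One) \<kappa> \<le> integral UNIV \<kappa>"
      using int nn by (intro integral_subset_le integrable_continuous cont) (auto simp: has_integral_iff)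
    moreover have "integral (cbox (-One) One) \<kappa> \<ge> 0"
      using nn by (intro integral_nonneg integrable_continuous cont) auto
    ultimately have "integral (cbox (-One) One) \<kappa> = 0" using int by (simp add: has_integral_iff)
    then have *: "(\<kappa> has_integral 0) (cbox (-One) One)"
      using integrable_integral[OF integrable_continuous[OF cont], of "-One" One] by simp
    have "\<kappa> 0 = 0"
      by (rule has_integral_0_cbox_imp_0[OF cont _ *])
        (auto simp: nn box_eq_empty mem_box)
    then show False using fourier_cutoff_nonzero[where 'a='a] by (simp add: \<kappa>_def)
  qed
qed

text \<open>The Lipschitz bound for \<open>h\<close> gives the factor \<open>\<epsilon>\<close>. The
  integrand is nonzero only if \<open>x\<close> or \<open>x - \<epsilon> *\<^sub>R z\<close> lies in
  the support of \<open>h\<close>, whence \<open>1 + norm x \<le> (1 + r) * (1 + norm z)\<close>: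
  the weight in \<open>x\<close> is shifted to \<open>z\<close> and absorbed by the decay of
  \<open>fourier G\<close>.\<close>

lemma averaging_bound:
  fixes h :: "'a::euclidean_space \<Rightarrow> complex"
  assumes h: "test_fn h" and G: "test_fn G"
  shows "\<exists>C\<ge>0. \<forall>\<epsilon> x. 0 < \<epsilon> \<longrightarrow> \<epsilon> \<le> 1 \<longrightarrow>
    (1 + norm x) ^ N * norm (integral UNIV (\<lambda>z. h (x - \<epsilon> *\<^sub>R z) * fourier G z) - integral UNIV (fourier G) * h x) \<le> C * \<epsilon>"
proof -
  obtain M where M: "0 \<le> M" "\<And>x v. norm (h (x + v) - h x) \<le> M * norm v" using test_fn_lipschitz[OF h] by metis
  obtain r where r: "0 < r" "\<And>x. h x \<noteq> 0 \<Longrightarrow> norm x \<le> r" using test_fn_bounded[OF h] by (auto simp: bounded_pos)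
  \<comment> \<open>\<open>N\<close> powers take over the weight in \<open>x\<close>, and one more
    pays for \<open>norm z\<close> from the Lipschitz estimate.\<close>
  let ?W = "\<lambda>z. (1 + norm z) ^ (N + 1) * norm (fourier G z)"
  have W: "?W integrable_on UNIV" by (rule sbound_integrable[OF schwartz_fourier[OF G]])
  define I where "I = integral UNIV ?W"
  have I: "0 \<le> I" unfolding I_def by (intro integral_nonneg W) auto
  define C where "C = (1 + r) ^ N * M * I"
  have "(1 + norm x) ^ N * norm (integral UNIV (\<lambda>z. h (x - \<epsilon> *\<^sub>R z) * fourier G z) - integral UNIV (fourier G) * h x) \<le> C * \<epsilon>"
    if \<epsilon>: "0 < \<epsilon>" "\<epsilon> \<le> 1" for \<epsilon> x
  proof -
    let ?k = "\<lambda>z. h (x - \<epsilon> *\<^sub>R z) * fourier G z"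
    have tk: "test_fn ?k"
      using test_fn_mult_right[OF test_fn_scale[OF h, of "- \<epsilon>" x] smooth_fourier[OF G]] \<epsilon> by simp
    have int: "(\<lambda>z. fourier G z * h x) integrable_on UNIV"
      by (rule integrable_on_mult_left[OF integrable_fourier[OF G]])
    let ?w = "of_real ((1 + norm x) ^ N) :: complex"
    have "?w * (integral UNIV ?k - integral UNIV (fourier G) * h x) = integral UNIV (\<lambda>z. ?w * (?k z - fourier G z * h x))"
      using Henstock_Kurzweil_Integration.integral_diff[OF test_fn_integrable[OF tk] int] by simp
    moreover have "norm (integral UNIV (\<lambda>z. ?w * (?k z - fourier G z * h x))) \<le>
        integral UNIV (\<lambda>z. ((1 + r) ^ N * M * \<epsilon>) * ?W z)"
    proof (rule Henstock_Kurzweil_Integration.integral_norm_bound_integral)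
      show "(\<lambda>z. ?w * (?k z - fourier G z * h x)) integrable_on UNIV"
        by (intro integrable_on_mult_right Henstock_Kurzweil_Integration.integrable_diff test_fn_integrable tk int)
      show "(\<lambda>z. ((1 + r) ^ N * M * \<epsilon>) * ?W z) integrable_on UNIV"
        by (rule integrable_on_mult_right[OF W])
      fix z
      have "(1 + norm x) ^ N * norm (h (x - \<epsilon> *\<^sub>R z) - h x) \<le> ((1 + r) ^ N * (1 + norm z) ^ N) * (M * (\<epsilon> * (1 + norm z)))"
      proof (cases "h (x - \<epsilon> *\<^sub>R z) - h x = 0")
        case False
        have ez: "norm (\<epsilon> *\<^sub>R z) \<le> norm z" using \<epsilon> by (simp add: mult_left_le_one_le)
        have "norm x \<le> r + norm z"
        proof (cases "h x = 0")
          case True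
          then have "norm (x - \<epsilon> *\<^sub>R z) \<le> r" using False r(2) by auto
          then show ?thesis using ez norm_triangle_ineq[of "x - \<epsilon> *\<^sub>R z" "\<epsilon> *\<^sub>R z"] by simp
        next
          case False
          then show ?thesis using r(2)[of x] norm_ge_zero[of z] by linarith
        qed
        moreover have "0 \<le> r * norm z" using r(1) by simp
        ultimately have "1 + norm x \<le> (1 + r) * (1 + norm z)"
          unfolding distrib_left distrib_right mult_1_left mult_1_right by linarith
        then have 1: "(1 + norm x) ^ N \<le> (1 + r) ^ N * (1 + norm z) ^ N"
          unfolding power_mult_distrib[symmetric] by (rule power_mono) simp
        have "norm (h (x - \<epsilon> *\<^sub>R z) - h x) \<le> M * norm (\<epsilon> *\<^sub>R z)" using M(2)[of x "- (\<epsilon> *\<^sub>R z)"] by simp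
        also have "\<dots> \<le> M * (\<epsilon> * (1 + norm z))" using \<epsilon> M(1) by (intro mult_left_mono) auto
        finally show ?thesis using 1 r(1) by (intro mult_mono) auto
      qed (use r M \<epsilon> in auto)
      then have "(1 + norm x) ^ N * norm (h (x - \<epsilon> *\<^sub>R z) - h x) * norm (fourier G z) \<le>
          ((1 + r) ^ N * (1 + norm z) ^ N) * (M * (\<epsilon> * (1 + norm z))) * norm (fourier G z)"
        by (rule mult_right_mono) simp
      moreover have "?k z - fourier G z * h x = (h (x - \<epsilon> *\<^sub>R z) - h x) * fourier G z" by (simp add: algebra_simps)
      moreover have "norm ?w = (1 + norm x) ^ N" unfolding norm_of_real by simp
      ultimately show "norm (?w * (?k z - fourier G z * h x)) \<le> ((1 + r) ^ N * M * \<epsilon>) * ?W z"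
        by (simp only: norm_mult power_add power_one_right mult_ac)
    qed
    moreover have "integral UNIV (\<lambda>z. ((1 + r) ^ N * M * \<epsilon>) * ?W z) = C * \<epsilon>"
      by (simp add: I_def C_def)
    moreover have "(1 + norm x) ^ N * norm (integral UNIV ?k - integral UNIV (fourier G) * h x) =
        norm (?w * (integral UNIV ?k - integral UNIV (fourier G) * h x))"
      unfolding norm_mult norm_of_real by simp
    ultimately show ?thesis by (simp only:)
  qed
  moreover have "0 \<le> C" using r M I by (simp add: C_def)
  ultimately show ?thesis by blast
qed

text \<open>The windowed double transforms at scale \<open>1 / real (Suc n)\<close> recover
  \<open>f\<close> up to the total mass \<open>c\<close> of \<open>fourier G\<close>; by linearity a
  nonzero constant does no harm when a functional is to be shown to vanish.\<close>

lemma fourier_approx: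
  fixes f :: "'a::euclidean_space \<Rightarrow> complex"
  assumes f: "test_fn f"
  shows "\<exists>g c. c \<noteq> 0 \<and> (\<forall>n. test_fn (g n)) \<and>
    (\<forall>N. \<exists>C. \<forall>n. sbound N (\<lambda>x. fourier (g n) x - c * f x) (C / real (Suc n)))"
proof -
  obtain G :: "'a \<Rightarrow> complex" where G: "test_fn G" "integral UNIV (fourier G) \<noteq> 0" using kernel_nonzero_integral by metis
  define c where "c = integral UNIV (fourier G)"
  define \<epsilon> where "\<epsilon> n = 1 / real (Suc n)" for n
  have \<epsilon>: "0 < \<epsilon> n" "\<epsilon> n \<le> 1" for n by (auto simp: \<epsilon>_def)
  define g where "g n = (\<lambda>\<xi>. G (\<epsilon> n *\<^sub>R \<xi>) * fourier f (- \<xi>))" for n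
  have tG: "test_fn (\<lambda>\<xi>. G (\<epsilon> n *\<^sub>R \<xi>))" for n using test_fn_scale[OF G(1), of "\<epsilon> n" 0] \<epsilon>(1)[of n] by simp
  have g: "test_fn (g n)" for n
    unfolding g_def
    using test_fn_mult_right[OF tG smooth_scale_shift[OF smooth_fourier[OF f], of 0 "-1"]] by simp
  have "\<exists>C. \<forall>n. sbound N (\<lambda>x. fourier (g n) x - c * f x) (C / real (Suc n))" for N
  proof -
    define D where "D = {bs :: 'a list. set bs \<subseteq> Basis \<and> length bs \<le> N}"
    have fin: "finite D" unfolding D_def by (rule finite_Basis_lists)
    define P where "P bs C \<longleftrightarrow> 0 \<le> C \<and> (\<forall>\<epsilon> x. 0 < \<epsilon> \<longrightarrow> \<epsilon> \<le> 1 \<longrightarrow> (1 + norm x) ^ N *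
      norm (integral UNIV (\<lambda>z. dlist bs f (x - \<epsilon> *\<^sub>R z) * fourier G z) - c * dlist bs f x) \<le> C * \<epsilon>)" for bs C
    have "\<exists>C. P bs C" if "bs \<in> D" for bs
      unfolding P_def c_def using that by (intro averaging_bound test_fn_dlist f G) (auto simp: D_def)
    then obtain C where C': "\<And>bs. bs \<in> D \<Longrightarrow> P bs (C bs)" by metis
    have C: "0 \<le> C bs" "(1 + norm x) ^ N *
      norm (integral UNIV (\<lambda>z. dlist bs f (x - \<epsilon> *\<^sub>R z) * fourier G z) - c * dlist bs f x) \<le> C bs * \<epsilon>"
      if "bs \<in> D" "0 < \<epsilon>" "\<epsilon> \<le> 1" for bs \<epsilon> x
      using C'[OF that(1)] that unfolding P_def by blast+
    have "sbound N (\<lambda>x. fourier (g n) x - c * f x) ((\<Sum>bs\<in>D. C bs) / real (Suc n))" for n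
    proof (rule sboundI)
      fix bs :: "'a list" and x assume bs: "set bs \<subseteq> Basis" "length bs \<le> N"
      then have D: "bs \<in> D" by (simp add: D_def)
      have "dlist bs (\<lambda>x. fourier (g n) x - c * f x) x = dlist bs (fourier (g n)) x - c * dlist bs f x"
        using smooth_fourier[OF g] test_fn_smooth[OF f]
        by (simp add: dlist_diff[OF _ _ bs(1)] dlist_cmult[OF _ bs(1)] smooth_mult smooth_const)
      also have "dlist bs (fourier (g n)) x = integral UNIV (\<lambda>z. dlist bs f (x - \<epsilon> n *\<^sub>R z) * fourier G z)"
        unfolding g_def dlist_fourier_window[OF tG f bs(1)]
        by (rule fourier_window[OF G(1) test_fn_dlist[OF f bs(1)] \<epsilon>(1)])
      finally have "(1 + norm x) ^ N * norm (dlist bs (\<lambda>x. fourier (g n) x - c * f x) x) \<le> C bs * \<epsilon> n"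
        using C(2)[OF D \<epsilon>] by simp
      also have "\<dots> \<le> (\<Sum>bs\<in>D. C bs) * \<epsilon> n"
        using \<epsilon>(1)[of n] C(1)[OF _ \<epsilon>] by (intro mult_right_mono member_le_sum[OF D _ fin]) auto
      finally show "(1 + norm x) ^ N * norm (dlist bs (\<lambda>x. fourier (g n) x - c * f x) x) \<le> (\<Sum>bs\<in>D. C bs) / real (Suc n)"
        by (simp add: \<epsilon>_def)
    qed
    then show ?thesis by blast
  qed
  moreover have "c \<noteq> 0" using G(2) by (simp add: c_def)
  ultimately show ?thesis using g by blast
qed

text \<open>Where the cutoff of radius \<open>Suc n\<close> differs from 1, \<open>norm x\<close> is
  at least \<open>Suc n\<close>, so a single spare power of the weight yields the rate. This is why
  the bound on \<open>f\<close> is taken at order \<open>Suc N\<close>.\<close>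

lemma schwartz_test_approx:
  fixes f :: "'a::euclidean_space \<Rightarrow> complex"
  assumes f: "schwartz f"
  shows "\<exists>g. (\<forall>n. test_fn (g n)) \<and> (\<forall>N. \<exists>C. \<forall>n. sbound N (\<lambda>x. g n x - f x) (C / real (Suc n)))"
proof -
  define \<theta> where "\<theta> n = (\<lambda>x::'a. cutoff ((1 / real (Suc n)) *\<^sub>R x))" for n
  have t\<theta>: "test_fn (\<theta> n)" for n using test_fn_scale[OF test_fn_cutoff, of "1 / real (Suc n)" 0] by (simp add: \<theta>_def)
  have sm: "smooth_fn f" using f by (rule schwartz_smooth)
  define g where "g n = (\<lambda>x. \<theta> n x * f x)" for n
  have "\<exists>C. \<forall>n. sbound N (\<lambda>x. g n x - f x) (C / real (Suc n))" for N
  proof -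
    obtain B where B: "sbound (Suc N) f B" using f by (auto simp: schwartz_iff_sbound)
    have B0: "0 \<le> B" by (rule sbound_nonneg[OF B])
    obtain M where M: "0 \<le> M" "\<And>x::'a. pbound N cutoff x M" using pbound_test[OF test_fn_cutoff] by metis
    have "pbound N (\<theta> n) x M" for n x
      using pbound_scale_shift[OF smooth_cutoff, of N 0 "1 / real (Suc n)" x M] M(2) by (simp add: \<theta>_def)
    moreover have "pbound N (\<lambda>_. 1) x 1" for x :: 'a
      unfolding pbound_def
    proof (intro allI impI)
      fix bs :: "'a list"
      show "norm (dlist bs (\<lambda>_. 1) x) \<le> 1"
      proof (cases bs rule: rev_cases)
        case (snoc cs b)
        then show ?thesis by (simp add: dlist_append)
      qed simp
    qed
    ultimately have 1: "pbound N (\<lambda>x. \<theta> n x - 1) x (M + 1)" for n x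
      by (intro pbound_diff test_fn_smooth t\<theta> smooth_const)
    have "sbound N (\<lambda>x. g n x - f x) ((2 ^ N * (M + 1) * B) / real (Suc n))" for n
    proof (rule sboundI)
      fix bs :: "'a list" and x assume bs: "set bs \<subseteq> Basis" "length bs \<le> N"
      have eq: "(\<lambda>x. g n x - f x) = (\<lambda>x. (\<theta> n x - 1) * f x)" by (auto simp: g_def algebra_simps)
      show "(1 + norm x) ^ N * norm (dlist bs (\<lambda>x. g n x - f x) x) \<le> (2 ^ N * (M + 1) * B) / real (Suc n)"
      proof (cases "norm x < real (Suc n)")
        case True
        have "dlist bs (\<lambda>x. g n x - f x) x = dlist bs (\<lambda>_. 0) x"
        proof (rule dlist_local[of "ball 0 (real (Suc n))"])
          show "g n y - f y = 0" if "y \<in> ball 0 (real (Suc n))" for y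
            using that cutoff_one[of "(1 / real (Suc n)) *\<^sub>R y"] by (simp add: g_def \<theta>_def)
        qed (use True in auto)
        then show ?thesis using M B0 by simp
      next
        case False
        have "pbound (Suc N) f x (B / (1 + norm x) ^ Suc N)" using B unfolding sbound_def by blast
        then have "pbound N f x (B / (1 + norm x) ^ Suc N)" by (rule pbound_mono) auto
        then have "pbound N (\<lambda>x. (\<theta> n x - 1) * f x) x (2 ^ N * (M + 1) * (B / (1 + norm x) ^ Suc N))"
          by (intro pbound_mult 1 sm smooth_intros test_fn_smooth t\<theta>)
        then have "norm (dlist bs (\<lambda>x. g n x - f x) x) \<le> 2 ^ N * (M + 1) * (B / (1 + norm x) ^ Suc N)"
          unfolding eq using bs by (rule pboundD)
        then have "(1 + norm x) ^ N * norm (dlist bs (\<lambda>x. g n x - f x) x) \<le>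
            (1 + norm x) ^ N * (2 ^ N * (M + 1) * (B / (1 + norm x) ^ Suc N))"
          by (intro mult_left_mono) auto
        also have "\<dots> = (2 ^ N * (M + 1) * B) / (1 + norm x)"
        proof -
          have "1 + norm x \<noteq> 0" using norm_ge_zero[of x] by linarith
          then show ?thesis by simp
        qed
        also have "\<dots> \<le> (2 ^ N * (M + 1) * B) / real (Suc n)"
          using False M B0 by (intro divide_left_mono mult_nonneg_nonneg mult_pos_pos) (auto intro: add_pos_nonneg)
        finally show ?thesis .
      qed
    qed
    then show ?thesis by blast
  qed
  moreover have "test_fn (g n)" for n unfolding g_def by (rule test_fn_mult_right[OF t\<theta> sm])
  ultimately show ?thesis by blast
qed

lemma tempered_zero_if_zero_on_fourier:
  assumes U: "tempered U" and zero: "\<And>g. test_fn g \<Longrightarrow> U (fourier g) = 0" and \<psi>: "schwartz \<psi>"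
  shows "U \<psi> = 0"
proof -
  have test: "U f = 0" if f: "test_fn f" for f
  proof -
    obtain g c where g: "c \<noteq> 0" "\<And>n. test_fn (g n)"
      "\<And>N. \<exists>C. \<forall>n. sbound N (\<lambda>x. fourier (g n) x - c * f x) (C / real (Suc n))"
      using fourier_approx[OF f] by blast
    have "(\<lambda>n. U (fourier (g n))) \<longlonglongrightarrow> U (\<lambda>x. c * f x)"
      by (rule tempered_tendsto_0[OF U schwartz_fourier[OF g(2)] schwartz_cmult[OF test_fn_schwartz[OF f]] g(3)])
    then have "U (\<lambda>x. c * f x) = 0" using zero[OF g(2)] by (simp add: LIMSEQ_const_iff)
    then show ?thesis using g(1) tempered_cmult[OF U test_fn_schwartz[OF f]] by simp
  qed
  obtain g where g: "\<And>n. test_fn (g n)" "\<And>N. \<exists>C. \<forall>n. sbound N (\<lambda>x. g n x - \<psi> x) (C / real (Suc n))"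
    using schwartz_test_approx[OF \<psi>] by blast
  have "(\<lambda>n. U (g n)) \<longlonglongrightarrow> U \<psi>"
    by (rule tempered_tendsto_0[OF U test_fn_schwartz[OF g(1)] \<psi> g(2)])
  then show ?thesis using test[OF g(1)] by (simp add: LIMSEQ_const_iff)
qed

subsection \<open>Polynomial symbols and the equation in the frequency variable\<close>

definition mon_eval :: "('d::finite \<Rightarrow>\<^sub>0 nat) \<Rightarrow> complex^'d \<Rightarrow> complex" where
  "mon_eval \<alpha> \<xi> = (\<Prod>i\<in>UNIV. (\<xi> $ i) ^ Poly_Mapping.lookup \<alpha> i)"

lemma mon_eval_add: "mon_eval (\<alpha> + \<beta>) \<xi> = mon_eval \<alpha> \<xi> * mon_eval \<beta> \<xi>"
  by (simp add: mon_eval_def lookup_add power_add prod.distrib)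

lemma mpoly_eval_superset:
  assumes "finite K" "Poly_Mapping.keys q \<subseteq> K"
  shows "mpoly_eval q \<xi> = (\<Sum>\<alpha>\<in>K. Poly_Mapping.lookup q \<alpha> * mon_eval \<alpha> \<xi>)"
  unfolding mpoly_eval_def mon_eval_def
  by (rule sum.mono_neutral_left) (use assms in \<open>auto simp: in_keys_iff\<close>)

lemma mpoly_eval_add: "mpoly_eval (q + r) \<xi> = mpoly_eval q \<xi> + mpoly_eval r \<xi>"
proof -
  let ?K = "Poly_Mapping.keys q \<union> Poly_Mapping.keys r"
  have "mpoly_eval (q + r) \<xi> = (\<Sum>\<alpha>\<in>?K. Poly_Mapping.lookup (q + r) \<alpha> * mon_eval \<alpha> \<xi>)"
    by (rule mpoly_eval_superset) (use keys_add[of q r] in auto)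
  moreover have "mpoly_eval q \<xi> = (\<Sum>\<alpha>\<in>?K. Poly_Mapping.lookup q \<alpha> * mon_eval \<alpha> \<xi>)"
    by (rule mpoly_eval_superset) auto
  moreover have "mpoly_eval r \<xi> = (\<Sum>\<alpha>\<in>?K. Poly_Mapping.lookup r \<alpha> * mon_eval \<alpha> \<xi>)"
    by (rule mpoly_eval_superset) auto
  ultimately show ?thesis by (simp add: lookup_add distrib_right sum.distrib)
qed

lemma mpoly_eval_zero: "mpoly_eval 0 \<xi> = 0"
  by (simp add: mpoly_eval_def)

lemma mpoly_eval_sum: "mpoly_eval (\<Sum>i\<in>I. q i) \<xi> = (\<Sum>i\<in>I. mpoly_eval (q i) \<xi>)"
  by (induction I rule: infinite_finite_induct) (auto simp: mpoly_eval_zero mpoly_eval_add)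

lemma mpoly_eval_single: "mpoly_eval (Poly_Mapping.single \<alpha> c) \<xi> = c * mon_eval \<alpha> \<xi>"
  by (subst mpoly_eval_superset[of "{\<alpha>}"]) auto

lemma poly_mapping_eq_sum_single:
  fixes q :: "'a \<Rightarrow>\<^sub>0 'b::comm_monoid_add"
  shows "q = (\<Sum>\<alpha>\<in>Poly_Mapping.keys q. Poly_Mapping.single \<alpha> (Poly_Mapping.lookup q \<alpha>))"
  by (rule poly_mapping_eqI)
    (simp add: lookup_sum lookup_single when_def in_keys_iff)

lemma mpoly_eval_mult: "mpoly_eval (q * r) \<xi> = mpoly_eval q \<xi> * mpoly_eval r \<xi>"
proof -
  have "q * r = (\<Sum>\<alpha>\<in>Poly_Mapping.keys q. \<Sum>\<beta>\<in>Poly_Mapping.keys r.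
      Poly_Mapping.single \<alpha> (Poly_Mapping.lookup q \<alpha>) * Poly_Mapping.single \<beta> (Poly_Mapping.lookup r \<beta>))"
    unfolding sum_product[symmetric] by (simp add: poly_mapping_eq_sum_single[symmetric])
  then have "mpoly_eval (q * r) \<xi> = (\<Sum>\<alpha>\<in>Poly_Mapping.keys q. \<Sum>\<beta>\<in>Poly_Mapping.keys r.
      (Poly_Mapping.lookup q \<alpha> * mon_eval \<alpha> \<xi>) * (Poly_Mapping.lookup r \<beta> * mon_eval \<beta> \<xi>))"
    by (simp add: mpoly_eval_sum mult_single mpoly_eval_single mon_eval_add mult_ac)
  then show ?thesis
    by (simp add: sum_product[symmetric] mpoly_eval_superset[OF finite_keys order_refl])
qed

text \<open>The members of \<open>CX p\<close> are combinations of the coefficients, so a common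
  zero of all coefficients at an imaginary point would lie in the variety.\<close>

lemma Vset_CX_imag:
  fixes p :: "'d::finite mpoly poly" and y :: "real^'d"
  assumes "Vset (CX p) \<inter> imag_Rd = {}"
  shows "\<exists>j\<le>degree p. mpoly_eval (coeff p j) (\<chi> i. \<i> * of_real (y $ i)) \<noteq> 0"
proof (rule ccontr)
  let ?\<xi> = "\<chi> i. \<i> * complex_of_real (y $ i)"
  assume "\<not> ?thesis"
  then have "mpoly_eval q ?\<xi> = 0" if "q \<in> CX p" for q
    using that by (auto simp: CX_def mpoly_eval_sum mpoly_eval_mult)
  then have "?\<xi> \<in> Vset (CX p)" by (simp add: Vset_def)
  moreover have "?\<xi> \<in> imag_Rd" by (auto simp: imag_Rd_def)
  ultimately show False using assms by blast
qed

text \<open>The multiplier by which the differential operator with polynomial \<open>q\<close> acts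
  after a Fourier transform in space, as a function of the real frequency.\<close>

definition symb :: "'d::finite mpoly \<Rightarrow> real^'d \<Rightarrow> complex" where
  "symb q \<xi> = mpoly_eval q (\<chi> i. \<i> * of_real (\<xi> $ i))"

lemma symb_altdef:
  "symb q = (\<lambda>\<xi>. \<Sum>\<alpha>\<in>Poly_Mapping.keys q. Poly_Mapping.lookup q \<alpha> *
     (\<Prod>i\<in>UNIV. (\<i> * of_real (\<xi> \<bullet> axis i 1)) ^ Poly_Mapping.lookup \<alpha> i))"
  by (rule ext) (simp add: symb_def mpoly_eval_def inner_axis)

lemma smooth_symb: "smooth_fn (symb q)"
  unfolding symb_altdef by (intro smooth_intros smooth_linear bounded_linear_inner_left)

section \<open>Multi-indices as lists of directions\<close>

lemma mset_xdirs:
  "mset (xdirs \<alpha>) = (\<Sum>i\<in>UNIV. replicate_mset (Poly_Mapping.lookup \<alpha> i) (axis i 1, 0))"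
  unfolding xdirs_def by (rule someI_ex) (rule ex_mset)

lemma set_xdirs: "set (xdirs \<alpha>) \<subseteq> range (\<lambda>i. (axis i 1, 0))"
proof -
  have "set (xdirs \<alpha>) = set_mset (\<Sum>i\<in>UNIV. replicate_mset (Poly_Mapping.lookup \<alpha> i) (axis i 1, 0))"
    unfolding set_mset_mset[symmetric] mset_xdirs ..
  also have "\<dots> \<subseteq> range (\<lambda>i. (axis i 1, 0))"
    by (auto simp: set_mset_sum split: if_splits)
  finally show ?thesis .
qed

definition xaxes :: "('d::finite \<Rightarrow>\<^sub>0 nat) \<Rightarrow> (real^'d) list" where
  "xaxes \<alpha> = map fst (xdirs \<alpha>)"

lemma xdirs_xaxes: "xdirs \<alpha> = map (\<lambda>b. (b, 0)) (xaxes \<alpha>)"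
proof -
  have "(fst z, 0) = z" if "z \<in> set (xdirs \<alpha>)" for z using subsetD[OF set_xdirs that] by auto
  then show ?thesis by (simp add: xaxes_def o_def map_idI)
qed

lemma set_xaxes: "set (xaxes \<alpha>) \<subseteq> Basis"
  using set_xdirs[of \<alpha>] by (auto simp: xaxes_def)

text \<open>\<open>xdirs \<alpha>\<close> is some enumeration of which only the multiset of entries
  is known, so the product is computed over that multiset.\<close>

lemma prod_list_xaxes:
  fixes f :: "real^'d::finite \<Rightarrow> complex"
  shows "(\<Prod>b\<leftarrow>xaxes \<alpha>. f b) = (\<Prod>i\<in>UNIV. f (axis i 1) ^ Poly_Mapping.lookup \<alpha> i)"
proof -
  have "(\<Prod>b\<leftarrow>xaxes \<alpha>. f b) = (\<Prod>z\<in>#mset (xdirs \<alpha>). f (fst z))"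
    by (simp add: xaxes_def o_def prod_mset_prod_list flip: mset_map)
  also have "\<dots> = (\<Prod>i\<in>UNIV. f (axis i 1) ^ Poly_Mapping.lookup \<alpha> i)"
  proof -
    have "(\<Prod>z\<in>#(\<Sum>i\<in>I. replicate_mset (n i) (axis i 1, 0::real)). f (fst z)) = (\<Prod>i\<in>I. f (axis i 1) ^ n i)"
      for I :: "'d set" and n
      by (induction I rule: infinite_finite_induct) simp_all
    then show ?thesis unfolding mset_xdirs .
  qed
  finally show ?thesis .
qed

section \<open>Tensor products of functions of time and space\<close>

definition tensor :: "(real \<Rightarrow> complex) \<Rightarrow> ('a::euclidean_space \<Rightarrow> complex) \<Rightarrow> 'a \<times> real \<Rightarrow> complex" where
  "tensor \<phi> \<psi> = (\<lambda>(x, t). \<phi> t * \<psi> x)"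

lemma test_fn_tensor:
  fixes \<psi> :: "'a::euclidean_space \<Rightarrow> complex"
  assumes "test_fn \<phi>" "test_fn \<psi>"
  shows "test_fn (tensor \<phi> \<psi>)"
proof -
  have "smooth_fn (\<lambda>z::'a \<times> real. \<phi> (snd z))"
  proof (rule smooth_affine[OF test_fn_smooth[OF assms(1)]])
    fix b :: "'a \<times> real" assume "b \<in> Basis"
    show "\<exists>b'\<in>Basis. \<exists>c. \<forall>x s. snd (x + s *\<^sub>R b) = snd x + (c * s) *\<^sub>R b'"
      by (rule bexI[of _ "1::real"], rule exI[of _ "snd b"]) auto
  qed (auto intro!: continuous_intros)
  moreover have "smooth_fn (\<lambda>z::'a \<times> real. \<psi> (fst z))"
  proof (rule smooth_affine[OF test_fn_smooth[OF assms(2)]])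
    fix b :: "'a \<times> real" assume b: "b \<in> Basis"
    show "\<exists>b'\<in>Basis. \<exists>c. \<forall>x s. fst (x + s *\<^sub>R b) = fst x + (c * s) *\<^sub>R b'"
    proof (cases "fst b = 0")
      case True
      then show ?thesis by (intro bexI[of _ "SOME b. b \<in> Basis"] exI[of _ 0]) (auto simp: SOME_Basis)
    next
      case False
      then have "fst b \<in> Basis" using b by (auto simp: Basis_prod_def)
      then show ?thesis by (intro bexI[of _ "fst b"] exI[of _ 1]) auto
    qed
  qed (auto intro!: continuous_intros)
  ultimately have "smooth_fn (\<lambda>z. \<phi> (snd z) * \<psi> (fst z))" by (rule smooth_mult)
  moreover have "bounded ({x. \<psi> x \<noteq> 0} \<times> {t. \<phi> t \<noteq> 0})"
    using assms by (intro bounded_Times test_fn_bounded)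
  then have "bounded {z. tensor \<phi> \<psi> z \<noteq> 0}"
    by (rule bounded_subset) (auto simp: tensor_def)
  moreover have "tensor \<phi> \<psi> = (\<lambda>z. \<phi> (snd z) * \<psi> (fst z))" by (auto simp: tensor_def)
  ultimately show ?thesis by (simp add: test_fn_iff)
qed

lemma pdir_tensor_space:
  assumes "smooth_fn \<psi>" "b \<in> Basis"
  shows "pdir (b, 0) (tensor \<phi> \<psi>) = tensor \<phi> (pdir b \<psi>)"
proof (rule ext, rule has_pdir_imp)
  fix z
  show "has_pdir (b, 0) (tensor \<phi> \<psi>) z (tensor \<phi> (pdir b \<psi>) z)"
    using has_vector_derivative_mult_right[OF smooth_fn_has_pdir[OF assms, of "fst z"], of "\<phi> (snd z)"]
    by (simp add: tensor_def case_prod_beta)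
qed

lemma pdir_tensor_time:
  assumes "smooth_fn \<phi>"
  shows "pdir (0, 1) (tensor \<phi> \<psi>) = tensor (pdir 1 \<phi>) \<psi>"
proof (rule ext, rule has_pdir_imp)
  fix z
  show "has_pdir (0, 1) (tensor \<phi> \<psi>) z (tensor (pdir 1 \<phi>) \<psi> z)"
    using has_vector_derivative_mult_left[OF smooth_fn_has_pdir[OF assms, of 1 "snd z"], of "\<psi> (fst z)"]
    by (simp add: tensor_def case_prod_beta)
qed

lemma dlist_tensor:
  assumes "smooth_fn \<phi>" "smooth_fn \<psi>" "set bs \<subseteq> Basis"
  shows "dlist (replicate j (0, 1) @ map (\<lambda>b. (b, 0)) bs) (tensor \<phi> \<psi>) =
    tensor (dlist (replicate j 1) \<phi>) (dlist bs \<psi>)"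
proof -
  have "dlist (map (\<lambda>b. (b, 0)) bs) (tensor \<phi> \<psi>) = tensor \<phi> (dlist bs \<psi>)"
    using assms(3) by (induction bs) (auto simp: pdir_tensor_space smooth_fn_dlist[OF assms(2)])
  moreover have "dlist (replicate j (0, 1)) (tensor \<phi> \<psi>') = tensor (dlist (replicate j 1) \<phi>) \<psi>'" for \<psi>'
  proof (induction j)
    case (Suc j)
    have "smooth_fn (dlist (replicate j 1) \<phi>)"
      by (rule smooth_fn_dlist[OF assms(1)]) (auto simp: set_replicate_conv_if)
    then show ?case using Suc by (simp add: pdir_tensor_time)
  qed simp
  ultimately show ?thesis by (simp add: dlist_append)
qed

lemma neg_deriv_pow:
  assumes "smooth_fn \<phi>"
  shows "(neg_deriv ^^ j) \<phi> = (\<lambda>t. (-1) ^ j * dlist (replicate j 1) \<phi> t)"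
proof (induction j)
  case (Suc j)
  have "smooth_fn (dlist (replicate j 1) \<phi>)"
    by (rule smooth_fn_dlist[OF assms]) (auto simp: set_replicate_conv_if)
  then show ?case using Suc by (simp add: neg_deriv_def[abs_def] pdir_cmult)
qed simp

lemma fourier_zero: "fourier (\<lambda>\<xi>. 0) = (\<lambda>x. 0)"
  by (rule ext) (simp add: fourier_def)

lemma tempered_fourier_sum:
  fixes U :: "('a::euclidean_space \<Rightarrow> complex) \<Rightarrow> complex"
  assumes "tempered U" "finite I" "\<And>i. i \<in> I \<Longrightarrow> test_fn (g i)"
  shows "U (fourier (\<lambda>\<xi>. \<Sum>i\<in>I. c i * g i \<xi>)) = (\<Sum>i\<in>I. c i * U (fourier (g i)))"
  using assms(2,3)
proof (induction I rule: finite_induct)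
  case empty
  then show ?case by (simp add: fourier_zero tempered_zero[OF assms(1)])
next
  case (insert i I)
  have t: "test_fn (g i)" "test_fn (\<lambda>\<xi>. \<Sum>i\<in>I. c i * g i \<xi>)"
    using insert by (auto intro!: test_fn_sum test_fn_cmult)
  have "fourier (\<lambda>\<xi>. c i * g i \<xi> + (\<Sum>i\<in>I. c i * g i \<xi>)) =
      (\<lambda>x. c i * fourier (g i) x + fourier (\<lambda>\<xi>. \<Sum>i\<in>I. c i * g i \<xi>) x)"
    using fourier_add[OF test_fn_cmult[OF t(1)] t(2)] by (auto simp: fourier_cmult)
  then show ?case
    using insert tempered_lin[OF assms(1) schwartz_fourier[OF t(1)] schwartz_fourier[OF t(2)], of "c i"] by simp
qed

section \<open>Vanishing of solutions supported in the future\<close>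

text \<open>For each frequency window \<open>g\<close> the values of \<open>u\<close> on cut-off
  time functions and on transforms of \<open>\<lambda>\<xi>. g \<xi> * h \<xi>\<close> form a
  pairing to which \<open>pairing_unique_continuation\<close> applies. At \<open>h = 1\<close> it
  gives \<open>u \<phi> (fourier g) = 0\<close>, and such transforms determine a tempered
  distribution.\<close>

lemma N_L_zero:
  fixes u :: "(real \<Rightarrow> complex) \<Rightarrow> (real^'d::finite \<Rightarrow> complex) \<Rightarrow> complex"
  assumes u: "u \<in> N_L p" and V: "Vset (CX p) \<inter> imag_Rd = {}"
    and \<phi>: "test_fn \<phi>" and \<psi>: "schwartz \<psi>"
  shows "u \<phi> \<psi> = 0"
proof -
  obtain U where U: "distribution U" "represents U u" "Dp_zero p U" "vanishes_neg U"
    using u by (auto simp: N_L_def)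
  have temp: "tempered (u \<phi>)" if "test_fn \<phi>" for \<phi>
    using u that by (auto simp: N_L_def Lmaps_def)
  have dist: "distribution (\<lambda>\<phi>. u \<phi> \<psi>)" if "schwartz \<psi>" for \<psi>
    using u that by (auto simp: N_L_def Lmaps_def)
  have rep: "U (tensor \<phi> \<psi>) = u \<phi> \<psi>" if "test_fn \<phi>" "test_fn \<psi>" for \<phi> \<psi>
    using U(2) that by (simp add: represents_def tensor_def)
  \<comment> \<open>The margin between -1 and 0 keeps the closed support of the tensor product
    inside the open half space. Vanishing for test functions \<open>\<psi>\<close> passes to
    Schwartz functions by density.\<close>
  have past: "u \<phi> \<psi> = 0" if \<phi>: "test_fn \<phi>" and neg: "\<And>t. t > -1 \<Longrightarrow> \<phi> t = 0" and \<psi>: "schwartz \<psi>" for \<phi> \<psi>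
  proof -
    have test: "u \<phi> \<psi> = 0" if "test_fn \<psi>" for \<psi>
    proof -
      have "{z. tensor \<phi> \<psi> z \<noteq> 0} \<subseteq> {z. snd z \<le> -1}"
        using neg by (auto simp: tensor_def) (meson not_le)
      moreover have "closed {z::(real^'d) \<times> real. snd z \<le> -1}"
        by (intro closed_Collect_le continuous_intros)
      ultimately have "tsupport (tensor \<phi> \<psi>) \<subseteq> {z. snd z \<le> -1}"
        unfolding tsupport_def by (rule closure_minimal)
      then have "tsupport (tensor \<phi> \<psi>) \<subseteq> {z. snd z < 0}" by auto
      then show ?thesis
        using U(4) test_fn_tensor[OF \<phi> that] rep[OF \<phi> that] by (simp add: vanishes_neg_def)
    qed
    obtain g where g: "\<And>n. test_fn (g n)" "\<And>N. \<exists>C. \<forall>n. sbound N (\<lambda>x. g n x - \<psi> x) (C / real (Suc n))"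
      using schwartz_test_approx[OF \<psi>] by blast
    have "(\<lambda>n. u \<phi> (g n)) \<longlonglongrightarrow> u \<phi> \<psi>"
      by (rule tempered_tendsto_0[OF temp[OF \<phi>] test_fn_schwartz[OF g(1)] \<psi> g(2)])
    then show ?thesis using test[OF g(1)] by (simp add: LIMSEQ_const_iff)
  qed
  let ?c = "\<lambda>j \<alpha>. Poly_Mapping.lookup (coeff p j) \<alpha> * (-1) ^ ((\<Sum>i\<in>UNIV. Poly_Mapping.lookup \<alpha> i) + j)"
  \<comment> \<open>The equation is known on tensor products of test functions, but the space factor
    will be a transform, which is merely a Schwartz function; hence the limit in
    \<open>\<psi>\<close>.\<close>
  have eq_schwartz: "(\<Sum>j\<le>degree p. \<Sum>\<alpha>\<in>Poly_Mapping.keys (coeff p j).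
      ?c j \<alpha> * u (dlist (replicate j 1) \<phi>) (dlist (xaxes \<alpha>) \<psi>)) = 0"
    if \<phi>: "test_fn \<phi>" and \<psi>: "schwartz \<psi>" for \<phi> \<psi>
  proof -
    have t\<phi>: "test_fn (dlist (replicate j 1) \<phi>)" for j
      by (rule test_fn_dlist[OF \<phi>]) (auto simp: set_replicate_conv_if)
    have test: "(\<Sum>j\<le>degree p. \<Sum>\<alpha>\<in>Poly_Mapping.keys (coeff p j).
        ?c j \<alpha> * u (dlist (replicate j 1) \<phi>) (dlist (xaxes \<alpha>) \<psi>)) = 0" if \<psi>: "test_fn \<psi>" for \<psi>
    proof -
      have t: "test_fn (tensor (dlist (replicate j 1) \<phi>) (dlist (xaxes \<alpha>) \<psi>))" for j \<alpha>
        by (intro test_fn_tensor t\<phi> test_fn_dlist[OF \<psi>] set_xaxes)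
      have "Dp_transpose p (tensor \<phi> \<psi>) = (\<lambda>z. \<Sum>j\<le>degree p. \<Sum>\<alpha>\<in>Poly_Mapping.keys (coeff p j).
          ?c j \<alpha> * tensor (dlist (replicate j 1) \<phi>) (dlist (xaxes \<alpha>) \<psi>) z)"
        unfolding Dp_transpose_def xdirs_xaxes
        by (simp add: dlist_tensor[OF test_fn_smooth[OF \<phi>] test_fn_smooth[OF \<psi>] set_xaxes])
      then have "U (Dp_transpose p (tensor \<phi> \<psi>)) = (\<Sum>j\<le>degree p. \<Sum>\<alpha>\<in>Poly_Mapping.keys (coeff p j).
          ?c j \<alpha> * u (dlist (replicate j 1) \<phi>) (dlist (xaxes \<alpha>) \<psi>))"
        by (simp add: distribution_sum[OF U(1)] distribution_cmult[OF U(1)] t test_fn_sum test_fn_cmult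
            rep[OF t\<phi> test_fn_dlist[OF \<psi> set_xaxes]])
      then show ?thesis using U(3) test_fn_tensor[OF \<phi> \<psi>] by (simp add: Dp_zero_def)
    qed
    obtain g where g: "\<And>n. test_fn (g n)" "\<And>N. \<exists>C. \<forall>n. sbound N (\<lambda>x. g n x - \<psi> x) (C / real (Suc n))"
      using schwartz_test_approx[OF \<psi>] by blast
    have "(\<lambda>n. u (dlist (replicate j 1) \<phi>) (dlist (xaxes \<alpha>) (g n))) \<longlonglongrightarrow>
        u (dlist (replicate j 1) \<phi>) (dlist (xaxes \<alpha>) \<psi>)" for j \<alpha>
    proof (rule tempered_tendsto_0[OF temp[OF t\<phi>]])
      show "\<exists>C. \<forall>n. sbound N (\<lambda>x. dlist (xaxes \<alpha>) (g n) x - dlist (xaxes \<alpha>) \<psi> x) (C / real (Suc n))" for N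
        using g(2)[of "N + length (xaxes \<alpha>)"] sbound_dlist[OF _ set_xaxes, of N \<alpha>]
        by (simp add: dlist_diff[OF test_fn_smooth[OF g(1)] schwartz_smooth[OF \<psi>] set_xaxes, symmetric]) blast
    qed (intro test_fn_schwartz schwartz_dlist test_fn_dlist g \<psi> set_xaxes)+
    then have "(\<lambda>n. \<Sum>j\<le>degree p. \<Sum>\<alpha>\<in>Poly_Mapping.keys (coeff p j).
        ?c j \<alpha> * u (dlist (replicate j 1) \<phi>) (dlist (xaxes \<alpha>) (g n))) \<longlonglongrightarrow>
      (\<Sum>j\<le>degree p. \<Sum>\<alpha>\<in>Poly_Mapping.keys (coeff p j).
        ?c j \<alpha> * u (dlist (replicate j 1) \<phi>) (dlist (xaxes \<alpha>) \<psi>))"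
      by (intro tendsto_sum tendsto_mult tendsto_const)
    then show ?thesis unfolding test[OF g(1)] by (simp add: LIMSEQ_const_iff)
  qed
  \<comment> \<open>The signs of the transposed operator split: those from space turn the factors
    \<open>- \<i> * \<xi>\<close> of a differentiated transform into \<open>\<i> * \<xi>\<close>,
    where \<open>symb\<close> evaluates the polynomial, and those from time are absorbed by
    \<open>neg_deriv ^^ j\<close>.\<close>
  have eq_fourier: "(\<Sum>j\<le>degree p. u ((neg_deriv ^^ j) \<phi>) (fourier (\<lambda>\<xi>. symb (coeff p j) \<xi> * h \<xi>))) = 0"
    if \<phi>: "test_fn \<phi>" and h: "test_fn h" for \<phi> h
  proof -
    have t\<phi>: "test_fn (dlist (replicate j 1) \<phi>)" for j
      by (rule test_fn_dlist[OF \<phi>]) (auto simp: set_replicate_conv_if)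
    have "u ((neg_deriv ^^ j) \<phi>) (fourier (\<lambda>\<xi>. symb (coeff p j) \<xi> * h \<xi>)) =
      (\<Sum>\<alpha>\<in>Poly_Mapping.keys (coeff p j). ?c j \<alpha> * u (dlist (replicate j 1) \<phi>) (dlist (xaxes \<alpha>) (fourier h)))" for j
    proof -
      define m where "m \<alpha> = (\<lambda>\<xi>::real^'d. (\<Prod>b\<leftarrow>xaxes \<alpha>. - \<i> * of_real (\<xi> \<bullet> b)) * h \<xi>)" for \<alpha>
      have m: "dlist (xaxes \<alpha>) (fourier h) = fourier (m \<alpha>)" "test_fn (m \<alpha>)" for \<alpha>
        using dlist_fourier[OF h] by (auto simp: m_def)
      have "(\<lambda>\<xi>. symb (coeff p j) \<xi> * h \<xi>) = (\<lambda>\<xi>. \<Sum>\<alpha>\<in>Poly_Mapping.keys (coeff p j).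
          (Poly_Mapping.lookup (coeff p j) \<alpha> * (-1) ^ (\<Sum>i\<in>UNIV. Poly_Mapping.lookup \<alpha> i)) * m \<alpha> \<xi>)"
      proof
        fix \<xi> :: "real^'d"
        have "(-1) ^ (\<Sum>i\<in>UNIV. Poly_Mapping.lookup \<alpha> i) * (\<Prod>b\<leftarrow>xaxes \<alpha>. - \<i> * complex_of_real (\<xi> \<bullet> b)) =
            (\<Prod>i\<in>UNIV. (\<i> * of_real (\<xi> \<bullet> axis i 1)) ^ Poly_Mapping.lookup \<alpha> i)" for \<alpha>
          unfolding prod_list_xaxes power_sum prod.distrib[symmetric] power_mult_distrib[symmetric] by simp
        then show "symb (coeff p j) \<xi> * h \<xi> = (\<Sum>\<alpha>\<in>Poly_Mapping.keys (coeff p j).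
          (Poly_Mapping.lookup (coeff p j) \<alpha> * (-1) ^ (\<Sum>i\<in>UNIV. Poly_Mapping.lookup \<alpha> i)) * m \<alpha> \<xi>)"
          by (simp add: symb_altdef m_def sum_distrib_right mult.assoc flip: mult.assoc[of "(-1) ^ _"])
      qed
      then have "u ((neg_deriv ^^ j) \<phi>) (fourier (\<lambda>\<xi>. symb (coeff p j) \<xi> * h \<xi>)) =
        (-1) ^ j * (\<Sum>\<alpha>\<in>Poly_Mapping.keys (coeff p j).
          (Poly_Mapping.lookup (coeff p j) \<alpha> * (-1) ^ (\<Sum>i\<in>UNIV. Poly_Mapping.lookup \<alpha> i)) *
          u (dlist (replicate j 1) \<phi>) (fourier (m \<alpha>)))"
        using distribution_cmult[OF dist[OF schwartz_fourier[OF test_fn_mult_left[OF smooth_symb[of "coeff p j"] h]]]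
            t\<phi>[of j], of "(-1) ^ j"]
        by (simp add: neg_deriv_pow[OF test_fn_smooth[OF \<phi>]] tempered_fourier_sum[OF temp[OF t\<phi>] finite_keys m(2)])
      then show ?thesis by (simp add: m(1) sum_distrib_left power_add mult_ac)
    qed
    then show ?thesis using eq_schwartz[OF \<phi> schwartz_fourier[OF h]] by simp
  qed
  \<comment> \<open>Since \<open>u\<close> vanishes in the past, cutting off there extends it to \<open>past_functions\<close>, on which the
    time derivative is invertible.\<close>
  define \<theta> where "\<theta> = (\<lambda>t. complex_of_real (smooth_step (t + 2)))"
  have \<theta>: "smooth_fn \<theta>" "\<And>t. t \<le> -2 \<Longrightarrow> \<theta> t = 0" "\<And>t. t \<ge> -1 \<Longrightarrow> \<theta> t = 1"
  proof -
    have "smooth_fn (\<lambda>t::real. complex_of_real (smooth_step (Re (complex_of_real t + 2))))"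
      using smooth_linear[OF bounded_linear_ident] by (intro smooth_smooth_step smooth_intros) auto
    then show "smooth_fn \<theta>" by (simp add: \<theta>_def)
  qed (auto simp: \<theta>_def smooth_step_zero smooth_step_one)
  have \<theta>_past: "smooth_fn (\<lambda>t. \<theta> t * \<phi> t)" "\<And>t. t \<notin> {-2..T} \<Longrightarrow> \<theta> t * \<phi> t = 0" "test_fn (\<lambda>t. \<theta> t * \<phi> t)"
    if "\<phi> \<in> past_functions T" for \<phi> T
  proof -
    show sm: "smooth_fn (\<lambda>t. \<theta> t * \<phi> t)" using that by (intro smooth_intros \<theta>(1)) (simp add: past_functions_def)
    show *: "\<theta> t * \<phi> t = 0" if "t \<notin> {-2..T}" for t
      using that \<theta>(2)[of t] \<open>\<phi> \<in> past_functions T\<close> by (cases "t \<le> -2") (auto simp: past_functions_def)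
    show "test_fn (\<lambda>t. \<theta> t * \<phi> t)"
      by (rule box_test_fn[of _ "-2" T, OF sm]) (use * in auto)
  qed
  have zero_on_fourier: "u \<phi> (fourier g) = 0" if g: "test_fn g" for g
  proof -
    obtain r where r: "\<And>t. \<phi> t \<noteq> 0 \<Longrightarrow> norm t \<le> r" using test_fn_bounded[OF \<phi>] by (auto simp: bounded_iff)
    define T where "T = r + 1"
    have \<phi>T: "\<phi> \<in> past_functions T"
      using r test_fn_smooth[OF \<phi>] by (force simp: past_functions_def T_def)
    obtain a where a: "\<And>x. x \<notin> cbox (-a) a \<Longrightarrow> g x = 0" using bounded_supportE[OF test_fn_bounded[OF g]] by metis
    define L where "L = cbox (-a) a"
    have L: "compact L" by (simp add: L_def)
    \<comment> \<open>The window \<open>g\<close> confines frequencies to the compact set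
      \<open>L\<close>, so that every smooth \<open>h\<close> is admissible, in particular the
      constant 1.\<close>
    define w where "w \<phi> h = u (\<lambda>t. \<theta> t * \<phi> t) (fourier (\<lambda>\<xi>. g \<xi> * h \<xi>))" for \<phi> h
    have "w \<phi> (\<lambda>_. 1) = 0"
    \<comment> \<open>With \<open>f = 0\<close> the induction starts from the coefficients alone;
      \<open>n\<close> is \<open>Suc (degree p)\<close> because they are indexed by
      \<open>j < n\<close>. The lower end -2 is where \<open>\<theta>\<close> begins.\<close>
    proof (rule pairing_unique_continuation[where l = "-2" and T = T and L = L and n = "Suc (degree p)"
          and a = "\<lambda>j. symb (coeff p j)" and f = "\<lambda>_. 0" and w = w and h = "\<lambda>_. 1"])
      have "w \<phi> (\<lambda>x. h x + k x) = w \<phi> h + w \<phi> k"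
        if "\<phi> \<in> past_functions T" "smooth_fn h" "smooth_fn k" for \<phi> h k
      proof -
        have "fourier (\<lambda>\<xi>. g \<xi> * (h \<xi> + k \<xi>)) = (\<lambda>x. fourier (\<lambda>\<xi>. g \<xi> * h \<xi>) x + fourier (\<lambda>\<xi>. g \<xi> * k \<xi>) x)"
          using fourier_add[OF test_fn_mult_right[OF g that(2)] test_fn_mult_right[OF g that(3)]]
          by (auto simp: distrib_left)
        then show ?thesis
          unfolding w_def
          using tempered_add[OF temp[OF \<theta>_past(3)[OF that(1)]] schwartz_fourier[OF test_fn_mult_right[OF g that(2)]]
              schwartz_fourier[OF test_fn_mult_right[OF g that(3)]]] by simp
      qed
      moreover have "\<exists>N. \<exists>C\<ge>0. pairing_le (-2) T L N C w"
      proof -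
        \<comment> \<open>A single order and constant for the interval \<open>{-2..T}\<close>,
          outside which every \<open>\<lambda>t. \<theta> t * \<phi> t\<close> with
          \<open>\<phi>\<close> in \<open>past_functions T\<close> vanishes.\<close>
        have "\<exists>N C. 0 \<le> C \<and> (\<forall>\<phi> \<psi> A B. smooth_fn \<phi> \<longrightarrow> (\<forall>t. t \<notin> {-2..T} \<longrightarrow> \<phi> t = 0) \<longrightarrow>
            schwartz \<psi> \<longrightarrow> (\<forall>t. pbound N \<phi> t A) \<longrightarrow> sbound N \<psi> B \<longrightarrow> norm (u \<phi> \<psi>) \<le> C * A * B)"
          by (rule joint_continuity[OF _ _ compact_Icc]) (rule dist temp; assumption)+
        then obtain N C where C0: "0 \<le> C" "\<forall>\<phi> \<psi> A B. smooth_fn \<phi> \<longrightarrow> (\<forall>t. t \<notin> {-2..T} \<longrightarrow> \<phi> t = 0) \<longrightarrow>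
            schwartz \<psi> \<longrightarrow> (\<forall>t. pbound N \<phi> t A) \<longrightarrow> sbound N \<psi> B \<longrightarrow> norm (u \<phi> \<psi>) \<le> C * A * B"
          by (elim exE conjE) (rule that)
        note C = C0(1) C0(2)[rule_format]
        obtain C' where C0': "0 \<le> C'" "\<forall>g B. smooth_fn g \<longrightarrow> (\<forall>\<xi>. \<xi> \<notin> cbox (-a) a \<longrightarrow> g \<xi> = 0) \<longrightarrow>
            (\<forall>\<xi>\<in>cbox (-a) a. pbound N g \<xi> B) \<longrightarrow> 0 \<le> B \<longrightarrow> sbound N (fourier g) (C' * B)"
          using fourier_sbound[of "-a" a N] by (elim exE conjE) (rule that)
        note C' = C0'(1) C0'(2)[rule_format]
        obtain M where M: "0 \<le> M" "\<And>t. t \<in> {-2..T} \<Longrightarrow> pbound N \<theta> t M"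
          using pbound_compact[OF \<theta>(1) compact_Icc] by metis
        obtain M' where M': "0 \<le> M'" "\<And>x. pbound N g x M'" using pbound_test[OF g] by metis
        have "pairing_le (-2) T L N (C * (2 ^ N * M) * (C' * (2 ^ N * M'))) w"
          unfolding pairing_le_def
        proof (intro ballI allI impI)
          fix \<phi> h A B assume *: "\<phi> \<in> past_functions T" "smooth_fn h" "0 \<le> A" "0 \<le> B"
            "\<forall>t\<in>{-2..T}. pbound N \<phi> t A" "\<forall>x\<in>L. pbound N h x B"
          have "pbound N (\<lambda>t. \<theta> t * \<phi> t) t (2 ^ N * M * A)" for t
          proof (cases "t \<in> {-2..T}")
            case True
            then show ?thesis
              using * M \<theta>(1) past_functions_smooth[OF *(1)] by (intro pbound_mult) auto
          next
            case False
            have "dlist bs (\<lambda>t. \<theta> t * \<phi> t) t = 0" for bs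
              using dlist_local[of "- {-2..T}" "\<lambda>t. \<theta> t * \<phi> t" "\<lambda>_. 0" t bs] \<theta>_past(2)[OF *(1)] False by auto
            then show ?thesis using M * by (auto simp: pbound_def)
          qed
          moreover have "sbound N (fourier (\<lambda>\<xi>. g \<xi> * h \<xi>)) (C' * (2 ^ N * M' * B))"
            using * M' a test_fn_smooth[OF g] by (intro C'(2) smooth_intros ballI pbound_mult) (auto simp: L_def)
          ultimately have "norm (w \<phi> h) \<le> C * (2 ^ N * M * A) * (C' * (2 ^ N * M' * B))"
            unfolding w_def using \<theta>_past[OF *(1)]
            by (intro C(2) schwartz_fourier test_fn_mult_right g *) auto
          then show "norm (w \<phi> h) \<le> C * (2 ^ N * M) * (C' * (2 ^ N * M')) * A * B" by (simp add: mult_ac)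
        qed
        moreover have "0 \<le> C * (2 ^ N * M) * (C' * (2 ^ N * M'))" using C(1) C'(1) M(1) M'(1) by simp
        ultimately show ?thesis by blast
      qed
      ultimately show "bounded_pairing (-2) T L w" by (simp add: bounded_pairing_def)
      show "w \<phi> (\<lambda>x. 0 * h x) = 0" if "\<phi> \<in> past_functions T" for \<phi> h
        using tempered_zero[OF temp[OF \<theta>_past(3)[OF that]]] by (simp add: w_def fourier_zero)
      show "(\<Sum>j<Suc (degree p). w ((neg_deriv ^^ j) \<phi>) (\<lambda>x. symb (coeff p j) x * h x)) = 0"
        if \<phi>: "\<phi> \<in> past_functions T" and h: "smooth_fn h" for \<phi> h
      proof -
        have tgh: "test_fn (\<lambda>\<xi>. g \<xi> * h \<xi>)" by (rule test_fn_mult_right[OF g h])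
        have "w ((neg_deriv ^^ j) \<phi>) (\<lambda>x. symb (coeff p j) x * h x) =
          u ((neg_deriv ^^ j) (\<lambda>t. \<theta> t * \<phi> t)) (fourier (\<lambda>\<xi>. symb (coeff p j) \<xi> * (g \<xi> * h \<xi>)))" for j
        proof -
          let ?a = "\<lambda>t. \<theta> t * (neg_deriv ^^ j) \<phi> t" and ?b = "(neg_deriv ^^ j) (\<lambda>t. \<theta> t * \<phi> t)"
          let ?\<psi> = "fourier (\<lambda>\<xi>. symb (coeff p j) \<xi> * (g \<xi> * h \<xi>))"
          have \<psi>: "schwartz ?\<psi>" by (intro schwartz_fourier test_fn_mult_left smooth_symb tgh)
          have ta: "test_fn ?a" by (rule \<theta>_past(3)[OF neg_deriv_pow_past[OF \<phi>]])
          have tb: "test_fn ?b"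
            unfolding neg_deriv_pow[OF \<theta>_past(1)[OF \<phi>]]
            by (intro test_fn_cmult test_fn_dlist \<theta>_past(3)[OF \<phi>]) (auto simp: set_replicate_conv_if)
          \<comment> \<open>Cutting off before or after differentiating makes a difference only for
            \<open>t \<le> -1\<close>, since \<open>\<theta>\<close> is 1 beyond, and there
            \<open>u\<close> vanishes.\<close>
          have "u (\<lambda>t. ?a t - ?b t) ?\<psi> = 0"
          proof (rule past[OF test_fn_diff[OF ta tb] _ \<psi>])
            fix t :: real assume t: "t > -1"
            have "dlist (replicate j 1) (\<lambda>t. \<theta> t * \<phi> t) t = dlist (replicate j 1) \<phi> t"
              by (rule dlist_local[of "{-1<..}"]) (use t \<theta>(3) in auto)
            then show "?a t - ?b t = 0"
              using t \<theta>(3)[of t]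
              by (simp add: neg_deriv_pow[OF \<theta>_past(1)[OF \<phi>]] neg_deriv_pow[OF past_functions_smooth[OF \<phi>]])
          qed
          then have "u ?a ?\<psi> = u ?b ?\<psi>" using distribution_diff[OF dist[OF \<psi>] ta tb] by simp
          then show ?thesis by (simp add: w_def mult.left_commute)
        qed
        then show ?thesis
          using eq_fourier[OF \<theta>_past(3)[OF \<phi>] tgh] by (simp only: lessThan_Suc_atMost)
      qed
      show "(0::complex) \<noteq> 0 \<or> (\<exists>j<Suc (degree p). symb (coeff p j) x \<noteq> 0)" for x
        using Vset_CX_imag[OF V, of x] by (auto simp: symb_def less_Suc_eq_le)
    qed (auto intro: L \<phi>T smooth_symb smooth_const)
    then have 1: "u (\<lambda>t. \<theta> t * \<phi> t) (fourier g) = 0" by (simp add: w_def)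
    have t1: "test_fn (\<lambda>t. \<theta> t * \<phi> t)" by (rule \<theta>_past(3)[OF \<phi>T])
    have "u (\<lambda>t. \<phi> t - \<theta> t * \<phi> t) (fourier g) = 0"
      by (rule past[OF test_fn_diff[OF \<phi> t1] _ schwartz_fourier[OF g]]) (use \<theta>(3) in auto)
    then show ?thesis using 1 distribution_diff[OF dist[OF schwartz_fourier[OF g]] \<phi> t1] by simp
  qed
  show ?thesis by (rule tempered_zero_if_zero_on_fourier[OF temp[OF \<phi>] zero_on_fourier \<psi>])
qed

lemma distribution_const_zero: "distribution (\<lambda>f. 0)"
  unfolding distribution_def by (auto intro!: exI[of _ 0])

lemma tempered_const_zero: "tempered (\<lambda>f. 0)"
  unfolding tempered_def by (auto intro!: exI[of _ 0])

lemma zero_in_N_L: "(\<lambda>\<phi> \<psi>. 0) \<in> N_L p"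
  unfolding N_L_def Lmaps_def
  by (auto intro!: exI[of _ "\<lambda>_. 0"] distribution_const_zero tempered_const_zero
      simp: represents_def Dp_zero_def vanishes_neg_def)

theorem theorem4p1:
  fixes p :: "'d::finite mpoly poly"
  assumes "p \<noteq> 0"
    and "Vset (CX p) \<inter> imag_Rd = {}"
  shows "N_L p = {(\<lambda>\<phi> \<psi>. 0)}"
proof -
  have "u = (\<lambda>\<phi> \<psi>. 0)" if u: "u \<in> N_L p" for u
  proof (intro ext)
    fix \<phi> \<psi>
    show "u \<phi> \<psi> = 0"
    proof (cases "test_fn \<phi> \<and> schwartz \<psi>")
      case True
      then show ?thesis using N_L_zero[OF u assms(2)] by blast
    next
      case False
      then show ?thesis using u by (auto simp: N_L_def Lmaps_def)
    qed
  qed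
  then show ?thesis using zero_in_N_L by blast
qed

end
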